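(* Let $\{W(t),~t\ge 0\}$ be a continuous modification of a standard Brownian motion, let $Y(0), b, \sigma > 0$ be given constants, put $X(0) := Y(0)^2$, and let $\{\varepsilon_n,~n\ge 1\}$ be an arbitrary sequence of positive numbers such that $\varepsilon_n \downarrow 0$ as $n\to\infty$. For each $n\ge 1$, consider the Cox-Ingersoll-Ross process $X_{\varepsilon_n} = \{X_{\varepsilon_n}(t),~t\ge 0\}$ given by \[ X_{\varepsilon_n}(t) = X(0) + \int_0^t \left(\frac{\sigma^2}{4} + \varepsilon_n - bX_{\varepsilon_n}(s) \right) ds + \sigma\int_0^t \sqrt{X_{\varepsilon_n}(s)}\,dW(s), \quad t\ge 0, \] and denote its square root by $Y_{\varepsilon_n}(t) := \sqrt{X_{\varepsilon_n}(t)}$. Then, with probability 1, 1) the limit $\lim_{n\to\infty } Y_{\varepsilon_n}(t) =: Y(t)$ is well-defined, finite and non-negative for any $t\ge 0$; 2) the limit process $Y = \{Y(t),~t\ge 0\}$ is a reflected Ornstein-Uhlenbeck process satisfying \[ Y(t) = Y(0) - \frac{b}{2} \int_0^t Y(s) ds + \frac{\sigma}{2} W(t) + L(t),\quad t\ge 0, \] with $Y(0) = \sqrt{X(0)} >0$ and $L$ being the reflection function for $Y$; 3) for any $T>0$ \[ \sup_{t\in[0,T]} |Y(t) - Y_{\varepsilon_n}(t)| \to 0, \quad n\to\infty, \] and \[ \sup_{t\in[0,T]} \left|L(t) - \frac{1}{2}\int_0^t \frac{\varepsilon_n}{Y_{\varepsilon_n}(s)}ds\right| \to 0, \quad n\to\infty.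 \]
   Context: For positive constants $X(0),a,b,\sigma$, the Cox-Ingersoll-Ross (CIR) process is the continuous modification of the unique solution to $X(t) = X(0) + \int_0^t (a - bX(s))ds + \sigma \int_0^t \sqrt{X(s)}\, dW(s)$, $t\ge 0$; it is a known fact that it is non-negative a.s., so its square root is well defined. All $X_{\varepsilon_n}$ are driven by the same Brownian motion $W$. Reflection function: a process $\zeta=\{\zeta(t),~t\ge0\}$ is called a reflection function for a stochastic process $\xi=\{\xi(t),~t\ge 0\}$ if, with probability 1, $\zeta$ is a continuous non-decreasing process such that $\zeta(0)=0$ and the points of growth of $\zeta$ can occur only at zeros of $\xi$. Reflected Ornstein-Uhlenbeck (ROU) process: a stochastic process $\widetilde Y=\{\widetilde Y(t),~t\ge 0\}$ with $\widetilde Y\ge 0$ a.s. satisfying \[ \widetilde Y(t) = Y(0) - \widetilde{b} \int_0^t \widetilde Y(s) ds + \widetilde{\sigma} W(t) + \widetilde L(t),\quad t\ge 0, \] where $Y(0),\widetilde b,\widetilde\sigma$ are positive constants, $W$ is a standard Brownian motion and $\widetilde L$ is a reflection function for $\widetilde Y$. *)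

theory Defs
  imports "HOL-Probability.Probability"
begin

text \<open>
  A process is a function \<open>real \<Rightarrow> 'a \<Rightarrow> real\<close>; only its values at times \<open>t \<ge> 0\<close> matter.
  Path properties are required with probability 1.
\<close>

definition stochastic_process :: "'a measure \<Rightarrow> (real \<Rightarrow> 'a \<Rightarrow> real) \<Rightarrow> bool" where
  "stochastic_process M X \<longleftrightarrow> (\<forall>t\<ge>0. X t \<in> borel_measurable M)"

definition continuous_process :: "'a measure \<Rightarrow> (real \<Rightarrow> 'a \<Rightarrow> real) \<Rightarrow> bool" where
  "continuous_process M X \<longleftrightarrow>
     stochastic_process M X \<and> (AE \<omega> in M. continuous_on {0..} (\<lambda>t. X t \<omega>))"

definition brownian_motion :: "'a measure \<Rightarrow> (real \<Rightarrow> 'a \<Rightarrow> real) \<Rightarrow> bool" where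
  "brownian_motion M W \<longleftrightarrow>
     continuous_process M W \<and>
     (AE \<omega> in M. W 0 \<omega> = 0) \<and>
     (\<forall>s t. 0 \<le> s \<and> s < t \<longrightarrow>
        distributed M lborel (\<lambda>\<omega>. W t \<omega> - W s \<omega>)
          (\<lambda>x. ennreal (normal_density 0 (sqrt (t - s)) x))) \<and>
     (\<forall>(n::nat) \<tau>. 0 \<le> \<tau> 0 \<and> mono \<tau> \<longrightarrow>
        prob_space.indep_vars M (\<lambda>_. borel) (\<lambda>i \<omega>. W (\<tau> (Suc i)) \<omega> - W (\<tau> i) \<omega>) {..<n})"

text \<open>
  A filtration relative to which the Brownian motion \<open>W\<close> is adapted and has increments
  independent of the past, such as the (augmented) natural filtration of \<open>W\<close>.
\<close>

definition brownian_filtration ::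
  "'a measure \<Rightarrow> (real \<Rightarrow> 'a measure) \<Rightarrow> (real \<Rightarrow> 'a \<Rightarrow> real) \<Rightarrow> bool" where
  "brownian_filtration M F W \<longleftrightarrow>
     filtration (space M) F \<and> (\<forall>t. subalgebra M (F t)) \<and>
     (\<forall>t\<ge>0. W t \<in> borel_measurable (F t)) \<and>
     (\<forall>s t. 0 \<le> s \<and> s < t \<longrightarrow>
        prob_space.indep_set M (sets (F s))
          {(\<lambda>\<omega>. W t \<omega> - W s \<omega>) -` A \<inter> space M | A. A \<in> sets borel})"

subsection \<open>The Ito integral\<close>

text \<open>
  The data \<open>(N, \<tau>, \<xi>)\<close> describe the elementary process
  \<open>\<Sum>i<N. \<xi>\<^sub>i 1\<^bsub>(\<tau>\<^sub>i, \<tau>\<^sub>i\<^sub>+\<^sub>1]\<^esub>\<close>, with \<open>\<xi>\<^sub>i\<close> bounded and measurable at time \<open>\<tau>\<^sub>i\<close>.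
\<close>

definition elementary_data ::
  "'a measure \<Rightarrow> (real \<Rightarrow> 'a measure) \<Rightarrow> nat \<Rightarrow> (nat \<Rightarrow> real) \<Rightarrow> (nat \<Rightarrow> 'a \<Rightarrow> real) \<Rightarrow> bool" where
  "elementary_data M F N \<tau> \<xi> \<longleftrightarrow>
     0 \<le> \<tau> 0 \<and> mono \<tau> \<and>
     (\<forall>i<N. \<xi> i \<in> borel_measurable (F (\<tau> i)) \<and> (\<exists>C. \<forall>\<omega>\<in>space M. \<bar>\<xi> i \<omega>\<bar> \<le> C))"

definition elementary_process ::
  "nat \<Rightarrow> (nat \<Rightarrow> real) \<Rightarrow> (nat \<Rightarrow> 'a \<Rightarrow> real) \<Rightarrow> real \<Rightarrow> 'a \<Rightarrow> real" where
  "elementary_process N \<tau> \<xi> s \<omega> = (\<Sum>i<N. \<xi> i \<omega> * indicator {\<tau> i<..\<tau> (Suc i)} s)"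

definition elementary_integral ::
  "(real \<Rightarrow> 'a \<Rightarrow> real) \<Rightarrow> nat \<Rightarrow> (nat \<Rightarrow> real) \<Rightarrow> (nat \<Rightarrow> 'a \<Rightarrow> real) \<Rightarrow> real \<Rightarrow> 'a \<Rightarrow> real" where
  "elementary_integral W N \<tau> \<xi> t \<omega> =
     (\<Sum>i<N. \<xi> i \<omega> * (W (min t (\<tau> (Suc i))) \<omega> - W (min t (\<tau> i)) \<omega>))"

definition tendsto_in_prob :: "'a measure \<Rightarrow> (nat \<Rightarrow> 'a \<Rightarrow> real) \<Rightarrow> ('a \<Rightarrow> real) \<Rightarrow> bool" where
  "tendsto_in_prob M Z Z' \<longleftrightarrow>
     (\<forall>\<delta>>0. (\<lambda>k. measure M {\<omega>\<in>space M. \<bar>Z k \<omega> - Z' \<omega>\<bar> \<ge> \<delta>}) \<longlonglongrightarrow> 0)"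

text \<open>
  \<open>I\<close> is the continuous version of \<open>\<integral>\<^sub>0\<^sup>t H dW\<close>, defined for adapted \<open>H\<close> with locally
  square-integrable paths: elementary processes approximate \<open>H\<close> in \<open>L\<^sup>2[0,T]\<close> almost surely
  and their integrals converge to \<open>I\<close> in probability. This determines \<open>I\<close> up to
  indistinguishability, whatever the approximating sequence.
\<close>

definition ito_integral ::
  "'a measure \<Rightarrow> (real \<Rightarrow> 'a measure) \<Rightarrow> (real \<Rightarrow> 'a \<Rightarrow> real) \<Rightarrow> (real \<Rightarrow> 'a \<Rightarrow> real) \<Rightarrow>
   (real \<Rightarrow> 'a \<Rightarrow> real) \<Rightarrow> bool" where
  "ito_integral M F W H I \<longleftrightarrow>
     continuous_process M I \<and>
     (\<exists>N \<tau> \<xi>.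
        (\<forall>k. elementary_data M F (N k) (\<tau> k) (\<xi> k)) \<and>
        (AE \<omega> in M. \<forall>T\<ge>0.
           (\<lambda>k. \<integral>\<^sup>+s\<in>{0..T}.
              ennreal ((elementary_process (N k) (\<tau> k) (\<xi> k) s \<omega> - H s \<omega>)\<^sup>2) \<partial>lborel) \<longlonglongrightarrow> 0) \<and>
        (\<forall>t\<ge>0. tendsto_in_prob M
           (\<lambda>k. elementary_integral W (N k) (\<tau> k) (\<xi> k) t) (I t)))"

subsection \<open>Cox-Ingersoll-Ross and reflected Ornstein-Uhlenbeck processes\<close>

text \<open>
  Nonnegativity is part of being a solution: the equation involves \<open>sqrt (X s)\<close>, and HOL's
  \<open>sqrt\<close> is a total, odd function. By pathwise uniqueness the choice of the filtration is immaterial.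
\<close>

definition cir_process ::
  "'a measure \<Rightarrow> (real \<Rightarrow> 'a \<Rightarrow> real) \<Rightarrow> real \<Rightarrow> real \<Rightarrow> real \<Rightarrow> real \<Rightarrow> (real \<Rightarrow> 'a \<Rightarrow> real) \<Rightarrow> bool" where
  "cir_process M W x0 a b \<sigma> X \<longleftrightarrow>
     0 < x0 \<and> 0 < a \<and> 0 < b \<and> 0 < \<sigma> \<and>
     continuous_process M X \<and> (AE \<omega> in M. \<forall>t\<ge>0. 0 \<le> X t \<omega>) \<and>
     (\<exists>F I. brownian_filtration M F W \<and> (\<forall>t\<ge>0. X t \<in> borel_measurable (F t)) \<and>
        ito_integral M F W (\<lambda>s \<omega>. sqrt (X s \<omega>)) I \<and>
        (AE \<omega> in M. \<forall>t\<ge>0.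
           X t \<omega> = x0 + (LBINT s:{0..t}. a - b * X s \<omega>) + \<sigma> * I t \<omega>))"

text \<open>A point of growth has no neighbourhood in \<open>[0, \<infinity>)\<close> on which \<open>f\<close> is constant.\<close>

definition growth_point :: "(real \<Rightarrow> real) \<Rightarrow> real \<Rightarrow> bool" where
  "growth_point f t \<longleftrightarrow> 0 \<le> t \<and> (\<forall>\<delta>>0. f (max 0 (t - \<delta>)) < f (t + \<delta>))"

definition reflection_function ::
  "'a measure \<Rightarrow> (real \<Rightarrow> 'a \<Rightarrow> real) \<Rightarrow> (real \<Rightarrow> 'a \<Rightarrow> real) \<Rightarrow> bool" where
  "reflection_function M \<xi> \<zeta> \<longleftrightarrow>
     continuous_process M \<zeta> \<and>
     (AE \<omega> in M. mono_on {0..} (\<lambda>t. \<zeta> t \<omega>) \<and> \<zeta> 0 \<omega> = 0 \<and>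
        (\<forall>t. growth_point (\<lambda>s. \<zeta> s \<omega>) t \<longrightarrow> \<xi> t \<omega> = 0))"

text \<open>\<open>L\<close> is the reflection function for \<open>Y\<close> that appears in the equation.\<close>

definition reflected_OU_process ::
  "'a measure \<Rightarrow> (real \<Rightarrow> 'a \<Rightarrow> real) \<Rightarrow> real \<Rightarrow> real \<Rightarrow> real \<Rightarrow>
   (real \<Rightarrow> 'a \<Rightarrow> real) \<Rightarrow> (real \<Rightarrow> 'a \<Rightarrow> real) \<Rightarrow> bool" where
  "reflected_OU_process M W y0 b \<sigma> Y L \<longleftrightarrow>
     0 < y0 \<and> 0 < b \<and> 0 < \<sigma> \<and>
     stochastic_process M Y \<and> (AE \<omega> in M. \<forall>t\<ge>0. 0 \<le> Y t \<omega>) \<and>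
     reflection_function M Y L \<and>
     (AE \<omega> in M. \<forall>t\<ge>0. set_integrable lborel {0..t} (\<lambda>s. Y s \<omega>) \<and>
        Y t \<omega> = y0 - b * (LBINT s:{0..t}. Y s \<omega>) + \<sigma> * W t \<omega> + L t \<omega>)"

text \<open>
  \<open>\<integral>\<^sub>0\<^sup>t \<epsilon> / y(s) ds\<close> for a nonnegative function \<open>y\<close>, as an integral with values in \<open>[0, \<infinity>]\<close>.
  Division in \<open>ennreal\<close> makes the integrand \<open>\<infinity>\<close> at the zeros of \<open>y\<close> (if \<open>\<epsilon> > 0\<close>), whereas real
  division would make it 0.
\<close>

definition recip_integral :: "real \<Rightarrow> (real \<Rightarrow> real) \<Rightarrow> real \<Rightarrow> ereal" where
  "recip_integral \<epsilon> y t = enn2ereal (\<integral>\<^sup>+s\<in>{0..t}. ennreal \<epsilon> / ennreal (y s) \<partial>lborel)"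

end

theory Submission
  imports Defs
begin

text \<open>
  The square root \<open>Y\<^sub>n = sqrt (X\<^sub>n)\<close> satisfies an equation without stochastic integral,
  \<open>Y\<^sub>n t = y0 + 1/2 \<integral>\<^sub>0\<^sup>t \<epsilon>\<^sub>n / Y\<^sub>n ds - b/2 \<integral>\<^sub>0\<^sup>t Y\<^sub>n ds + \<sigma>/2 W t\<close>, because the constant
  \<open>\<sigma>\<^sup>2 / 4\<close> in the drift of \<open>X\<^sub>n\<close> cancels the second-order term of Ito's formula. Once this is known
  for almost every \<open>\<omega>\<close>, everything else is a statement about individual continuous paths, and the
  processes \<open>X\<^sub>n\<close>, which need not be adapted to a common filtration, can be compared path by path.

  The equation for one process (\<open>cir_sqrt_singular_solution\<close>). The square root is not smooth at 0, and
  \<open>X\<^sub>n\<close> may hit 0, so Ito's formula is first proved for \<open>sqrt (X\<^sub>n + \<delta>)\<close> (\<open>ito_formula_sqrt\<close>). It is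
  obtained on uniform grids from an exact algebraic identity for increments of square roots
  (\<open>sqrt_path_expansion\<close>) and three facts in probability: increments of \<open>\<integral> H dW\<close> may be replaced by
  \<open>H \<Delta>W\<close> (\<open>ito_increment_approximation\<close>), \<open>(\<Delta>W)\<^sup>2\<close> may be replaced by the cell length
  (\<open>quadratic_variation\<close>), and the stochastic integral that appears differs from \<open>W / 2\<close> by a remainder
  whose mean square is at most the expected time integral of
  \<open>(1/2 - sqrt X / (2 sqrt (X + \<delta>)))\<^sup>2\<close>. The Ito integral is given as a limit in probability of
  elementary integrals; the estimate behind all of this is that an elementary integral is small in
  probability if its variance process is (\<open>truncated_sum_bound\<close>), which follows from orthogonality of
  increments after cutting the integrand off when its accumulated variance gets too large.

  As \<open>\<delta>\<close> tends to 0, the mean square bound and Fatou's lemma show that \<open>\<integral> \<epsilon> / sqrt X ds\<close> is finite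
  almost surely. So \<open>X\<close> vanishes at almost no time, the remainder tends to 0 by dominated convergence,
  and the equation for \<open>sqrt X\<close> results at each fixed time, hence at all rational times, and by
  monotonicity of the singular integral at all times.

  Convergence (\<open>singular_solution_difference\<close>, locale \<open>singular_limit\<close>). Let \<open>y\<close> and \<open>y'\<close> solve the
  equation with the same path \<open>w\<close> and with parameters \<open>\<epsilon>\<close> and \<open>\<epsilon>'\<close>. Where \<open>y - y'\<close> is large, \<open>y\<close> is
  large and its singular drift \<open>\<epsilon> / y\<close> is small, while the other terms decrease the difference. This
  gives \<open>y t - y' t \<le> sqrt (2 \<epsilon> t)\<close>. Hence the solutions form a uniform Cauchy sequence on compact
  intervals, with explicit rate, and so do the terms \<open>1/2 \<integral> \<epsilon>\<^sub>n / Y\<^sub>n ds\<close>, by the equation. The limit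
  \<open>L\<close> of the latter is nondecreasing, and constant near any time with \<open>Y > 0\<close>, since there \<open>Y\<^sub>n\<close> is
  bounded below and \<open>\<epsilon>\<^sub>n / Y\<^sub>n\<close> tends to 0 uniformly. So \<open>L\<close> is the reflection function of \<open>Y\<close>.
\<close>

section \<open>Convergence in probability\<close>

context prob_space
begin

text \<open>
  Dominated convergence for the indicators of the sets.
\<close>
lemma prob_tendsto_0_if_AE_eventually_notin:
  assumes [measurable]: "\<And>k. A k \<in> events"
    and ev: "AE \<omega> in M. \<forall>\<^sub>F k in sequentially. \<omega> \<notin> A k"
  shows "(\<lambda>k. prob (A k)) \<longlonglongrightarrow> 0"
proof -
  have "(\<lambda>k. \<integral>\<omega>. indicator (A k) \<omega> \<partial>M) \<longlonglongrightarrow> (\<integral>\<omega>. (0::real) \<partial>M)"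
  proof (rule integral_dominated_convergence[where w = "\<lambda>_. 1"])
    show "AE \<omega> in M. (\<lambda>k. indicator (A k) \<omega> :: real) \<longlonglongrightarrow> 0"
      using ev
    proof eventually_elim
      case (elim \<omega>)
      then have "\<forall>\<^sub>F k in sequentially. (indicator (A k) \<omega> :: real) = 0"
        by eventually_elim simp
      then show ?case by (rule tendsto_eventually)
    qed
  qed (auto simp: indicator_def)
  then show ?thesis by simp
qed

text \<open>
  Choosing \<open>\<kappa> m\<close> so large that \<open>B m (\<kappa> m)\<close> has probability at most \<open>2\<^sup>-\<^sup>m\<close> makes the
  Borel-Cantelli lemma applicable. The lemma serves both to extract almost surely convergent
  subsequences and to pick a sufficiently fine approximation for each mesh.
\<close>
lemma diagonal_selection:
  assumes [measurable]: "\<And>m k. B m k \<in> events"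
    and lim: "\<And>m. (\<lambda>k. prob (B m k)) \<longlonglongrightarrow> 0"
  shows "\<exists>\<kappa>. (\<forall>m. m \<le> \<kappa> m) \<and> (AE \<omega> in M. \<forall>\<^sub>F m in sequentially. \<omega> \<notin> B m (\<kappa> m))"
proof -
  have "\<exists>k\<ge>m. prob (B m k) \<le> (1/2)^m" for m
  proof -
    have "\<forall>\<^sub>F k in sequentially. prob (B m k) < (1/2)^m"
      using lim[of m] by (rule order_tendstoD) simp
    then obtain N where "\<And>k. k \<ge> N \<Longrightarrow> prob (B m k) < (1/2)^m"
      by (auto simp: eventually_sequentially)
    then have "prob (B m (max m N)) \<le> (1/2)^m" by (simp add: less_imp_le)
    then show ?thesis by (intro exI[of _ "max m N"]) auto
  qed
  then obtain \<kappa> where \<kappa>: "\<And>m. m \<le> \<kappa> m" "\<And>m. prob (B m (\<kappa> m)) \<le> (1/2)^m"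
    by metis
  have "summable (\<lambda>m. prob (B m (\<kappa> m)))"
    by (rule summable_comparison_test'[of "\<lambda>m. (1/2)^m"]) (use \<kappa>(2) in auto)
  then have "AE \<omega> in M. \<forall>\<^sub>F m in sequentially. \<omega> \<in> space M - B m (\<kappa> m)"
    by (intro borel_cantelli_AE1) (auto simp: emeasure_eq_measure)
  then have "AE \<omega> in M. \<forall>\<^sub>F m in sequentially. \<omega> \<notin> B m (\<kappa> m)"
    by eventually_elim (auto elim: eventually_mono)
  with \<kappa>(1) show ?thesis by blast
qed

lemma tendsto_in_prob_if_AE:
  assumes [measurable]: "\<And>k. Z k \<in> borel_measurable M" "Z' \<in> borel_measurable M"
    and lim: "AE \<omega> in M. (\<lambda>k. Z k \<omega>) \<longlonglongrightarrow> Z' \<omega>"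
  shows "tendsto_in_prob M Z Z'"
  unfolding tendsto_in_prob_def
proof (intro allI impI)
  fix \<delta> :: real assume "\<delta> > 0"
  show "(\<lambda>k. prob {\<omega> \<in> space M. \<delta> \<le> \<bar>Z k \<omega> - Z' \<omega>\<bar>}) \<longlonglongrightarrow> 0"
  proof (rule prob_tendsto_0_if_AE_eventually_notin)
    show "AE \<omega> in M. \<forall>\<^sub>F k in sequentially. \<omega> \<notin> {\<omega> \<in> space M. \<delta> \<le> \<bar>Z k \<omega> - Z' \<omega>\<bar>}"
      using lim
    proof eventually_elim
      case (elim \<omega>)
      then have "\<forall>\<^sub>F k in sequentially. dist (Z k \<omega>) (Z' \<omega>) < \<delta>"
        using \<open>\<delta> > 0\<close> by (rule tendstoD)
      then show ?case by eventually_elim (auto simp: dist_real_def)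
    qed
  qed measurable
qed

lemma tendsto_in_prob_AE_subsequence:
  assumes [measurable]: "\<And>k. Z k \<in> borel_measurable M" "Z' \<in> borel_measurable M"
    and lim: "tendsto_in_prob M Z Z'"
  shows "\<exists>r. (\<forall>n. n \<le> r n) \<and> (AE \<omega> in M. (\<lambda>n. Z (r n) \<omega>) \<longlonglongrightarrow> Z' \<omega>)"
proof -
  define B where "B m k = {\<omega> \<in> space M. 1 / real (Suc m) \<le> \<bar>Z k \<omega> - Z' \<omega>\<bar>}" for m k
  have "\<exists>\<kappa>. (\<forall>m. m \<le> \<kappa> m) \<and> (AE \<omega> in M. \<forall>\<^sub>F m in sequentially. \<omega> \<notin> B m (\<kappa> m))"
  proof (rule diagonal_selection)
    show "B m k \<in> events" for m k unfolding B_def by measurable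
    show "(\<lambda>k. prob (B m k)) \<longlonglongrightarrow> 0" for m
      using lim unfolding tendsto_in_prob_def B_def by simp
  qed
  then obtain r where r: "\<And>m. m \<le> r m" and ae: "AE \<omega> in M. \<forall>\<^sub>F m in sequentially. \<omega> \<notin> B m (r m)"
    by blast
  have "AE \<omega> in M. (\<lambda>n. Z (r n) \<omega>) \<longlonglongrightarrow> Z' \<omega>"
    using ae AE_space
  proof eventually_elim
    case (elim \<omega>)
    have "\<forall>\<^sub>F n in sequentially. norm (Z (r n) \<omega> - Z' \<omega>) \<le> 1 / real (Suc n)"
      using elim(1) by eventually_elim (use elim(2) in \<open>auto simp: B_def\<close>)
    then have "(\<lambda>n. Z (r n) \<omega> - Z' \<omega>) \<longlonglongrightarrow> 0"
      by (intro tendsto_0_le[where K = 1, OF LIMSEQ_Suc[OF lim_1_over_n[where 'a = real]]]) (auto elim: eventually_mono)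
    then show ?case by (simp add: LIM_zero_iff)
  qed
  with r show ?thesis by blast
qed

lemma tendsto_in_prob_0_le:
  assumes [measurable]: "\<And>k. V k \<in> borel_measurable M"
    and V: "tendsto_in_prob M V (\<lambda>_. 0)"
    and le: "\<And>k. AE \<omega> in M. \<bar>Z k \<omega>\<bar> \<le> \<bar>V k \<omega>\<bar>"
  shows "tendsto_in_prob M Z (\<lambda>_. 0)"
  unfolding tendsto_in_prob_def
proof (intro allI impI)
  fix \<delta> :: real assume "\<delta> > 0"
  have mono: "prob {\<omega> \<in> space M. \<delta> \<le> \<bar>Z k \<omega> - 0\<bar>} \<le> prob {\<omega> \<in> space M. \<delta> \<le> \<bar>V k \<omega> - 0\<bar>}" for k
  proof (rule finite_measure_mono_AE)
    show "AE \<omega> in M. \<omega> \<in> {\<omega> \<in> space M. \<delta> \<le> \<bar>Z k \<omega> - 0\<bar>} \<longrightarrow>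
        \<omega> \<in> {\<omega> \<in> space M. \<delta> \<le> \<bar>V k \<omega> - 0\<bar>}"
      using le[of k] by eventually_elim auto
  qed measurable
  show "(\<lambda>k. prob {\<omega> \<in> space M. \<delta> \<le> \<bar>Z k \<omega> - 0\<bar>}) \<longlonglongrightarrow> 0"
  proof (rule tendsto_sandwich[OF _ _ tendsto_const])
    show "\<forall>\<^sub>F k in sequentially. prob {\<omega> \<in> space M. \<delta> \<le> \<bar>Z k \<omega> - 0\<bar>} \<le> prob {\<omega> \<in> space M. \<delta> \<le> \<bar>V k \<omega> - 0\<bar>}"
      using mono by simp
    show "(\<lambda>k. prob {\<omega> \<in> space M. \<delta> \<le> \<bar>V k \<omega> - 0\<bar>}) \<longlonglongrightarrow> 0"
      using V \<open>\<delta> > 0\<close> unfolding tendsto_in_prob_def by blast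
  qed simp
qed

lemma tendsto_in_prob_0_add:
  assumes [measurable]: "\<And>k. Z1 k \<in> borel_measurable M" "\<And>k. Z2 k \<in> borel_measurable M"
    and Z: "tendsto_in_prob M Z1 (\<lambda>_. 0)" "tendsto_in_prob M Z2 (\<lambda>_. 0)"
  shows "tendsto_in_prob M (\<lambda>k \<omega>. Z1 k \<omega> + Z2 k \<omega>) (\<lambda>_. 0)"
  unfolding tendsto_in_prob_def
proof (intro allI impI)
  fix \<delta> :: real assume "\<delta> > 0"
  let ?P = "\<lambda>Z k. prob {\<omega> \<in> space M. \<delta> / 2 \<le> \<bar>Z k \<omega> - 0\<bar>}"
  show "(\<lambda>k. prob {\<omega> \<in> space M. \<delta> \<le> \<bar>Z1 k \<omega> + Z2 k \<omega> - 0\<bar>}) \<longlonglongrightarrow> 0"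
  proof (rule tendsto_sandwich[OF _ _ tendsto_const])
    have "prob {\<omega> \<in> space M. \<delta> \<le> \<bar>Z1 k \<omega> + Z2 k \<omega> - 0\<bar>} \<le> ?P Z1 k + ?P Z2 k" for k
    proof -
      have "prob {\<omega> \<in> space M. \<delta> \<le> \<bar>Z1 k \<omega> + Z2 k \<omega> - 0\<bar>} \<le>
        prob ({\<omega> \<in> space M. \<delta> / 2 \<le> \<bar>Z1 k \<omega> - 0\<bar>} \<union> {\<omega> \<in> space M. \<delta> / 2 \<le> \<bar>Z2 k \<omega> - 0\<bar>})"
        by (intro finite_measure_mono) auto
      also have "\<dots> \<le> ?P Z1 k + ?P Z2 k" by (intro measure_Un_le) auto
      finally show ?thesis .
    qed
    then show "\<forall>\<^sub>F k in sequentially. prob {\<omega> \<in> space M. \<delta> \<le> \<bar>Z1 k \<omega> + Z2 k \<omega> - 0\<bar>} \<le> ?P Z1 k + ?P Z2 k"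
      by simp
    show "(\<lambda>k. ?P Z1 k + ?P Z2 k) \<longlonglongrightarrow> 0"
      using Z half_gt_zero[OF \<open>\<delta> > 0\<close>] unfolding tendsto_in_prob_def by (intro tendsto_add_zero) blast+
  qed simp
qed

lemma tendsto_in_prob_0_if_L2:
  assumes [measurable]: "\<And>k. Z k \<in> borel_measurable M"
    and int: "\<And>k. integrable M (\<lambda>\<omega>. (Z k \<omega>)\<^sup>2)"
    and lim: "(\<lambda>k. \<integral>\<omega>. (Z k \<omega>)\<^sup>2 \<partial>M) \<longlonglongrightarrow> 0"
  shows "tendsto_in_prob M Z (\<lambda>_. 0)"
  unfolding tendsto_in_prob_def
proof (intro allI impI)
  fix \<delta> :: real assume "\<delta> > 0"
  show "(\<lambda>k. prob {\<omega> \<in> space M. \<delta> \<le> \<bar>Z k \<omega> - 0\<bar>}) \<longlonglongrightarrow> 0"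
  proof (rule tendsto_sandwich[OF _ _ tendsto_const])
    show "\<forall>\<^sub>F k in sequentially. prob {\<omega> \<in> space M. \<delta> \<le> \<bar>Z k \<omega> - 0\<bar>} \<le> (\<integral>\<omega>. (Z k \<omega>)\<^sup>2 \<partial>M) / \<delta>\<^sup>2"
      using second_moment_method[OF _ int \<open>\<delta> > 0\<close>] by simp
    show "(\<lambda>k. (\<integral>\<omega>. (Z k \<omega>)\<^sup>2 \<partial>M) / \<delta>\<^sup>2) \<longlonglongrightarrow> 0"
      using tendsto_divide_zero[OF lim] by simp
  qed simp
qed

text \<open>
  This is the form in which the truncation argument for stochastic integrals is used:
  \<open>V\<close> is the accumulated variance, and \<open>\<eta>\<close> the level at which it is cut off.
\<close>
lemma tendsto_in_prob_0_if_variance_control: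
  assumes [measurable]: "\<And>k. V k \<in> borel_measurable M"
    and V: "AE \<omega> in M. (\<lambda>k. V k \<omega>) \<longlonglongrightarrow> (0::real)"
    and ctrl: "\<And>k x \<eta>. 0 < x \<Longrightarrow> 0 < \<eta> \<Longrightarrow>
      prob {\<omega> \<in> space M. x \<le> \<bar>Z k \<omega>\<bar>} \<le> prob {\<omega> \<in> space M. \<eta> < V k \<omega>} + \<eta> / f x"
    and f: "\<And>x. 0 < x \<Longrightarrow> 0 < f x"
  shows "tendsto_in_prob M Z (\<lambda>_. 0)"
  unfolding tendsto_in_prob_def
proof (intro allI impI)
  fix x :: real assume x: "x > 0"
  have V': "tendsto_in_prob M V (\<lambda>_. 0)" by (rule tendsto_in_prob_if_AE) (use V in auto)
  show "(\<lambda>k. prob {\<omega> \<in> space M. x \<le> \<bar>Z k \<omega> - 0\<bar>}) \<longlonglongrightarrow> 0"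
  proof (rule LIMSEQ_I)
    fix e :: real assume e: "e > 0"
    define \<eta> where "\<eta> = e / 2 * f x"
    have \<eta>: "\<eta> > 0" using e f[OF x] by (simp add: \<eta>_def)
    have "(\<lambda>k. prob {\<omega> \<in> space M. \<eta> \<le> \<bar>V k \<omega> - 0\<bar>}) \<longlonglongrightarrow> 0"
      using V' \<eta> unfolding tendsto_in_prob_def by blast
    then have "\<forall>\<^sub>F k in sequentially. prob {\<omega> \<in> space M. \<eta> \<le> \<bar>V k \<omega> - 0\<bar>} < e / 2"
      using e by (intro order_tendstoD) auto
    then obtain N where N: "\<And>k. k \<ge> N \<Longrightarrow> prob {\<omega> \<in> space M. \<eta> \<le> \<bar>V k \<omega> - 0\<bar>} < e / 2"
      by (auto simp: eventually_sequentially)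
    have "norm (prob {\<omega> \<in> space M. x \<le> \<bar>Z k \<omega> - 0\<bar>} - 0) < e" if "k \<ge> N" for k
    proof -
      have "prob {\<omega> \<in> space M. \<eta> < V k \<omega>} \<le> prob {\<omega> \<in> space M. \<eta> \<le> \<bar>V k \<omega> - 0\<bar>}"
        by (intro finite_measure_mono) auto
      moreover have "\<eta> / f x = e / 2" using f[OF x] by (simp add: \<eta>_def)
      ultimately show ?thesis using ctrl[OF x \<eta>, of k] N[OF that] by simp
    qed
    then show "\<exists>N. \<forall>k\<ge>N. norm (prob {\<omega> \<in> space M. x \<le> \<bar>Z k \<omega> - 0\<bar>} - 0) < e" by blast
  qed
qed

end

section \<open>Everywhere continuous versions\<close>

text \<open>
  The process is the limit of the processes that are frozen between consecutive multiples of \<open>1 / n\<close>,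
  and these are jointly measurable because they involve countably many times.
\<close>
lemma continuous_paths_jointly_measurable:
  fixes h :: "real \<Rightarrow> 'a \<Rightarrow> real"
  assumes [measurable]: "\<And>s. h s \<in> borel_measurable M"
    and cont: "\<And>\<omega>. \<omega> \<in> space M \<Longrightarrow> continuous_on UNIV (\<lambda>s. h s \<omega>)"
  shows "(\<lambda>(s, \<omega>). h s \<omega>) \<in> borel_measurable (lborel \<Otimes>\<^sub>M M)"
proof (rule borel_measurable_LIMSEQ_metric)
  fix n :: nat
  have "(\<lambda>p. h (real_of_int \<lfloor>real (Suc n) * fst p\<rfloor> / real (Suc n)) (snd p)) \<in> borel_measurable (lborel \<Otimes>\<^sub>M M)"
    by (rule measurable_compose_countable'[of UNIV "\<lambda>i p. h (real_of_int i / real (Suc n)) (snd p)"])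
      (auto intro!: countableI_type)
  then show "(\<lambda>(s, \<omega>). h (real_of_int \<lfloor>real (Suc n) * s\<rfloor> / real (Suc n)) \<omega>) \<in> borel_measurable (lborel \<Otimes>\<^sub>M M)"
    by (simp add: split_beta')
next
  fix p :: "real \<times> 'a" assume "p \<in> space (lborel \<Otimes>\<^sub>M M)"
  then obtain s \<omega> where p: "p = (s, \<omega>)" "\<omega> \<in> space M" by (auto simp: space_pair_measure)
  let ?g = "\<lambda>n. real_of_int \<lfloor>real (Suc n) * s\<rfloor> / real (Suc n)"
  have "(\<lambda>n. ?g n - s) \<longlonglongrightarrow> 0"
  proof (rule tendsto_0_le[where K = 1, OF LIMSEQ_Suc[OF lim_1_over_n[where 'a = real]]])
    have "norm (?g n - s) \<le> 1 / real (Suc n)" for n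
    proof -
      have "?g n - s = (real_of_int \<lfloor>real (Suc n) * s\<rfloor> - real (Suc n) * s) / real (Suc n)"
        by (simp add: field_simps)
      moreover have "\<bar>real_of_int \<lfloor>real (Suc n) * s\<rfloor> - real (Suc n) * s\<bar> \<le> 1" by linarith
      ultimately show ?thesis by (simp add: abs_divide divide_right_mono del: of_nat_Suc)
    qed
    then show "\<forall>\<^sub>F n in sequentially. norm (?g n - s) \<le> norm (1 / real (Suc n)) * 1" by simp
  qed
  then have "?g \<longlonglongrightarrow> s" by (simp only: LIM_zero_iff)
  moreover have "isCont (\<lambda>s. h s \<omega>) s" using cont[OF p(2)] by (simp add: continuous_on_eq_continuous_at)
  ultimately have "(\<lambda>n. h (?g n) \<omega>) \<longlonglongrightarrow> h s \<omega>" by (rule isCont_tendsto_compose[rotated])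
  then show "(\<lambda>n. case p of (s, \<omega>) \<Rightarrow> h (real_of_int \<lfloor>real (Suc n) * s\<rfloor> / real (Suc n)) \<omega>)
      \<longlonglongrightarrow> (case p of (s, \<omega>) \<Rightarrow> h s \<omega>)" by (simp add: p)
qed

text \<open>
  The exceptional null set of a continuous process is removed by resetting the paths in it to 0.
  The new process need not be adapted, since the filtration need not contain the null sets. It serves
  to form integrals over \<open>\<omega>\<close> of time integrals of the path, which are measurable for this version.
\<close>
lemma continuous_version:
  assumes "continuous_process M X"
  obtains Xc where "AE \<omega> in M. \<forall>s\<ge>0. Xc s \<omega> = X s \<omega>"
    "\<And>\<omega>. continuous_on UNIV (\<lambda>s. Xc s \<omega>)"
    "(\<lambda>(s, \<omega>). Xc s \<omega>) \<in> borel_measurable (lborel \<Otimes>\<^sub>M M)"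
    "\<And>s. Xc s \<in> borel_measurable M"
proof -
  have X: "\<And>s. s \<ge> 0 \<Longrightarrow> X s \<in> borel_measurable M"
    and ae: "AE \<omega> in M. continuous_on {0..} (\<lambda>t. X t \<omega>)"
    using assms unfolding continuous_process_def stochastic_process_def by auto
  obtain N where N: "\<And>\<omega>. \<omega> \<in> space M - N \<Longrightarrow> continuous_on {0..} (\<lambda>t. X t \<omega>)" "N \<in> null_sets M"
    using ae by (rule AE_E3) blast
  define Xc where "Xc s \<omega> = (if \<omega> \<in> space M - N then X (max 0 s) \<omega> else 0)" for s \<omega>
  have [measurable]: "N \<in> sets M" using N(2) by auto
  have Xm[measurable]: "X (max 0 s) \<in> borel_measurable M" for s by (rule X) simp
  have m: "Xc s \<in> borel_measurable M" for s unfolding Xc_def by measurable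
  have c: "continuous_on UNIV (\<lambda>s. Xc s \<omega>)" for \<omega>
  proof (cases "\<omega> \<in> space M - N")
    case True
    have "continuous_on UNIV (\<lambda>s. X (max 0 s) \<omega>)"
      by (rule continuous_on_compose2[OF N(1)[OF True]]) (auto intro!: continuous_intros)
    with True show ?thesis by (simp add: Xc_def)
  next
    case False
    then have "Xc s \<omega> = 0" for s by (auto simp: Xc_def)
    then show ?thesis by simp
  qed
  have "AE \<omega> in M. \<omega> \<notin> N" using N(2) by (rule AE_not_in)
  then have "AE \<omega> in M. \<forall>s\<ge>0. Xc s \<omega> = X s \<omega>"
    using AE_space by eventually_elim (simp add: Xc_def)
  from this c continuous_paths_jointly_measurable[OF m c] m show ?thesis by (rule that)
qed

section \<open>Square integrals of elementary stochastic sums\<close>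

lemma square_le_if_abs_le: "\<bar>x\<bar> \<le> y \<Longrightarrow> x\<^sup>2 \<le> y\<^sup>2" for x y :: real
  using power_mono[of "\<bar>x\<bar>" y 2] by simp

lemma square_sum_le: "(x + y)\<^sup>2 \<le> 2 * x\<^sup>2 + 2 * y\<^sup>2" for x y :: real
  using sum_squares_bound[of x y] by (simp add: power2_sum)

locale brownian = prob_space M for M :: "'a measure" +
  fixes F :: "real \<Rightarrow> 'a measure" and W :: "real \<Rightarrow> 'a \<Rightarrow> real"
  assumes bm: "brownian_motion M W" and bf: "brownian_filtration M F W"
begin

lemma filt_mono: "s \<le> t \<Longrightarrow> f \<in> borel_measurable (F s) \<Longrightarrow> f \<in> borel_measurable (F t)"
proof -
  assume st: "s \<le> t" and f: "f \<in> borel_measurable (F s)"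
  interpret filtration "space M" F using bf unfolding brownian_filtration_def by blast
  have "subalgebra (F t) (F s)"
    using sets_F_mono[OF st] by (simp add: subalgebra_def space_F)
  from measurable_from_subalg[OF this f] show ?thesis .
qed

lemma filt_measurable: "f \<in> borel_measurable (F t) \<Longrightarrow> f \<in> borel_measurable M"
  using bf measurable_from_subalg unfolding brownian_filtration_def by blast

lemma space_filt: "space (F t) = space M"
  using bf unfolding brownian_filtration_def subalgebra_def by blast

lemma W_adapted: "0 \<le> t \<Longrightarrow> W t \<in> borel_measurable (F t)"
  using bf unfolding brownian_filtration_def by blast

lemma W_measurable: "0 \<le> t \<Longrightarrow> W t \<in> borel_measurable M"
  by (rule filt_measurable[OF W_adapted])

lemma W_incr_distributed:
  "0 \<le> s \<Longrightarrow> s < t \<Longrightarrow> distributed M lborel (\<lambda>\<omega>. W t \<omega> - W s \<omega>)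
     (\<lambda>x. ennreal (normal_density 0 (sqrt (t - s)) x))"
  using bm unfolding brownian_motion_def by blast

lemma W_incr_integrable:
  assumes "0 \<le> s" "s < t"
  shows "integrable M (\<lambda>\<omega>. (W t \<omega> - W s \<omega>) ^ k)"
proof -
  have "integrable lborel (\<lambda>x. normal_density 0 (sqrt (t - s)) x * x ^ k)"
    using integrable_normal_moment[of "sqrt (t - s)" 0 k] assms by simp
  then show ?thesis
    by (subst (asm) distributed_integrable[OF W_incr_distributed[OF assms]]) auto
qed

lemma W_incr_moments:
  assumes "0 \<le> s" "s < t"
  shows "expectation (\<lambda>\<omega>. W t \<omega> - W s \<omega>) = 0"
    and "expectation (\<lambda>\<omega>. (W t \<omega> - W s \<omega>)\<^sup>2) = t - s"
    and "expectation (\<lambda>\<omega>. (W t \<omega> - W s \<omega>) ^ 4) = 3 * (t - s)\<^sup>2"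
proof -
  have eq: "expectation (\<lambda>\<omega>. (W t \<omega> - W s \<omega>) ^ k) = (\<integral>x. normal_density 0 (sqrt (t - s)) x * x ^ k \<partial>lborel)" for k
    by (rule distributed_integral[OF W_incr_distributed[OF assms], symmetric]) auto
  have pos: "0 < sqrt (t - s)" using assms by simp
  show "expectation (\<lambda>\<omega>. W t \<omega> - W s \<omega>) = 0"
    using eq[of 1] integral_normal_moment_odd[OF pos, of 0 0] by simp
  show "expectation (\<lambda>\<omega>. (W t \<omega> - W s \<omega>)\<^sup>2) = t - s"
    using eq[of 2] integral_normal_moment_even[OF pos, of 0 1] assms by simp
  show "expectation (\<lambda>\<omega>. (W t \<omega> - W s \<omega>) ^ 4) = 3 * (t - s)\<^sup>2"
    using eq[of 4] integral_normal_moment_even[OF pos, of 0 2] assms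
    by (simp add: fact_numeral power_divide field_simps)
qed

lemma incr_independent_expectation:
  assumes st: "0 \<le> s" "s < t"
    and g: "g \<in> borel_measurable (F s)" "integrable M g"
    and h[measurable]: "(h :: real \<Rightarrow> real) \<in> borel_measurable borel"
    and hi: "integrable M (\<lambda>\<omega>. h (W t \<omega> - W s \<omega>))"
  shows "integrable M (\<lambda>\<omega>. g \<omega> * h (W t \<omega> - W s \<omega>))"
    and "expectation (\<lambda>\<omega>. g \<omega> * h (W t \<omega> - W s \<omega>)) = expectation g * expectation (\<lambda>\<omega>. h (W t \<omega> - W s \<omega>))"
proof -
  let ?D = "\<lambda>\<omega>. W t \<omega> - W s \<omega>"
  have [measurable]: "W s \<in> borel_measurable M" "W t \<in> borel_measurable M"
    using st W_measurable by auto
  have gM[measurable]: "g \<in> borel_measurable M" by (rule filt_measurable[OF g(1)])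
  have ind: "indep_set (sets (F s)) {?D -` A \<inter> space M | A. A \<in> sets borel}"
    using bf st unfolding brownian_filtration_def by blast
  have sub1: "{g -` A \<inter> space M | A. A \<in> sets borel} \<subseteq> sets (F s)"
    using measurable_sets[OF g(1)] by (auto simp: space_filt)
  have sub2: "{(\<lambda>\<omega>. h (?D \<omega>)) -` A \<inter> space M | A. A \<in> sets borel} \<subseteq> {?D -` A \<inter> space M | A. A \<in> sets borel}"
  proof safe
    fix A :: "real set" assume "A \<in> sets borel"
    then have "h -` A \<in> sets borel" using measurable_sets[OF h] by simp
    then show "\<exists>B. (\<lambda>\<omega>. h (?D \<omega>)) -` A \<inter> space M = ?D -` B \<inter> space M \<and> B \<in> sets borel"
      by (intro exI[of _ "h -` A"]) auto
  qed
  have "indep_set {g -` A \<inter> space M | A. A \<in> sets borel} {(\<lambda>\<omega>. h (?D \<omega>)) -` A \<inter> space M | A. A \<in> sets borel}"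
    unfolding indep_set_def
  proof (rule indep_sets_mono_sets[OF ind[unfolded indep_set_def]])
    fix i show "case_bool {g -` A \<inter> space M | A. A \<in> sets borel} {(\<lambda>\<omega>. h (?D \<omega>)) -` A \<inter> space M | A. A \<in> sets borel} i
      \<subseteq> case_bool (sets (F s)) {?D -` A \<inter> space M | A. A \<in> sets borel} i"
      by (cases i) (simp_all only: bool.case sub1 sub2)
  qed
  then have "indep_set (sigma_sets (space M) {g -` A \<inter> space M | A. A \<in> sets borel})
      (sigma_sets (space M) {(\<lambda>\<omega>. h (?D \<omega>)) -` A \<inter> space M | A. A \<in> sets borel})"
  proof (rule indep_set_sigma_sets)
    have "Int_stable {f -` A \<inter> space M | A. A \<in> sets borel}" for f :: "'a \<Rightarrow> real"
    proof (rule Int_stableI, safe)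
      fix A B :: "real set" assume "A \<in> sets borel" "B \<in> sets borel"
      then show "\<exists>C. f -` A \<inter> space M \<inter> (f -` B \<inter> space M) = f -` C \<inter> space M \<and> C \<in> sets borel"
        by (intro exI[of _ "A \<inter> B"]) auto
    qed
    then show "Int_stable {g -` A \<inter> space M | A. A \<in> sets borel}"
      "Int_stable {(\<lambda>\<omega>. h (?D \<omega>)) -` A \<inter> space M | A. A \<in> sets borel}" by auto
  qed
  then have iv: "indep_var borel g borel (\<lambda>\<omega>. h (?D \<omega>))"
    unfolding indep_var_eq by simp
  show "integrable M (\<lambda>\<omega>. g \<omega> * h (?D \<omega>))"
    "expectation (\<lambda>\<omega>. g \<omega> * h (?D \<omega>)) = expectation g * expectation (\<lambda>\<omega>. h (?D \<omega>))"
    by (rule indep_var_integrable[OF iv g(2) hi]) (rule indep_var_lebesgue_integral[OF iv g(2) hi])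
qed

text \<open>
  The summands are orthogonal: of two distinct intervals one lies before the other, and the
  increment over the later one is centred and independent of all other factors. The intervals are
  indexed by an arbitrary finite set, so that the pieces of a partition cut by a second one can be
  indexed by pairs.
\<close>
lemma orthogonal_increments:
  fixes u v :: "'i \<Rightarrow> real" and h :: "'i \<Rightarrow> real \<Rightarrow> real" and c :: "'i \<Rightarrow> 'a \<Rightarrow> real"
  assumes fin: "finite A"
    and uv: "\<And>a. a \<in> A \<Longrightarrow> 0 \<le> u a \<and> u a < v a"
    and disj: "\<And>a b. a \<in> A \<Longrightarrow> b \<in> A \<Longrightarrow> a \<noteq> b \<Longrightarrow> v a \<le> u b \<or> v b \<le> u a"
    and c: "\<And>a. a \<in> A \<Longrightarrow> c a \<in> borel_measurable (F (u a))"
    and bd: "\<And>a. a \<in> A \<Longrightarrow> \<exists>C. \<forall>\<omega>\<in>space M. \<bar>c a \<omega>\<bar> \<le> C"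
    and h: "\<And>a. a \<in> A \<Longrightarrow> h a \<in> borel_measurable borel"
    and hi: "\<And>a. a \<in> A \<Longrightarrow> integrable M (\<lambda>\<omega>. (h a (W (v a) \<omega> - W (u a) \<omega>))\<^sup>2)"
    and h0: "\<And>a. a \<in> A \<Longrightarrow> expectation (\<lambda>\<omega>. h a (W (v a) \<omega> - W (u a) \<omega>)) = 0"
  defines "Z \<equiv> \<lambda>a \<omega>. h a (W (v a) \<omega> - W (u a) \<omega>)"
  shows "integrable M (\<lambda>\<omega>. (\<Sum>a\<in>A. c a \<omega> * Z a \<omega>)\<^sup>2)"
    and "expectation (\<lambda>\<omega>. (\<Sum>a\<in>A. c a \<omega> * Z a \<omega>)\<^sup>2) =
      (\<Sum>a\<in>A. expectation (\<lambda>\<omega>. (c a \<omega>)\<^sup>2) * expectation (\<lambda>\<omega>. (Z a \<omega>)\<^sup>2))"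
proof -
  have Zv: "Z a \<in> borel_measurable (F (v a))" if a: "a \<in> A" for a
  proof -
    have [measurable]: "W (v a) \<in> borel_measurable (F (v a))" "W (u a) \<in> borel_measurable (F (v a))"
      using uv[OF a] W_adapted[of "v a"] filt_mono[OF _ W_adapted, of "u a" "v a"] by auto
    note h[OF a, measurable]
    show ?thesis unfolding Z_def by measurable
  qed
  have Zi: "integrable M (Z a)" if a: "a \<in> A" for a
    unfolding Z_def
    by (rule square_integrable_imp_integrable[OF _ hi[OF a]])
      (use filt_measurable[OF Zv[OF a]] in \<open>simp add: Z_def\<close>)
  have bounded_mult: "integrable M (\<lambda>\<omega>. k \<omega> * f \<omega>)"
    if "k \<in> borel_measurable M" "\<forall>\<omega>\<in>space M. \<bar>k \<omega>\<bar> \<le> C" "integrable M f" for k f :: "'a \<Rightarrow> real" and C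
  proof (rule Bochner_Integration.integrable_bound)
    show "integrable M (\<lambda>\<omega>. C * f \<omega>)" using that by simp
    show "(\<lambda>\<omega>. k \<omega> * f \<omega>) \<in> borel_measurable M" using that by measurable
    show "AE \<omega> in M. norm (k \<omega> * f \<omega>) \<le> norm (C * f \<omega>)"
      using that(2) by (intro AE_I2) (auto simp: abs_mult intro!: mult_right_mono)
  qed
  have bounded_int: "integrable M f" if "f \<in> borel_measurable M" "\<exists>C. AE \<omega> in M. norm (f \<omega>) \<le> C" for f :: "'a \<Rightarrow> real"
    using that integrable_const_bound by blast
  have sq: "integrable M (\<lambda>\<omega>. (c a \<omega>)\<^sup>2 * (Z a \<omega>)\<^sup>2)"
      "expectation (\<lambda>\<omega>. (c a \<omega>)\<^sup>2 * (Z a \<omega>)\<^sup>2) = expectation (\<lambda>\<omega>. (c a \<omega>)\<^sup>2) * expectation (\<lambda>\<omega>. (Z a \<omega>)\<^sup>2)"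
    if a: "a \<in> A" for a
  proof -
    obtain C where "\<forall>\<omega>\<in>space M. \<bar>c a \<omega>\<bar> \<le> C" using bd[OF a] by blast
    then have "\<forall>\<omega>\<in>space M. (c a \<omega>)\<^sup>2 \<le> C\<^sup>2"
      using square_le_if_abs_le by blast
    then have i: "integrable M (\<lambda>\<omega>. (c a \<omega>)\<^sup>2)"
      using filt_measurable[OF c[OF a]] by (intro bounded_int) (auto intro!: AE_I2)
    have m: "(\<lambda>\<omega>. (c a \<omega>)\<^sup>2) \<in> borel_measurable (F (u a))" using c[OF a] by measurable
    have hm: "(\<lambda>x. (h a x)\<^sup>2) \<in> borel_measurable borel" using h[OF a] by measurable
    show "integrable M (\<lambda>\<omega>. (c a \<omega>)\<^sup>2 * (Z a \<omega>)\<^sup>2)"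
      "expectation (\<lambda>\<omega>. (c a \<omega>)\<^sup>2 * (Z a \<omega>)\<^sup>2) = expectation (\<lambda>\<omega>. (c a \<omega>)\<^sup>2) * expectation (\<lambda>\<omega>. (Z a \<omega>)\<^sup>2)"
      using incr_independent_expectation[OF _ _ m i hm hi[OF a]] uv[OF a] by (auto simp: Z_def)
  qed
  have cross': "integrable M (\<lambda>\<omega>. c a \<omega> * Z a \<omega> * (c b \<omega> * Z b \<omega>)) \<and>
      expectation (\<lambda>\<omega>. c a \<omega> * Z a \<omega> * (c b \<omega> * Z b \<omega>)) = 0"
    if a: "a \<in> A" and b: "b \<in> A" and le: "v a \<le> u b" for a b
  proof -
    let ?g = "\<lambda>\<omega>. c a \<omega> * (c b \<omega> * Z a \<omega>)"
    have [measurable]: "c a \<in> borel_measurable (F (u b))" "Z a \<in> borel_measurable (F (u b))" "c b \<in> borel_measurable (F (u b))"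
      using le uv[OF a] filt_mono[OF _ c[OF a], of "u b"] filt_mono[OF le Zv[OF a]] c[OF b] by auto
    have gm: "?g \<in> borel_measurable (F (u b))" by measurable
    have m': "c a \<in> borel_measurable M" "c b \<in> borel_measurable M"
      using filt_measurable[OF c] a b by auto
    obtain Ca Cb where C: "\<forall>\<omega>\<in>space M. \<bar>c a \<omega>\<bar> \<le> Ca" "\<forall>\<omega>\<in>space M. \<bar>c b \<omega>\<bar> \<le> Cb"
      using bd[OF a] bd[OF b] by blast
    have gi: "integrable M ?g"
      by (rule bounded_mult[OF m'(1) C(1) bounded_mult[OF m'(2) C(2) Zi[OF a]]])
    have "integrable M (\<lambda>\<omega>. ?g \<omega> * Z b \<omega>)" "expectation (\<lambda>\<omega>. ?g \<omega> * Z b \<omega>) = 0"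
      using incr_independent_expectation[OF _ _ gm gi h[OF b]] Zi[OF b] h0[OF b] uv[OF b] by (auto simp: Z_def)
    moreover have "?g \<omega> * Z b \<omega> = c a \<omega> * Z a \<omega> * (c b \<omega> * Z b \<omega>)" for \<omega> by simp
    ultimately show ?thesis by simp
  qed
  have cross: "integrable M (\<lambda>\<omega>. c a \<omega> * Z a \<omega> * (c b \<omega> * Z b \<omega>)) \<and>
      expectation (\<lambda>\<omega>. c a \<omega> * Z a \<omega> * (c b \<omega> * Z b \<omega>)) =
      (if a = b then expectation (\<lambda>\<omega>. (c a \<omega>)\<^sup>2) * expectation (\<lambda>\<omega>. (Z a \<omega>)\<^sup>2) else 0)"
    if a: "a \<in> A" and b: "b \<in> A" for a b
  proof (cases "a = b")
    case True
    have "c a \<omega> * Z a \<omega> * (c a \<omega> * Z a \<omega>) = (c a \<omega>)\<^sup>2 * (Z a \<omega>)\<^sup>2" for \<omega> by (simp add: power2_eq_square)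
    with sq[OF a] True show ?thesis by simp
  next
    case False
    then consider "v a \<le> u b" | "v b \<le> u a" using disj[OF a b] by blast
    then show ?thesis
    proof cases
      case 1 then show ?thesis using cross'[OF a b] False by simp
    next
      case 2 then show ?thesis using cross'[OF b a] False by (simp add: mult.commute)
    qed
  qed
  have eq: "(\<Sum>a\<in>A. c a \<omega> * Z a \<omega>)\<^sup>2 = (\<Sum>a\<in>A. \<Sum>b\<in>A. c a \<omega> * Z a \<omega> * (c b \<omega> * Z b \<omega>))" for \<omega>
    by (simp add: power2_eq_square sum_product)
  show "integrable M (\<lambda>\<omega>. (\<Sum>a\<in>A. c a \<omega> * Z a \<omega>)\<^sup>2)"
    unfolding eq using cross by (intro Bochner_Integration.integrable_sum) auto
  show "expectation (\<lambda>\<omega>. (\<Sum>a\<in>A. c a \<omega> * Z a \<omega>)\<^sup>2) =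
      (\<Sum>a\<in>A. expectation (\<lambda>\<omega>. (c a \<omega>)\<^sup>2) * expectation (\<lambda>\<omega>. (Z a \<omega>)\<^sup>2))"
    unfolding eq using cross fin
    by (simp add: Bochner_Integration.integral_sum Bochner_Integration.integrable_sum cong: sum.cong)
qed

text \<open>
  Coefficients are multiplied by the indicator that the variance accumulated up to and including
  their own interval is at most \<open>\<eta>\<close>. This keeps them adapted, makes the total variance at most
  \<open>\<eta>\<close> on all of the space, and changes nothing where the total variance was at most \<open>\<eta>\<close> from the
  start. The blocks \<open>{a\<in>A. f a = j}\<close> allow bounding both a single sum and a sum of squares.
\<close>
lemma truncated_sum_bound:
  fixes u v :: "'i \<Rightarrow> real" and c :: "'i \<Rightarrow> 'a \<Rightarrow> real" and f :: "'i \<Rightarrow> 'j"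
  assumes fin: "finite A" "finite J" and fJ: "f ` A \<subseteq> J"
    and uv: "\<And>a. a \<in> A \<Longrightarrow> 0 \<le> u a \<and> u a < v a"
    and disj: "\<And>a b. a \<in> A \<Longrightarrow> b \<in> A \<Longrightarrow> a \<noteq> b \<Longrightarrow> v a \<le> u b \<or> v b \<le> u a"
    and c: "\<And>a. a \<in> A \<Longrightarrow> c a \<in> borel_measurable (F (u a))"
    and x: "0 < x" and \<eta>: "0 < \<eta>"
  defines "V \<equiv> \<lambda>\<omega>. \<Sum>a\<in>A. (c a \<omega>)\<^sup>2 * (v a - u a)"
  shows "prob {\<omega> \<in> space M. x \<le> (\<Sum>j\<in>J. (\<Sum>a\<in>{a\<in>A. f a = j}. c a \<omega> * (W (v a) \<omega> - W (u a) \<omega>))\<^sup>2)}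
    \<le> prob {\<omega> \<in> space M. \<eta> < V \<omega>} + \<eta> / x"
proof -
  define P where "P a \<omega> = (\<Sum>b\<in>{b\<in>A. u b \<le> u a}. (c b \<omega>)\<^sup>2 * (v b - u b))" for a \<omega>
  define c' where "c' a \<omega> = (if P a \<omega> \<le> \<eta> then c a \<omega> else 0)" for a \<omega>
  let ?S = "\<lambda>c \<omega>. \<Sum>j\<in>J. (\<Sum>a\<in>{a\<in>A. f a = j}. c a \<omega> * (W (v a) \<omega> - W (u a) \<omega>))\<^sup>2"
  have pm: "P a \<in> borel_measurable (F (u a))" if "a \<in> A" for a
    unfolding P_def
  proof (intro borel_measurable_sum borel_measurable_times borel_measurable_const borel_measurable_power)
    fix b assume "b \<in> {b \<in> A. u b \<le> u a}"
    then show "c b \<in> borel_measurable (F (u a))" using filt_mono[OF _ c] by auto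
  qed
  have c'm: "c' a \<in> borel_measurable (F (u a))" if "a \<in> A" for a
    using c[OF that] pm[OF that] unfolding c'_def by measurable
  have nn: "0 \<le> (c a \<omega>)\<^sup>2 * (v a - u a)" if "a \<in> A" for a \<omega>
    using uv[OF that] by simp
  have c'_le: "(c' a \<omega>)\<^sup>2 * (v a - u a) \<le> \<eta>" if a: "a \<in> A" for a \<omega>
  proof (cases "P a \<omega> \<le> \<eta>")
    case True
    have "(c a \<omega>)\<^sup>2 * (v a - u a) \<le> P a \<omega>"
      unfolding P_def by (rule member_le_sum) (use a fin nn in auto)
    with True show ?thesis by (simp add: c'_def)
  qed (use \<eta> in \<open>simp add: c'_def\<close>)
  have bd: "\<exists>C. \<forall>\<omega>\<in>space M. \<bar>c' a \<omega>\<bar> \<le> C" if a: "a \<in> A" for a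
  proof (intro exI ballI)
    fix \<omega>
    have "(c' a \<omega>)\<^sup>2 \<le> \<eta> / (v a - u a)" using c'_le[OF a, of \<omega>] uv[OF a] by (simp add: field_simps)
    then show "\<bar>c' a \<omega>\<bar> \<le> sqrt (\<eta> / (v a - u a))" by (metis real_sqrt_abs real_sqrt_le_mono)
  qed
  have V'_le: "(\<Sum>a\<in>A. (c' a \<omega>)\<^sup>2 * (v a - u a)) \<le> \<eta>" for \<omega>
  proof -
    define B where "B = {a\<in>A. P a \<omega> \<le> \<eta>}"
    have eq: "(\<Sum>a\<in>A. (c' a \<omega>)\<^sup>2 * (v a - u a)) = (\<Sum>a\<in>B. (c a \<omega>)\<^sup>2 * (v a - u a))"
      unfolding B_def by (subst sum.inter_filter[OF fin(1)]) (auto intro!: sum.cong simp: c'_def)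
    show ?thesis
    proof (cases "B = {}")
      case True then show ?thesis using \<eta> eq by simp
    next
      case False
      have "finite B" using fin by (simp add: B_def)
      then obtain a where a: "a \<in> B" "\<And>b. b \<in> B \<Longrightarrow> u b \<le> u a"
      proof -
        \<comment> \<open>Among the surviving indices, the one with the latest interval has accumulated all the others.\<close>
        have "Max (u ` B) \<in> u ` B" using False \<open>finite B\<close> by (intro Max_in) auto
        then obtain a where "a \<in> B" "u a = Max (u ` B)" by auto
        then show ?thesis using that[of a] \<open>finite B\<close> by auto
      qed
      have "(\<Sum>a\<in>B. (c a \<omega>)\<^sup>2 * (v a - u a)) \<le> P a \<omega>"
        unfolding P_def by (rule sum_mono2) (use fin a nn in \<open>auto simp: B_def\<close>)
      then show ?thesis using a(1) eq by (simp add: B_def)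
    qed
  qed
  have ort: "integrable M (\<lambda>\<omega>. (\<Sum>a\<in>{a\<in>A. f a = j}. c' a \<omega> * (W (v a) \<omega> - W (u a) \<omega>))\<^sup>2)"
    "expectation (\<lambda>\<omega>. (\<Sum>a\<in>{a\<in>A. f a = j}. c' a \<omega> * (W (v a) \<omega> - W (u a) \<omega>))\<^sup>2) =
     (\<Sum>a\<in>{a\<in>A. f a = j}. expectation (\<lambda>\<omega>. (c' a \<omega>)\<^sup>2) * expectation (\<lambda>\<omega>. (W (v a) \<omega> - W (u a) \<omega>)\<^sup>2))" for j
  proof -
    let ?A = "{a\<in>A. f a = j}"
    have 1: "finite ?A" using fin by simp
    have 2: "integrable M (\<lambda>\<omega>. (W (v a) \<omega> - W (u a) \<omega>)\<^sup>2)"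
      "expectation (\<lambda>\<omega>. W (v a) \<omega> - W (u a) \<omega>) = 0" if "a \<in> ?A" for a
      using that uv[of a] W_incr_integrable[of "u a" "v a" 2] W_incr_moments(1)[of "u a" "v a"] by auto
    note ort' = orthogonal_increments[where h = "\<lambda>_ x. x" and A = ?A and u = u and v = v and c = c',
        OF 1 uv disj c'm bd measurable_ident_sets[OF refl] 2]
    show "integrable M (\<lambda>\<omega>. (\<Sum>a\<in>?A. c' a \<omega> * (W (v a) \<omega> - W (u a) \<omega>))\<^sup>2)" by (rule ort') auto
    show "expectation (\<lambda>\<omega>. (\<Sum>a\<in>?A. c' a \<omega> * (W (v a) \<omega> - W (u a) \<omega>))\<^sup>2) =
     (\<Sum>a\<in>?A. expectation (\<lambda>\<omega>. (c' a \<omega>)\<^sup>2) * expectation (\<lambda>\<omega>. (W (v a) \<omega> - W (u a) \<omega>)\<^sup>2))" by (rule ort') auto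
  qed
  have c'i: "integrable M (\<lambda>\<omega>. (c' a \<omega>)\<^sup>2)" if a: "a \<in> A" for a
  proof -
    obtain C where "\<forall>\<omega>\<in>space M. \<bar>c' a \<omega>\<bar> \<le> C" using bd[OF a] by blast
    then have "\<forall>\<omega>\<in>space M. (c' a \<omega>)\<^sup>2 \<le> C\<^sup>2"
      using square_le_if_abs_le by blast
    then show ?thesis
      using filt_measurable[OF c'm[OF a]] by (intro integrable_const_bound[of _ "C\<^sup>2"]) (auto intro!: AE_I2)
  qed
  have Si: "integrable M (?S c')" by (intro Bochner_Integration.integrable_sum ort)
  have "expectation (?S c') = (\<Sum>j\<in>J. \<Sum>a\<in>{a\<in>A. f a = j}. expectation (\<lambda>\<omega>. (c' a \<omega>)\<^sup>2) * (v a - u a))"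
    using uv W_incr_moments(2)
    by (subst Bochner_Integration.integral_sum) (auto simp: ort intro!: sum.cong)
  also have "\<dots> = (\<Sum>a\<in>A. expectation (\<lambda>\<omega>. (c' a \<omega>)\<^sup>2) * (v a - u a))"
    by (rule sum.group[OF fin fJ])
  also have "\<dots> = expectation (\<lambda>\<omega>. \<Sum>a\<in>A. (c' a \<omega>)\<^sup>2 * (v a - u a))"
    using c'i by (subst Bochner_Integration.integral_sum) auto
  also have "\<dots> \<le> expectation (\<lambda>\<omega>. \<eta>)"
    using c'i V'_le by (intro integral_mono Bochner_Integration.integrable_sum) auto
  finally have ES: "expectation (?S c') \<le> \<eta>" by (simp add: prob_space)
  have [measurable]: "W (v a) \<in> borel_measurable M" "W (u a) \<in> borel_measurable M"
      "c a \<in> borel_measurable M" "c' a \<in> borel_measurable M" if "a \<in> A" for a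
    using uv[OF that] W_measurable[of "u a"] W_measurable[of "v a"]
      filt_measurable[OF c[OF that]] filt_measurable[OF c'm[OF that]] by auto
  have Vm[measurable]: "V \<in> borel_measurable M" unfolding V_def by measurable
  have Sm[measurable]: "?S c' \<in> borel_measurable M" by (rule borel_measurable_integrable[OF Si])
  have sub: "{\<omega> \<in> space M. x \<le> ?S c \<omega>} \<subseteq> {\<omega> \<in> space M. \<eta> < V \<omega>} \<union> {\<omega> \<in> space M. x \<le> ?S c' \<omega>}"
  proof safe
    fix \<omega> assume \<omega>: "\<omega> \<in> space M" "x \<le> ?S c \<omega>" "\<not> x \<le> ?S c' \<omega>"
    show "\<eta> < V \<omega>"
    proof (rule ccontr)
      assume "\<not> \<eta> < V \<omega>"
      then have "V \<omega> \<le> \<eta>" by simp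
      moreover have "P a \<omega> \<le> V \<omega>" for a
        unfolding P_def V_def by (rule sum_mono2) (use fin nn in auto)
      ultimately have "c' a \<omega> = c a \<omega>" for a by (meson c'_def order_trans)
      with \<omega> show False by simp
    qed
  qed
  have "prob {\<omega> \<in> space M. x \<le> ?S c \<omega>} \<le> prob ({\<omega> \<in> space M. \<eta> < V \<omega>} \<union> {\<omega> \<in> space M. x \<le> ?S c' \<omega>})"
    by (rule finite_measure_mono[OF sub]) measurable
  also have "\<dots> \<le> prob {\<omega> \<in> space M. \<eta> < V \<omega>} + prob {\<omega> \<in> space M. x \<le> ?S c' \<omega>}"
    by (rule measure_Un_le) measurable
  also have "prob {\<omega> \<in> space M. x \<le> ?S c' \<omega>} \<le> expectation (?S c') / x"
    by (rule integral_Markov_inequality_measure[where A = "{}", simplified, OF Si])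
      (auto intro!: AE_I2 sum_nonneg simp: x)
  also have "expectation (?S c') / x \<le> \<eta> / x" using ES x by (simp add: divide_right_mono)
  finally show ?thesis by simp
qed

end

section \<open>Uniform grids\<close>

definition grid :: "real \<Rightarrow> nat \<Rightarrow> nat \<Rightarrow> real" where
  "grid T m j = T * real j / real (Suc m)"

lemma grid_simps [simp]: "grid T m 0 = 0" "grid T m (Suc m) = T"
  by (simp_all add: grid_def)

lemma grid_diff: "grid T m (Suc j) - grid T m j = T / real (Suc m)"
  by (simp add: grid_def diff_divide_distrib[symmetric] algebra_simps)

lemma grid_less: "0 < T \<Longrightarrow> grid T m j < grid T m (Suc j)"
  unfolding grid_def by (intro divide_strict_right_mono mult_strict_left_mono) auto

lemma grid_mono: "0 \<le> T \<Longrightarrow> i \<le> j \<Longrightarrow> grid T m i \<le> grid T m j"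
  by (auto simp: grid_def intro!: divide_right_mono mult_left_mono)

lemma grid_nonneg: "0 \<le> T \<Longrightarrow> 0 \<le> grid T m j"
  by (simp add: grid_def)

lemma grid_le: "0 \<le> T \<Longrightarrow> j \<le> Suc m \<Longrightarrow> grid T m j \<le> T"
  using grid_mono[of T j "Suc m" m] by simp

lemma integral_grid:
  fixes g :: "real \<Rightarrow> real"
  assumes T: "0 \<le> T" and g: "continuous_on {0..T} g"
  shows "(\<Sum>j<Suc m. integral {grid T m j..grid T m (Suc j)} g) = integral {0..T} g"
proof -
  have "(\<Sum>j<n. integral {grid T m j..grid T m (Suc j)} g) = integral {0..grid T m n} g" if "n \<le> Suc m" for n
    using that
  proof (induction n)
    case (Suc n)
    have "integral {0..grid T m n} g + integral {grid T m n..grid T m (Suc n)} g = integral {0..grid T m (Suc n)} g"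
    proof (rule Henstock_Kurzweil_Integration.integral_combine)
      show "g integrable_on {0..grid T m (Suc n)}"
        by (intro integrable_continuous_real continuous_on_subset[OF g]) (use grid_le[OF T, of "Suc n" m] Suc in auto)
    qed (use T grid_nonneg grid_mono in auto)
    with Suc show ?case by simp
  qed simp
  from this[of "Suc m"] show ?thesis by simp
qed

lemma eventually_grid_oscillation:
  fixes f :: "real \<Rightarrow> real"
  assumes T: "0 \<le> T" and f: "continuous_on {0..T} f" and e: "0 < e"
  shows "\<forall>\<^sub>F m in sequentially. \<forall>j<Suc m. \<forall>q\<in>{grid T m j..grid T m (Suc j)}. \<bar>f q - f (grid T m j)\<bar> \<le> e"
proof -
  have "uniformly_continuous_on {0..T} f" using f by (intro compact_uniformly_continuous) auto
  then obtain d where d: "d > 0" "\<And>q q'. q \<in> {0..T} \<Longrightarrow> q' \<in> {0..T} \<Longrightarrow> dist q q' < d \<Longrightarrow> dist (f q) (f q') < e"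
    using e unfolding uniformly_continuous_on_def by metis
  have "(\<lambda>m. T / real (Suc m)) \<longlonglongrightarrow> 0" by (rule LIMSEQ_Suc[OF lim_const_over_n])
  then have "\<forall>\<^sub>F m in sequentially. T / real (Suc m) < d" using d(1) by (rule order_tendstoD)
  then show ?thesis
  proof eventually_elim
    case (elim m)
    show ?case
    proof (intro allI impI ballI)
      fix j q assume j: "j < Suc m" and q: "q \<in> {grid T m j..grid T m (Suc j)}"
      have "dist (f q) (f (grid T m j)) < e"
        using q j elim grid_nonneg[OF T, of m j] grid_le[OF T, of "Suc j" m] grid_diff[of T m j]
        by (intro d(2)) (auto simp: dist_real_def)
      then show "\<bar>f q - f (grid T m j)\<bar> \<le> e" by (simp add: dist_real_def)
    qed
  qed
qed

text \<open>
  On each cell, replacing \<open>f\<close> by its value at the left end costs at most its oscillation, which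
  vanishes uniformly.
\<close>
lemma grid_weighted_integral_tendsto:
  fixes f h :: "real \<Rightarrow> real"
  assumes T: "0 \<le> T" and f: "continuous_on {0..T} f" and h: "continuous_on {0..T} h"
  shows "(\<lambda>m. \<Sum>j<Suc m. f (grid T m j) * integral {grid T m j..grid T m (Suc j)} h)
    \<longlonglongrightarrow> integral {0..T} (\<lambda>r. f r * h r)"
proof (rule LIMSEQ_I)
  fix e :: real assume e: "e > 0"
  have "bounded (h ` {0..T})" using h by (intro compact_imp_bounded compact_continuous_image) auto
  then obtain B where B: "B > 0" "\<And>r. r \<in> {0..T} \<Longrightarrow> \<bar>h r\<bar> \<le> B"
    by (auto simp: bounded_pos)
  define c where "c = B * (T + 1)"
  define e' where "e' = e / (2 * c)"
  have c: "0 < c" using B T by (simp add: c_def)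
  have e': "0 < e'" using e c by (simp add: e'_def)
  have small: "e' * B * T < e"
  proof -
    have "e' * (B * T) \<le> e' * c" using e' B by (intro mult_left_mono) (auto simp: c_def)
    also have "\<dots> = e / 2" using c by (simp add: e'_def)
    finally show ?thesis using e by simp
  qed
  have fh: "continuous_on {0..T} (\<lambda>r. f r * h r)" by (intro continuous_intros f h)
  have "\<forall>\<^sub>F m in sequentially. norm ((\<Sum>j<Suc m. f (grid T m j) * integral {grid T m j..grid T m (Suc j)} h) - integral {0..T} (\<lambda>r. f r * h r)) < e"
    using eventually_grid_oscillation[OF T f e']
  proof eventually_elim
    case (elim m)
    let ?J = "\<lambda>j. {grid T m j..grid T m (Suc j)}"
    have sub: "?J j \<subseteq> {0..T}" if "j < Suc m" for j
      using grid_nonneg[OF T, of m j] grid_le[OF T, of "Suc j" m] that by auto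
    have "(\<Sum>j<Suc m. f (grid T m j) * integral (?J j) h) - integral {0..T} (\<lambda>r. f r * h r)
      = (\<Sum>j<Suc m. f (grid T m j) * integral (?J j) h - integral (?J j) (\<lambda>r. f r * h r))"
      unfolding sum_subtractf integral_grid[OF T fh] ..
    also have "norm \<dots> \<le> (\<Sum>j<Suc m. e' * B * (T / real (Suc m)))"
    proof (rule sum_norm_le)
      fix j assume "j \<in> {..<Suc m}"
      then have j: "j < Suc m" by simp
      have c: "continuous_on (?J j) h" "continuous_on (?J j) f" using continuous_on_subset[OF h sub[OF j]] continuous_on_subset[OF f sub[OF j]] by auto
      have "f (grid T m j) * integral (?J j) h - integral (?J j) (\<lambda>r. f r * h r) = integral (?J j) (\<lambda>r. f (grid T m j) * h r - f r * h r)"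
        by (subst Henstock_Kurzweil_Integration.integral_diff) (auto intro!: integrable_continuous_real continuous_intros c)
      also have "norm \<dots> \<le> e' * B * (grid T m (Suc j) - grid T m j)"
      proof (rule integral_bound)
        show "grid T m j \<le> grid T m (Suc j)" using T by (rule grid_mono) simp
        show "continuous_on (?J j) (\<lambda>r. f (grid T m j) * h r - f r * h r)" by (intro continuous_intros c)
        fix r assume r: "r \<in> ?J j"
        have "f (grid T m j) * h r - f r * h r = (f (grid T m j) - f r) * h r" by (simp add: algebra_simps)
        moreover have "\<bar>f (grid T m j) - f r\<bar> \<le> e'" using elim j r by (metis abs_minus_commute)
        ultimately show "norm (f (grid T m j) * h r - f r * h r) \<le> e' * B"
          using B(2)[of r] r sub[OF j] e' by (auto simp: abs_mult intro!: mult_mono)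
      qed
      finally show "norm (f (grid T m j) * integral (?J j) h - integral (?J j) (\<lambda>r. f r * h r)) \<le> e' * B * (T / real (Suc m))"
        by (simp only: grid_diff)
    qed
    also have "\<dots> = e' * B * T" by simp
    finally show ?case using small by simp
  qed
  then show "\<exists>no. \<forall>m\<ge>no. norm ((\<Sum>j<Suc m. f (grid T m j) * integral {grid T m j..grid T m (Suc j)} h) - integral {0..T} (\<lambda>r. f r * h r)) < e"
    by (simp add: eventually_sequentially)
qed

lemma grid_riemann_sum_tendsto:
  fixes f :: "real \<Rightarrow> real"
  assumes T: "0 \<le> T" and f: "continuous_on {0..T} f"
  shows "(\<lambda>m. \<Sum>j<Suc m. f (grid T m j) * (T / real (Suc m))) \<longlonglongrightarrow> integral {0..T} f"
proof -
  have "integral {grid T m j..grid T m (Suc j)} (\<lambda>_. 1) = T / real (Suc m)" for m j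
    using grid_mono[OF T, of j "Suc j" m] grid_diff[of T m j] by simp
  then show ?thesis
    using grid_weighted_integral_tendsto[OF T f, of "\<lambda>_. 1"] by (simp only: mult_1_right continuous_on_const simp_thms)
qed

lemma continuous_on_atLeast_if_Icc:
  fixes f :: "real \<Rightarrow> real"
  assumes "\<And>T. continuous_on {0..T} f" shows "continuous_on {0..} f"
proof -
  have "continuous (at t within {0..}) f" if t: "0 \<le> t" for t
  proof -
    have "continuous (at t within {0..t+1}) f"
      using assms[of "t + 1"] t by (auto simp: continuous_on_eq_continuous_within)
    moreover have "at t within {0..t+1} = at t within {0..}"
      by (rule at_within_nhd[of _ "{..<t+1}"]) auto
    ultimately show ?thesis by simp
  qed
  then show ?thesis by (simp add: continuous_on_eq_continuous_within)
qed

section \<open>Increments of the Ito integral\<close>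

text \<open>
  Adding a first and a last interval with coefficient 0 makes the partition cover \<open>[0, T]\<close>, so that
  its pieces fill every grid cell in \<open>[0, T]\<close>.
\<close>
lemma elementary_data_covering:
  assumes "elementary_data M F N \<tau> \<xi>"
  shows "\<exists>N' \<tau>' \<xi>'. elementary_data M F N' \<tau>' \<xi>' \<and> \<tau>' 0 = 0 \<and> T \<le> \<tau>' N' \<and>
    elementary_process N' \<tau>' \<xi>' = elementary_process N \<tau> \<xi> \<and>
    elementary_integral W N' \<tau>' \<xi>' = elementary_integral W N \<tau> \<xi>"
proof -
  have \<tau>: "0 \<le> \<tau> 0" "mono \<tau>"
    and \<xi>: "\<And>i. i < N \<Longrightarrow> \<xi> i \<in> borel_measurable (F (\<tau> i)) \<and> (\<exists>C. \<forall>\<omega>\<in>space M. \<bar>\<xi> i \<omega>\<bar> \<le> C)"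
    using assms unfolding elementary_data_def by auto
  define \<tau>' where "\<tau>' i = (if i = 0 then 0 else if i \<le> Suc N then \<tau> (i - 1) else max T (\<tau> N))" for i
  define \<xi>' where "\<xi>' i = (if i = 0 \<or> i = Suc N then (\<lambda>_. 0) else \<xi> (i - 1))" for i
  have "mono \<tau>'"
  proof (rule monoI)
    fix i j :: nat assume "i \<le> j"
    have "0 \<le> \<tau> k" for k using \<tau> by (meson le0 monoD order_trans)
    moreover have "\<tau> (i - 1) \<le> \<tau> (j - 1)" using \<tau>(2) \<open>i \<le> j\<close> by (simp add: monoD)
    moreover have "i \<le> Suc N \<Longrightarrow> \<tau> (i - 1) \<le> \<tau> N" using \<tau>(2) by (simp add: monoD)
    ultimately show "\<tau>' i \<le> \<tau>' j" using \<open>i \<le> j\<close> by (auto simp: \<tau>'_def le_max_iff_disj)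
  qed
  moreover have "\<xi>' i \<in> borel_measurable (F (\<tau>' i)) \<and> (\<exists>C. \<forall>\<omega>\<in>space M. \<bar>\<xi>' i \<omega>\<bar> \<le> C)" if "i < N + 2" for i
    using \<xi>[of "i - 1"] that by (auto simp: \<xi>'_def \<tau>'_def)
  ultimately have "elementary_data M F (N + 2) \<tau>' \<xi>'"
    unfolding elementary_data_def by (auto simp: \<tau>'_def)
  moreover have "elementary_process (N + 2) \<tau>' \<xi>' = elementary_process N \<tau> \<xi>"
  proof (intro ext)
    fix s \<omega>
    have "elementary_process (N + 2) \<tau>' \<xi>' s \<omega> = (\<Sum>i<Suc N. \<xi>' i \<omega> * indicator {\<tau>' i<..\<tau>' (Suc i)} s)"
      unfolding elementary_process_def by (simp add: \<xi>'_def)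
    also have "\<dots> = (\<Sum>i<N. \<xi>' (Suc i) \<omega> * indicator {\<tau>' (Suc i)<..\<tau>' (Suc (Suc i))} s)"
      by (subst sum.lessThan_Suc_shift) (simp add: \<xi>'_def)
    also have "\<dots> = elementary_process N \<tau> \<xi> s \<omega>"
      unfolding elementary_process_def by (intro sum.cong) (auto simp: \<xi>'_def \<tau>'_def)
    finally show "elementary_process (N + 2) \<tau>' \<xi>' s \<omega> = elementary_process N \<tau> \<xi> s \<omega>" .
  qed
  moreover have "elementary_integral W (N + 2) \<tau>' \<xi>' = elementary_integral W N \<tau> \<xi>"
  proof (intro ext)
    fix s \<omega>
    have "elementary_integral W (N + 2) \<tau>' \<xi>' s \<omega> =
        (\<Sum>i<Suc N. \<xi>' i \<omega> * (W (min s (\<tau>' (Suc i))) \<omega> - W (min s (\<tau>' i)) \<omega>))"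
      unfolding elementary_integral_def by (simp add: \<xi>'_def)
    also have "\<dots> = (\<Sum>i<N. \<xi>' (Suc i) \<omega> * (W (min s (\<tau>' (Suc (Suc i)))) \<omega> - W (min s (\<tau>' (Suc i))) \<omega>))"
      by (subst sum.lessThan_Suc_shift) (simp add: \<xi>'_def)
    also have "\<dots> = elementary_integral W N \<tau> \<xi> s \<omega>"
      unfolding elementary_integral_def by (intro sum.cong) (auto simp: \<xi>'_def \<tau>'_def)
    finally show "elementary_integral W (N + 2) \<tau>' \<xi>' s \<omega> = elementary_integral W N \<tau> \<xi> s \<omega>" .
  qed
  moreover have "\<tau>' 0 = 0" "T \<le> \<tau>' (N + 2)" by (auto simp: \<tau>'_def)
  ultimately show ?thesis by blast
qed

text \<open>The partition point \<open>\<tau> i\<close>, moved to the nearest point of the \<open>j\<close>-th grid cell.\<close>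
definition clamp_cell :: "(nat \<Rightarrow> real) \<Rightarrow> (nat \<Rightarrow> real) \<Rightarrow> nat \<Rightarrow> nat \<Rightarrow> real" where
  "clamp_cell s \<tau> j i = max (s j) (min (s (Suc j)) (\<tau> i))"

lemma clamp_cell_ordered:
  assumes s: "mono s" and \<tau>: "mono \<tau>" and ne: "(j, i) \<noteq> (j', i')"
  shows "clamp_cell s \<tau> j (Suc i) \<le> clamp_cell s \<tau> j' i' \<or> clamp_cell s \<tau> j' (Suc i') \<le> clamp_cell s \<tau> j i"
proof -
  have *: "clamp_cell s \<tau> j (Suc i) \<le> clamp_cell s \<tau> j' i'" if "j < j' \<or> j = j' \<and> i < i'" for j i j' i'
    using that
  proof
    assume "j < j'"
    then have "s (Suc j) \<le> s j'" "s j \<le> s (Suc j)" using s by (auto simp: monoD)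
    then show ?thesis unfolding clamp_cell_def by (auto simp: max_def min_def)
  next
    assume h: "j = j' \<and> i < i'"
    then have "\<tau> (Suc i) \<le> \<tau> i'" using \<tau> by (auto simp: monoD)
    with h show ?thesis unfolding clamp_cell_def by (auto simp: max_def min_def)
  qed
  have "j < j' \<or> j = j' \<and> i < i' \<or> j' < j \<or> j' = j \<and> i' < i" using ne by auto
  then show ?thesis using *[of j j' i i'] *[of j' j i' i] by blast
qed

lemma clamp_cell_mono:
  assumes "mono \<tau>" shows "clamp_cell s \<tau> j i \<le> clamp_cell s \<tau> j (Suc i)"
proof -
  have "\<tau> i \<le> \<tau> (Suc i)" using assms by (simp add: monoD)
  then show ?thesis unfolding clamp_cell_def by (auto simp: max_def min_def)
qed

lemma elementary_integral_increment:
  assumes s: "mono s" and s0: "\<tau> 0 \<le> s j" and sN: "s (Suc j) \<le> \<tau> N"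
  shows "elementary_integral W N \<tau> \<xi> (s (Suc j)) \<omega> - elementary_integral W N \<tau> \<xi> (s j) \<omega>
      - h * (W (s (Suc j)) \<omega> - W (s j) \<omega>)
    = (\<Sum>i<N. (\<xi> i \<omega> - h) * (W (clamp_cell s \<tau> j (Suc i)) \<omega> - W (clamp_cell s \<tau> j i) \<omega>))"
proof -
  have sj: "s j \<le> s (Suc j)" using s by (simp add: monoD)
  have c: "W (min (s (Suc j)) z) \<omega> - W (min (s j) z) \<omega> = W (max (s j) (min (s (Suc j)) z)) \<omega> - W (s j) \<omega>" for z
    using sj by (auto simp: min_def max_def)
  have "elementary_integral W N \<tau> \<xi> (s (Suc j)) \<omega> - elementary_integral W N \<tau> \<xi> (s j) \<omega> =
      (\<Sum>i<N. \<xi> i \<omega> * ((W (min (s (Suc j)) (\<tau> (Suc i))) \<omega> - W (min (s j) (\<tau> (Suc i))) \<omega>)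
        - (W (min (s (Suc j)) (\<tau> i)) \<omega> - W (min (s j) (\<tau> i)) \<omega>)))"
    unfolding elementary_integral_def by (simp add: sum_subtractf[symmetric] algebra_simps)
  also have "\<dots> = (\<Sum>i<N. \<xi> i \<omega> * (W (clamp_cell s \<tau> j (Suc i)) \<omega> - W (clamp_cell s \<tau> j i) \<omega>))"
    unfolding c clamp_cell_def by simp
  finally have 1: "elementary_integral W N \<tau> \<xi> (s (Suc j)) \<omega> - elementary_integral W N \<tau> \<xi> (s j) \<omega> = \<dots>" .
  have "(\<Sum>i<N. W (clamp_cell s \<tau> j (Suc i)) \<omega> - W (clamp_cell s \<tau> j i) \<omega>) =
      W (clamp_cell s \<tau> j N) \<omega> - W (clamp_cell s \<tau> j 0) \<omega>"
    by (rule sum_lessThan_telescope)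
  moreover have "clamp_cell s \<tau> j N = s (Suc j)" "clamp_cell s \<tau> j 0 = s j"
    using s0 sN sj by (auto simp: clamp_cell_def)
  ultimately have 2: "W (s (Suc j)) \<omega> - W (s j) \<omega> =
      (\<Sum>i<N. W (clamp_cell s \<tau> j (Suc i)) \<omega> - W (clamp_cell s \<tau> j i) \<omega>)" by simp
  show ?thesis unfolding 1 2 by (simp only: sum_distrib_left left_diff_distrib flip: sum_subtractf)
qed

text \<open>
  The variance of the difference between the integrand \<open>\<xi>\<close> and its grid values \<open>h (s j)\<close> is an
  integral over time, compared here with the \<open>L\<^sup>2\<close> distance of \<open>\<xi>\<close> to \<open>h\<close> and the oscillation
  \<open>e\<close> of \<open>h\<close> on the grid cells.
\<close>
lemma cell_variance_le:
  fixes s \<tau> :: "nat \<Rightarrow> real" and h :: "real \<Rightarrow> real"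
  assumes s: "mono s" "0 \<le> s 0" "s m \<le> T" and \<tau>: "mono \<tau>"
    and h: "h \<in> borel_measurable borel"
    and osc: "\<And>j r. j < m \<Longrightarrow> s j \<le> r \<Longrightarrow> r \<le> s (Suc j) \<Longrightarrow> \<bar>h r - h (s j)\<bar> \<le> e"
  shows "ennreal (\<Sum>j<m. \<Sum>i<N. (\<xi> i \<omega> - h (s j))\<^sup>2 * (clamp_cell s \<tau> j (Suc i) - clamp_cell s \<tau> j i))
    \<le> 2 * (\<integral>\<^sup>+r\<in>{0..T}. ennreal ((elementary_process N \<tau> \<xi> r \<omega> - h r)\<^sup>2) \<partial>lborel) + ennreal (2 * e\<^sup>2 * T)"
proof -
  let ?A = "{..<m} \<times> {..<N}"
  let ?I = "\<lambda>a. {clamp_cell s \<tau> (fst a) (snd a)<..clamp_cell s \<tau> (fst a) (Suc (snd a))}"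
  let ?G = "\<lambda>r. 2 * ennreal ((elementary_process N \<tau> \<xi> r \<omega> - h r)\<^sup>2) + ennreal (2 * e\<^sup>2)"
  have T0: "0 \<le> T" using s by (meson le0 monoD order_trans)
  have sj: "0 \<le> s j" "s j \<le> s (Suc j)" for j using s(1,2) by (auto simp: monoD intro: order_trans[OF s(2)])
  have sT: "s (Suc j) \<le> T" if "j < m" for j using s(1,3) that by (meson Suc_leI monoD order_trans)
  have [measurable]: "(\<lambda>r. elementary_process N \<tau> \<xi> r \<omega>) \<in> borel_measurable borel"
    unfolding elementary_process_def by measurable
  note [measurable] = h
  have disj: "disjoint_family_on ?I ?A"
    unfolding disjoint_family_on_def
  proof (intro ballI impI)
    fix a b assume "a \<in> ?A" "b \<in> ?A" "a \<noteq> b"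
    then have "clamp_cell s \<tau> (fst a) (Suc (snd a)) \<le> clamp_cell s \<tau> (fst b) (snd b) \<or>
      clamp_cell s \<tau> (fst b) (Suc (snd b)) \<le> clamp_cell s \<tau> (fst a) (snd a)"
      using clamp_cell_ordered[OF s(1) \<tau>, of "fst a" "snd a" "fst b" "snd b"] by (auto simp: prod_eq_iff)
    then show "?I a \<inter> ?I b = {}" by auto
  qed
  have ep: "elementary_process N \<tau> \<xi> r \<omega> = \<xi> i \<omega>" if i: "i < N" and r: "\<tau> i < r" "r \<le> \<tau> (Suc i)" for i r
  proof -
    have "indicator {\<tau> k<..\<tau> (Suc k)} r = (if k = i then 1 else (0::real))" for k
    proof (cases k i rule: linorder_cases)
      case less
      then have "\<tau> (Suc k) \<le> \<tau> i" using \<tau> by (simp add: monoD)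
      then show ?thesis using less r by auto
    next
      case greater
      then have "\<tau> (Suc i) \<le> \<tau> k" using \<tau> by (simp add: monoD)
      then show ?thesis using greater r by auto
    qed (use r in auto)
    then have "elementary_process N \<tau> \<xi> r \<omega> = (\<Sum>k<N. \<xi> k \<omega> * (if k = i then 1 else 0))"
      unfolding elementary_process_def by (simp only:)
    also have "\<dots> = (\<Sum>k\<in>{i}. \<xi> k \<omega> * (if k = i then 1 else 0))"
      using i by (intro sum.mono_neutral_right) auto
    finally show ?thesis by simp
  qed
  have piece: "ennreal ((\<xi> i \<omega> - h (s j))\<^sup>2 * (clamp_cell s \<tau> j (Suc i) - clamp_cell s \<tau> j i))
      \<le> (\<integral>\<^sup>+r. ?G r * indicator (?I (j, i)) r \<partial>lborel)" if ji: "j < m" "i < N" for j i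
  proof -
    have le: "clamp_cell s \<tau> j i \<le> clamp_cell s \<tau> j (Suc i)" by (rule clamp_cell_mono[OF \<tau>])
    have "ennreal ((\<xi> i \<omega> - h (s j))\<^sup>2 * (clamp_cell s \<tau> j (Suc i) - clamp_cell s \<tau> j i)) =
        (\<integral>\<^sup>+r. ennreal ((\<xi> i \<omega> - h (s j))\<^sup>2) * indicator (?I (j, i)) r \<partial>lborel)"
      using le by (simp add: nn_integral_cmult_indicator ennreal_mult)
    also have "\<dots> \<le> (\<integral>\<^sup>+r. ?G r * indicator (?I (j, i)) r \<partial>lborel)"
    proof (rule nn_integral_mono)
      fix r
      show "ennreal ((\<xi> i \<omega> - h (s j))\<^sup>2) * indicator (?I (j, i)) r \<le> ?G r * indicator (?I (j, i)) r"
      proof (cases "r \<in> ?I (j, i)")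
        case True
        then have r: "s j \<le> r" "r \<le> s (Suc j)" "\<tau> i < r" "r \<le> \<tau> (Suc i)"
          using sj[of j] by (auto simp: clamp_cell_def max_def min_def split: if_splits)
        have "(\<xi> i \<omega> - h (s j))\<^sup>2 \<le> 2 * (\<xi> i \<omega> - h r)\<^sup>2 + 2 * (h r - h (s j))\<^sup>2"
          using sum_squares_bound[of "\<xi> i \<omega> - h r" "h r - h (s j)"]
          by (simp add: power2_eq_square algebra_simps)
        also have "(h r - h (s j))\<^sup>2 \<le> e\<^sup>2"
          by (rule square_le_if_abs_le[OF osc[OF ji(1) r(1,2)]])
        finally have "(\<xi> i \<omega> - h (s j))\<^sup>2 \<le> 2 * (elementary_process N \<tau> \<xi> r \<omega> - h r)\<^sup>2 + 2 * e\<^sup>2"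
          by (simp add: ep[OF ji(2) r(3,4)])
        then have "ennreal ((\<xi> i \<omega> - h (s j))\<^sup>2) \<le> ennreal (2 * (elementary_process N \<tau> \<xi> r \<omega> - h r)\<^sup>2 + 2 * e\<^sup>2)"
          by (rule ennreal_leI)
        also have "\<dots> = ?G r" by (simp add: ennreal_mult)
        finally show ?thesis using True by simp
      qed simp
    qed
    finally show ?thesis .
  qed
  have "ennreal (\<Sum>j<m. \<Sum>i<N. (\<xi> i \<omega> - h (s j))\<^sup>2 * (clamp_cell s \<tau> j (Suc i) - clamp_cell s \<tau> j i))
     = (\<Sum>j<m. \<Sum>i<N. ennreal ((\<xi> i \<omega> - h (s j))\<^sup>2 * (clamp_cell s \<tau> j (Suc i) - clamp_cell s \<tau> j i)))"
    using clamp_cell_mono[OF \<tau>, of s] by (simp add: sum_ennreal sum_nonneg)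
  also have "\<dots> \<le> (\<Sum>j<m. \<Sum>i<N. \<integral>\<^sup>+r. ?G r * indicator (?I (j, i)) r \<partial>lborel)"
    using piece by (intro sum_mono) auto
  also have "\<dots> = (\<Sum>a\<in>?A. \<integral>\<^sup>+r. ?G r * indicator (?I a) r \<partial>lborel)"
    by (simp add: sum.cartesian_product split_beta)
  also have "\<dots> = (\<integral>\<^sup>+r. (\<Sum>a\<in>?A. ?G r * indicator (?I a) r) \<partial>lborel)"
    by (rule nn_integral_sum[symmetric]) measurable
  also have "\<dots> = (\<integral>\<^sup>+r. ?G r * indicator (\<Union>a\<in>?A. ?I a) r \<partial>lborel)"
  proof (rule nn_integral_cong)
    fix r
    have "indicator (\<Union>a\<in>?A. ?I a) r = (\<Sum>a\<in>?A. indicator (?I a) r :: ennreal)"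
      by (rule indicator_UN_disjoint[OF _ disj]) simp
    then show "(\<Sum>a\<in>?A. ?G r * indicator (?I a) r) = ?G r * indicator (\<Union>a\<in>?A. ?I a) r"
      by (simp only: sum_distrib_left)
  qed
  also have "\<dots> \<le> (\<integral>\<^sup>+r. 2 * (ennreal ((elementary_process N \<tau> \<xi> r \<omega> - h r)\<^sup>2) * indicator {0..T} r)
      + ennreal (2 * e\<^sup>2) * indicator {0..T} r \<partial>lborel)"
  proof (rule nn_integral_mono)
    fix r
    have "(\<Union>a\<in>?A. ?I a) \<subseteq> {0..T}"
    proof safe
      fix j i r assume "j < m" "i < N" "r \<in> ?I (j, i)"
      then have "s j \<le> r" "r \<le> s (Suc j)"
        using sj[of j] by (auto simp: clamp_cell_def max_def min_def split: if_splits)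
      with sj[of j] sT[OF \<open>j < m\<close>] show "r \<in> {0..T}" by auto
    qed
    then have "indicator (\<Union>a\<in>?A. ?I a) r \<le> (indicator {0..T} r :: ennreal)"
      by (meson indicator_leI subsetD)
    then have "?G r * indicator (\<Union>a\<in>?A. ?I a) r \<le> ?G r * indicator {0..T} r" by (rule mult_left_mono) simp
    also have "\<dots> = 2 * (ennreal ((elementary_process N \<tau> \<xi> r \<omega> - h r)\<^sup>2) * indicator {0..T} r)
      + ennreal (2 * e\<^sup>2) * indicator {0..T} r" by (simp only: distrib_right mult.assoc)
    finally show "?G r * indicator (\<Union>a\<in>?A. ?I a) r \<le> 2 * (ennreal ((elementary_process N \<tau> \<xi> r \<omega> - h r)\<^sup>2) * indicator {0..T} r)
      + ennreal (2 * e\<^sup>2) * indicator {0..T} r" .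
  qed
  also have "\<dots> = 2 * (\<integral>\<^sup>+r\<in>{0..T}. ennreal ((elementary_process N \<tau> \<xi> r \<omega> - h r)\<^sup>2) \<partial>lborel)
      + ennreal (2 * e\<^sup>2) * ennreal T"
  proof (subst nn_integral_add)
    show "(\<integral>\<^sup>+r. 2 * (ennreal ((elementary_process N \<tau> \<xi> r \<omega> - h r)\<^sup>2) * indicator {0..T} r) \<partial>lborel)
        + (\<integral>\<^sup>+r. ennreal (2 * e\<^sup>2) * indicator {0..T} r \<partial>lborel)
      = 2 * (\<integral>\<^sup>+r\<in>{0..T}. ennreal ((elementary_process N \<tau> \<xi> r \<omega> - h r)\<^sup>2) \<partial>lborel)
        + ennreal (2 * e\<^sup>2) * ennreal T"
      using T0 by (intro arg_cong2[of _ _ _ _ "(+)"]) (subst nn_integral_cmult nn_integral_cmult_indicator; simp)+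
  qed measurable
  also have "ennreal (2 * e\<^sup>2) * ennreal T = ennreal (2 * e\<^sup>2 * T)" using T0 by (simp add: ennreal_mult)
  finally show ?thesis .
qed

context brownian
begin

text \<open>
  The intervals are the pieces \<open>(j, i)\<close> of the \<open>j\<close>-th grid cell in the \<open>i\<close>-th partition interval,
  with coefficient \<open>k j (\<xi> i - h j)\<close>. Empty pieces are discarded: on them the coefficient need not be
  known at the left endpoint.
\<close>
lemma elementary_increment_bound:
  fixes s :: "nat \<Rightarrow> real" and f :: "nat \<Rightarrow> 'l" and h k :: "nat \<Rightarrow> 'a \<Rightarrow> real"
  assumes ed: "elementary_data M F N \<tau> \<xi>" and s: "mono s" and s0: "\<tau> 0 \<le> s 0" and sN: "s m \<le> \<tau> N"
    and h: "\<And>j. h j \<in> borel_measurable (F (s j))"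
    and k: "\<And>j. k j \<in> borel_measurable (F (s j))" "\<And>j \<omega>. \<bar>k j \<omega>\<bar> \<le> C"
    and x: "0 < x" and \<eta>: "0 < \<eta>"
  defines "R \<equiv> \<lambda>j \<omega>. elementary_integral W N \<tau> \<xi> (s (Suc j)) \<omega> - elementary_integral W N \<tau> \<xi> (s j) \<omega>
      - h j \<omega> * (W (s (Suc j)) \<omega> - W (s j) \<omega>)"
  defines "V \<equiv> \<lambda>\<omega>. C\<^sup>2 * (\<Sum>j<m. \<Sum>i<N. (\<xi> i \<omega> - h j \<omega>)\<^sup>2 * (clamp_cell s \<tau> j (Suc i) - clamp_cell s \<tau> j i))"
  shows "prob {\<omega> \<in> space M. x \<le> (\<Sum>l\<in>f ` {..<m}. (\<Sum>j\<in>{j\<in>{..<m}. f j = l}. k j \<omega> * R j \<omega>)\<^sup>2)}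
      \<le> prob {\<omega> \<in> space M. \<eta> < V \<omega>} + \<eta> / x" (is "?lhs \<le> _")
    and "V \<in> borel_measurable M"
proof -
  let ?u = "\<lambda>a. clamp_cell s \<tau> (fst a) (snd a)" and ?v = "\<lambda>a. clamp_cell s \<tau> (fst a) (Suc (snd a))"
  define A where "A = {a \<in> {..<m} \<times> {..<N}. ?u a < ?v a}"
  let ?c = "\<lambda>a \<omega>. k (fst a) \<omega> * (\<xi> (snd a) \<omega> - h (fst a) \<omega>)"
  have \<tau>: "0 \<le> \<tau> 0" "mono \<tau>" and \<xi>: "\<And>i. i < N \<Longrightarrow> \<xi> i \<in> borel_measurable (F (\<tau> i))"
    using ed by (simp_all add: elementary_data_def)
  have s_ge: "\<tau> 0 \<le> s j" for j by (rule order_trans[OF s0 monoD[OF s]]) simp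
  have s_le: "s (Suc j) \<le> \<tau> N" if "j < m" for j
    by (rule order_trans[OF monoD[OF s] sN]) (use that in simp)
  have uv_eq: "?u a = ?v a" if "a \<in> {..<m} \<times> {..<N} - A" for a
    using that clamp_cell_mono[OF \<tau>(2), of s "fst a" "snd a"] by (auto simp: A_def)
  have fin: "finite A" unfolding A_def by simp
  have Veq: "(\<Sum>j<m. \<Sum>i<N. g j i * (clamp_cell s \<tau> j (Suc i) - clamp_cell s \<tau> j i)) = (\<Sum>a\<in>A. g (fst a) (snd a) * (?v a - ?u a))"
    for g :: "nat \<Rightarrow> nat \<Rightarrow> real"
  proof -
    have "(\<Sum>j<m. \<Sum>i<N. g j i * (clamp_cell s \<tau> j (Suc i) - clamp_cell s \<tau> j i)) =
        (\<Sum>a\<in>{..<m} \<times> {..<N}. g (fst a) (snd a) * (?v a - ?u a))"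
      by (simp add: sum.cartesian_product split_beta)
    also have "\<dots> = (\<Sum>a\<in>A. g (fst a) (snd a) * (?v a - ?u a))"
    proof (rule sum.mono_neutral_right)
      show "\<forall>a\<in>{..<m} \<times> {..<N} - A. g (fst a) (snd a) * (?v a - ?u a) = 0"
        using uv_eq by simp
    qed (auto simp: A_def)
    finally show ?thesis .
  qed
  have Req: "(\<Sum>j\<in>{j\<in>{..<m}. f j = l}. k j \<omega> * R j \<omega>) =
      (\<Sum>a\<in>{a\<in>A. f (fst a) = l}. ?c a \<omega> * (W (?v a) \<omega> - W (?u a) \<omega>))" for l \<omega>
  proof -
    have "(\<Sum>j\<in>{j\<in>{..<m}. f j = l}. k j \<omega> * R j \<omega>) = (\<Sum>j\<in>{j\<in>{..<m}. f j = l}. \<Sum>i<N.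
        k j \<omega> * (\<xi> i \<omega> - h j \<omega>) * (W (clamp_cell s \<tau> j (Suc i)) \<omega> - W (clamp_cell s \<tau> j i) \<omega>))"
    proof (intro sum.cong refl)
      fix j assume "j \<in> {j\<in>{..<m}. f j = l}"
      then have "R j \<omega> = (\<Sum>i<N. (\<xi> i \<omega> - h j \<omega>) * (W (clamp_cell s \<tau> j (Suc i)) \<omega> - W (clamp_cell s \<tau> j i) \<omega>))"
        unfolding R_def by (intro elementary_integral_increment[OF s s_ge s_le]) auto
      then show "k j \<omega> * R j \<omega> = (\<Sum>i<N. k j \<omega> * (\<xi> i \<omega> - h j \<omega>) * (W (clamp_cell s \<tau> j (Suc i)) \<omega> - W (clamp_cell s \<tau> j i) \<omega>))"
        by (simp add: sum_distrib_left mult.assoc)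
    qed
    also have "\<dots> = (\<Sum>a\<in>{j\<in>{..<m}. f j = l} \<times> {..<N}. ?c a \<omega> * (W (?v a) \<omega> - W (?u a) \<omega>))"
      by (simp add: sum.cartesian_product split_beta)
    also have "\<dots> = (\<Sum>a\<in>{a\<in>A. f (fst a) = l}. ?c a \<omega> * (W (?v a) \<omega> - W (?u a) \<omega>))"
    proof (rule sum.mono_neutral_right)
      show "\<forall>a\<in>{j\<in>{..<m}. f j = l} \<times> {..<N} - {a\<in>A. f (fst a) = l}. ?c a \<omega> * (W (?v a) \<omega> - W (?u a) \<omega>) = 0"
      proof
        fix a assume "a \<in> {j\<in>{..<m}. f j = l} \<times> {..<N} - {a\<in>A. f (fst a) = l}"
        then have "?u a = ?v a" by (intro uv_eq) auto
        then show "?c a \<omega> * (W (?v a) \<omega> - W (?u a) \<omega>) = 0" by simp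
      qed
    qed (auto simp: A_def)
    finally show ?thesis .
  qed
  have uv: "0 \<le> ?u a \<and> ?u a < ?v a" if "a \<in> A" for a
    using that s_ge[of "fst a"] \<tau>(1) by (auto simp: A_def clamp_cell_def)
  have disj: "?v a \<le> ?u b \<or> ?v b \<le> ?u a" if "a \<noteq> b" for a b
    using clamp_cell_ordered[OF s \<tau>(2), of "fst a" "snd a" "fst b" "snd b"] that by (auto simp: prod_eq_iff)
  have cm: "?c a \<in> borel_measurable (F (?u a))" if a: "a \<in> A" for a
  proof -
    have "s (fst a) \<le> ?u a" "\<tau> (snd a) \<le> ?u a"
      using a by (auto simp: A_def clamp_cell_def max_def min_def split: if_splits)
    then have [measurable]: "k (fst a) \<in> borel_measurable (F (?u a))" "h (fst a) \<in> borel_measurable (F (?u a))"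
        "\<xi> (snd a) \<in> borel_measurable (F (?u a))"
      using filt_mono[OF _ k(1)] filt_mono[OF _ h] filt_mono[OF _ \<xi>] a by (auto simp: A_def)
    show ?thesis by measurable
  qed
  have [measurable]: "h j \<in> borel_measurable M" for j by (rule filt_measurable[OF h])
  have [measurable]: "\<xi> i \<in> borel_measurable M" if "i < N" for i by (rule filt_measurable[OF \<xi>[OF that]])
  show Vm: "V \<in> borel_measurable M" unfolding V_def by measurable
  have "?lhs \<le> prob {\<omega> \<in> space M. \<eta> < (\<Sum>a\<in>A. (?c a \<omega>)\<^sup>2 * (?v a - ?u a))} + \<eta> / x"
    unfolding Req
    by (rule truncated_sum_bound[where f = "\<lambda>a. f (fst a)", OF fin _ _ uv disj cm x \<eta>]) (auto simp: A_def)
  also have "prob {\<omega> \<in> space M. \<eta> < (\<Sum>a\<in>A. (?c a \<omega>)\<^sup>2 * (?v a - ?u a))} \<le> prob {\<omega> \<in> space M. \<eta> < V \<omega>}"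
  proof (rule finite_measure_mono)
    have "(\<Sum>a\<in>A. (?c a \<omega>)\<^sup>2 * (?v a - ?u a)) \<le> V \<omega>" for \<omega>
    proof -
      have "(\<Sum>a\<in>A. (?c a \<omega>)\<^sup>2 * (?v a - ?u a)) \<le> (\<Sum>a\<in>A. C\<^sup>2 * ((\<xi> (snd a) \<omega> - h (fst a) \<omega>)\<^sup>2 * (?v a - ?u a)))"
      proof (rule sum_mono)
        fix a assume a: "a \<in> A"
        have "(k (fst a) \<omega>)\<^sup>2 \<le> C\<^sup>2" by (rule square_le_if_abs_le[OF k(2)])
        then have "(k (fst a) \<omega>)\<^sup>2 * ((\<xi> (snd a) \<omega> - h (fst a) \<omega>)\<^sup>2 * (?v a - ?u a)) \<le> C\<^sup>2 * ((\<xi> (snd a) \<omega> - h (fst a) \<omega>)\<^sup>2 * (?v a - ?u a))"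
          using uv[OF a] by (intro mult_right_mono) auto
        then show "(?c a \<omega>)\<^sup>2 * (?v a - ?u a) \<le> C\<^sup>2 * ((\<xi> (snd a) \<omega> - h (fst a) \<omega>)\<^sup>2 * (?v a - ?u a))"
          by (simp add: power_mult_distrib mult.assoc)
      qed
      also have "\<dots> = V \<omega>" unfolding V_def Veq by (simp add: sum_distrib_left)
      finally show ?thesis .
    qed
    then show "{\<omega> \<in> space M. \<eta> < (\<Sum>a\<in>A. (?c a \<omega>)\<^sup>2 * (?v a - ?u a))} \<subseteq> {\<omega> \<in> space M. \<eta> < V \<omega>}"
      by (auto intro: less_le_trans)
  qed (use Vm in measurable)
  finally show "?lhs \<le> prob {\<omega> \<in> space M. \<eta> < V \<omega>} + \<eta> / x" by simp
qed

text \<open>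
  On a fine grid, the increments of \<open>\<integral> H dW\<close> may be replaced by \<open>H(s\<^sub>j) \<Delta>W\<close>, both in the sum of
  squares (\<open>f\<close> injective) and in a weighted sum (\<open>f\<close> constant). For each mesh the elementary
  approximation is chosen fine enough that its own error vanishes; what remains is an elementary
  sum with vanishing variance.
\<close>
lemma ito_increment_approximation:
  fixes H I :: "real \<Rightarrow> 'a \<Rightarrow> real" and f :: "nat \<Rightarrow> 'l" and k :: "real \<Rightarrow> 'a \<Rightarrow> real"
  assumes H: "\<And>s. 0 \<le> s \<Longrightarrow> H s \<in> borel_measurable (F s)"
    and Hc: "continuous_process M H" and I: "ito_integral M F W H I" and T: "0 < T"
    and k: "\<And>s. 0 \<le> s \<Longrightarrow> k s \<in> borel_measurable (F s)" "\<And>s \<omega>. \<bar>k s \<omega>\<bar> \<le> C"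
  defines "R \<equiv> \<lambda>m j \<omega>. I (grid T m (Suc j)) \<omega> - I (grid T m j) \<omega> - H (grid T m j) \<omega> * (W (grid T m (Suc j)) \<omega> - W (grid T m j) \<omega>)"
  shows "tendsto_in_prob M (\<lambda>m \<omega>. \<Sum>l\<in>f ` {..<Suc m}. (\<Sum>j\<in>{j\<in>{..<Suc m}. f j = l}. k (grid T m j) \<omega> * R m j \<omega>)\<^sup>2) (\<lambda>_. 0)"
proof -
  let ?s = "grid T"
  obtain N0 \<tau>0 \<xi>0 where ed0: "\<And>q. elementary_data M F (N0 q) (\<tau>0 q) (\<xi>0 q)"
    and L20: "AE \<omega> in M. \<forall>T\<ge>0. (\<lambda>q. \<integral>\<^sup>+r\<in>{0..T}.
              ennreal ((elementary_process (N0 q) (\<tau>0 q) (\<xi>0 q) r \<omega> - H r \<omega>)\<^sup>2) \<partial>lborel) \<longlonglongrightarrow> 0"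
    and P0: "\<And>t. 0 \<le> t \<Longrightarrow> tendsto_in_prob M (\<lambda>q. elementary_integral W (N0 q) (\<tau>0 q) (\<xi>0 q) t) (I t)"
    using I unfolding ito_integral_def by blast
  let ?good = "\<lambda>q d. elementary_data M F (fst d) (fst (snd d)) (snd (snd d)) \<and> fst (snd d) 0 = 0 \<and> T \<le> fst (snd d) (fst d) \<and>
      elementary_process (fst d) (fst (snd d)) (snd (snd d)) = elementary_process (N0 q) (\<tau>0 q) (\<xi>0 q) \<and>
      elementary_integral W (fst d) (fst (snd d)) (snd (snd d)) = elementary_integral W (N0 q) (\<tau>0 q) (\<xi>0 q)"
  have "\<forall>q. \<exists>d. ?good q d"
  proof
    fix q
    from elementary_data_covering[OF ed0[of q], of T W]
    obtain N' \<tau>' \<xi>' where g: "elementary_data M F N' \<tau>' \<xi>' \<and> \<tau>' 0 = 0 \<and> T \<le> \<tau>' N' \<and>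
      elementary_process N' \<tau>' \<xi>' = elementary_process (N0 q) (\<tau>0 q) (\<xi>0 q) \<and>
      elementary_integral W N' \<tau>' \<xi>' = elementary_integral W (N0 q) (\<tau>0 q) (\<xi>0 q)" by (elim exE)
    show "\<exists>d. ?good q d" by (rule exI[of _ "(N', \<tau>', \<xi>')"]) (simp only: fst_conv snd_conv g)
  qed
  from choice[OF this] obtain d where d: "\<forall>q. ?good q (d q)" ..
  define N where "N q = fst (d q)" for q
  define \<tau> where "\<tau> q = fst (snd (d q))" for q
  define \<xi> where "\<xi> q = snd (snd (d q))" for q
  have ed: "elementary_data M F (N q) (\<tau> q) (\<xi> q)" and \<tau>0: "\<tau> q 0 = 0" and \<tau>N: "T \<le> \<tau> q (N q)"
    and ep: "elementary_process (N q) (\<tau> q) (\<xi> q) = elementary_process (N0 q) (\<tau>0 q) (\<xi>0 q)"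
    and ei: "elementary_integral W (N q) (\<tau> q) (\<xi> q) = elementary_integral W (N0 q) (\<tau>0 q) (\<xi>0 q)" for q
    using d[rule_format, of q] unfolding N_def \<tau>_def \<xi>_def by (simp_all only:)
  define E where "E q = elementary_integral W (N q) (\<tau> q) (\<xi> q)" for q
  have \<tau>: "mono (\<tau> q)" "0 \<le> \<tau> q i" and \<xi>m: "i < N q \<Longrightarrow> \<xi> q i \<in> borel_measurable M" for q i
  proof -
    show "mono (\<tau> q)" using ed[of q] unfolding elementary_data_def by simp
    then show "0 \<le> \<tau> q i" using \<tau>0[of q] by (metis le0 monoD)
    show "i < N q \<Longrightarrow> \<xi> q i \<in> borel_measurable M"
      using ed[of q] unfolding elementary_data_def by (metis filt_measurable)
  qed
  have EP: "tendsto_in_prob M (\<lambda>q. E q t) (I t)" if "0 \<le> t" for t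
    using P0[OF that] by (simp add: E_def ei)
  have Im: "0 \<le> t \<Longrightarrow> I t \<in> borel_measurable M" for t
    using I unfolding ito_integral_def continuous_process_def stochastic_process_def by blast
  have Em: "0 \<le> t \<Longrightarrow> E q t \<in> borel_measurable M" for q t
  proof -
    assume "0 \<le> t"
    then have [measurable]: "W (min t (\<tau> q i)) \<in> borel_measurable M" for i
      by (intro W_measurable) (simp add: \<tau>(2))
    note \<xi>m[measurable]
    show ?thesis unfolding E_def elementary_integral_def by measurable
  qed
  obtain H' where H': "AE \<omega> in M. \<forall>s\<ge>0. H' s \<omega> = H s \<omega>"
    "\<And>\<omega>. continuous_on UNIV (\<lambda>s. H' s \<omega>)"
    "(\<lambda>(s, \<omega>). H' s \<omega>) \<in> borel_measurable (lborel \<Otimes>\<^sub>M M)"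
    by (rule continuous_version[OF Hc]) (rule that, assumption+)
  define D where "D q \<omega> = (\<integral>\<^sup>+r\<in>{0..T}. ennreal ((elementary_process (N q) (\<tau> q) (\<xi> q) r \<omega> - H' r \<omega>)\<^sup>2) \<partial>lborel)" for q \<omega>
  have Dm[measurable]: "D q \<in> borel_measurable M" for q
  proof -
    have [measurable]: "(\<lambda>p. H' (snd p) (fst p)) \<in> borel_measurable (M \<Otimes>\<^sub>M lborel)"
      using measurable_compose[OF measurable_pair_swap' H'(3)] by (simp add: split_beta')
    have [measurable]: "(\<lambda>p. elementary_process (N q) (\<tau> q) (\<xi> q) (snd p) (fst p)) \<in> borel_measurable (M \<Otimes>\<^sub>M lborel)"
      unfolding elementary_process_def
    proof (rule borel_measurable_sum)
      fix i assume "i \<in> {..<N q}"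
      then have [measurable]: "\<xi> q i \<in> borel_measurable M" using \<xi>m by simp
      show "(\<lambda>p. \<xi> q i (fst p) * indicator {\<tau> q i<..\<tau> q (Suc i)} (snd p)) \<in> borel_measurable (M \<Otimes>\<^sub>M lborel)"
        by measurable
    qed
    have "(\<lambda>p. ennreal ((elementary_process (N q) (\<tau> q) (\<xi> q) (snd p) (fst p) - H' (snd p) (fst p))\<^sup>2) * indicator {0..T} (snd p))
        \<in> borel_measurable (M \<Otimes>\<^sub>M lborel)"
      by measurable
    then have "(\<lambda>(\<omega>, r). ennreal ((elementary_process (N q) (\<tau> q) (\<xi> q) r \<omega> - H' r \<omega>)\<^sup>2) * indicator {0..T} r)
        \<in> borel_measurable (M \<Otimes>\<^sub>M lborel)"
      by (simp only: split_beta')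
    then show ?thesis unfolding D_def by (rule lborel.borel_measurable_nn_integral)
  qed
  have D0: "AE \<omega> in M. (\<lambda>q. D q \<omega>) \<longlonglongrightarrow> 0"
    using L20 H'(1)
  proof eventually_elim
    case (elim \<omega>)
    have "D q \<omega> = (\<integral>\<^sup>+r\<in>{0..T}. ennreal ((elementary_process (N0 q) (\<tau>0 q) (\<xi>0 q) r \<omega> - H r \<omega>)\<^sup>2) \<partial>lborel)" for q
      unfolding D_def ep by (rule nn_integral_cong) (use elim(2) in \<open>simp add: indicator_def\<close>)
    then show ?case using elim(1) T by simp
  qed
  have T0: "0 \<le> T" using T by simp
  have s: "mono (?s m)" "?s m 0 = 0" "?s m (Suc m) = T" "0 \<le> ?s m j" for m j
    using grid_mono[OF T0] grid_nonneg[OF T0] by (auto intro: monoI)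
  \<comment> \<open>The tolerance \<open>1 / n\<^sup>3\<close> for \<open>n = m + 1\<close> cells leaves room for summing \<open>n\<close> errors, squaring, and
    summing over at most \<open>n\<close> blocks.\<close>
  define B where "B m q = {\<omega> \<in> space M. ennreal (1 / real (Suc m)) \<le> D q \<omega>} \<union>
    (\<Union>j\<in>{..Suc m}. {\<omega> \<in> space M. (1 / real (Suc m)) ^ 3 \<le> \<bar>E q (?s m j) \<omega> - I (?s m j) \<omega>\<bar>})" for m q
  have "\<exists>\<kappa>. (\<forall>m. m \<le> \<kappa> m) \<and> (AE \<omega> in M. \<forall>\<^sub>F m in sequentially. \<omega> \<notin> B m (\<kappa> m))"
  proof (rule diagonal_selection)
    have [measurable]: "E q (?s m j) \<in> borel_measurable M" "I (?s m j) \<in> borel_measurable M" for q m j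
      using Em Im s(4) by auto
    show "B m q \<in> events" for m q unfolding B_def by measurable
    show "(\<lambda>q. prob (B m q)) \<longlonglongrightarrow> 0" for m
    proof (rule tendsto_sandwich[OF _ _ tendsto_const])
      let ?P = "\<lambda>j q. prob {\<omega> \<in> space M. (1 / real (Suc m)) ^ 3 \<le> \<bar>E q (?s m j) \<omega> - I (?s m j) \<omega>\<bar>}"
      have "prob (B m q) \<le> prob {\<omega> \<in> space M. ennreal (1 / real (Suc m)) \<le> D q \<omega>} + (\<Sum>j\<in>{..Suc m}. ?P j q)" for q
        unfolding B_def by (rule order_trans[OF measure_Un_le add_left_mono[OF measure_UNION_le]]) measurable
      then show "\<forall>\<^sub>F q in sequentially. prob (B m q) \<le> prob {\<omega> \<in> space M. ennreal (1 / real (Suc m)) \<le> D q \<omega>} + (\<Sum>j\<in>{..Suc m}. ?P j q)"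
        by simp
      have "(\<lambda>q. prob {\<omega> \<in> space M. ennreal (1 / real (Suc m)) \<le> D q \<omega>}) \<longlonglongrightarrow> 0"
      proof (rule prob_tendsto_0_if_AE_eventually_notin)
        show "AE \<omega> in M. \<forall>\<^sub>F q in sequentially. \<omega> \<notin> {\<omega> \<in> space M. ennreal (1 / real (Suc m)) \<le> D q \<omega>}"
          using D0
        proof eventually_elim
          case (elim \<omega>)
          then have "\<forall>\<^sub>F q in sequentially. D q \<omega> < ennreal (1 / real (Suc m))"
            by (rule order_tendstoD) (simp del: of_nat_Suc)
          then show ?case by eventually_elim auto
        qed
      qed measurable
      moreover have "(\<lambda>q. \<Sum>j\<in>{..Suc m}. ?P j q) \<longlonglongrightarrow> 0"
        using EP[OF s(4)[of m]] unfolding tendsto_in_prob_def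
        by (intro tendsto_null_sum) simp
      ultimately show "(\<lambda>q. prob {\<omega> \<in> space M. ennreal (1 / real (Suc m)) \<le> D q \<omega>} + (\<Sum>j\<in>{..Suc m}. ?P j q)) \<longlonglongrightarrow> 0"
        by (rule tendsto_add_zero)
    qed simp
  qed
  then obtain \<kappa> where aeB: "AE \<omega> in M. \<forall>\<^sub>F m in sequentially. \<omega> \<notin> B m (\<kappa> m)" by blast
  define R' where "R' m j \<omega> = E (\<kappa> m) (?s m (Suc j)) \<omega> - E (\<kappa> m) (?s m j) \<omega>
    - H (?s m j) \<omega> * (W (?s m (Suc j)) \<omega> - W (?s m j) \<omega>)" for m j \<omega>
  let ?S = "\<lambda>R m \<omega>. \<Sum>l\<in>f ` {..<Suc m}. (\<Sum>j\<in>{j\<in>{..<Suc m}. f j = l}. k (?s m j) \<omega> * R m j \<omega>)\<^sup>2"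
  define V where "V m \<omega> = C\<^sup>2 * (\<Sum>j<Suc m. \<Sum>i<N (\<kappa> m). (\<xi> (\<kappa> m) i \<omega> - H (?s m j) \<omega>)\<^sup>2 *
    (clamp_cell (?s m) (\<tau> (\<kappa> m)) j (Suc i) - clamp_cell (?s m) (\<tau> (\<kappa> m)) j i))" for m \<omega>
  have ebound: "prob {\<omega> \<in> space M. x \<le> ?S R' m \<omega>} \<le> prob {\<omega> \<in> space M. \<eta> < V m \<omega>} + \<eta> / x"
    "V m \<in> borel_measurable M" if "0 < x" "0 < \<eta>" for m x \<eta>
    unfolding R'_def V_def E_def
    by (rule elementary_increment_bound[OF ed s(1), where h = "\<lambda>j. H (?s m j)" and k = "\<lambda>j. k (?s m j)"];
        use that \<tau>0 \<tau>N s H k in simp)+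
  have Vm: "V m \<in> borel_measurable M" for m by (rule ebound(2)[of 1 1]) auto
  \<comment> \<open>The variance vanishes pathwise, by the choice of \<open>\<kappa>\<close> and the continuity of the path.\<close>
  have V0: "AE \<omega> in M. (\<lambda>m. V m \<omega>) \<longlonglongrightarrow> 0"
    using aeB H'(1) AE_space
  proof eventually_elim
    case (elim \<omega>)
    have ge0: "0 \<le> V m \<omega>" for m
      unfolding V_def using clamp_cell_mono[OF \<tau>(1)] by (intro mult_nonneg_nonneg sum_nonneg) auto
    show ?case
    proof (rule LIMSEQ_I)
      fix e :: real assume "e > 0"
      define e' where "e' = sqrt (e / (4 * (C\<^sup>2 + 1) * T))"
      have e': "e' > 0" "C\<^sup>2 * (2 * e'\<^sup>2 * T) \<le> e / 2"
      proof -
        have p: "0 < C\<^sup>2 + 1" by (simp add: add_nonneg_pos)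
        then show "e' > 0" using \<open>e > 0\<close> T by (simp add: e'_def)
        have "e'\<^sup>2 = e / (4 * (C\<^sup>2 + 1) * T)" using \<open>e > 0\<close> T p by (simp add: e'_def)
        moreover have "C\<^sup>2 * (2 * (e / (4 * K * T)) * T) = (e / 2) * (C\<^sup>2 / K)" if "0 < K" for K
          using T that by (simp add: field_simps)
        ultimately have "C\<^sup>2 * (2 * e'\<^sup>2 * T) = (e / 2) * (C\<^sup>2 / (C\<^sup>2 + 1))" using p by metis
        also have "\<dots> \<le> (e / 2) * 1" using p \<open>e > 0\<close> by (intro mult_left_mono) (auto simp: divide_le_eq)
        finally show "C\<^sup>2 * (2 * e'\<^sup>2 * T) \<le> e / 2" by simp
      qed
      have "\<forall>\<^sub>F m in sequentially. \<forall>j<Suc m. \<forall>r\<in>{?s m j..?s m (Suc j)}. \<bar>H' r \<omega> - H' (?s m j) \<omega>\<bar> \<le> e'"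
        by (rule eventually_grid_oscillation[OF T0 continuous_on_subset[OF H'(2)] e'(1)]) simp
      moreover have "(\<lambda>m. C\<^sup>2 * (2 / real (Suc m))) \<longlonglongrightarrow> C\<^sup>2 * 0"
        by (intro tendsto_mult tendsto_const LIMSEQ_Suc[OF lim_const_over_n])
      then have "\<forall>\<^sub>F m in sequentially. C\<^sup>2 * (2 / real (Suc m)) < e / 2"
        by (rule order_tendstoD) (use \<open>e > 0\<close> in simp)
      moreover note elim(1)
      ultimately have "\<forall>\<^sub>F m in sequentially. norm (V m \<omega> - 0) < e"
      proof eventually_elim
        case (elim m)
        have osc: "\<bar>H' r \<omega> - H' (?s m j) \<omega>\<bar> \<le> e'" if "j < Suc m" "?s m j \<le> r" "r \<le> ?s m (Suc j)" for j r
          using elim(1) that by simp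
        let ?Q = "\<Sum>j<Suc m. \<Sum>i<N (\<kappa> m). (\<xi> (\<kappa> m) i \<omega> - H' (?s m j) \<omega>)\<^sup>2 *
          (clamp_cell (?s m) (\<tau> (\<kappa> m)) j (Suc i) - clamp_cell (?s m) (\<tau> (\<kappa> m)) j i)"
        have "ennreal ?Q \<le> 2 * D (\<kappa> m) \<omega> + ennreal (2 * e'\<^sup>2 * T)"
          unfolding D_def
          by (rule cell_variance_le[OF s(1) _ _ \<tau>(1)])
            (use s osc borel_measurable_continuous_onI[OF H'(2)] in auto)
        also have "\<dots> \<le> 2 * ennreal (1 / real (Suc m)) + ennreal (2 * e'\<^sup>2 * T)"
        proof (intro add_right_mono mult_left_mono)
          show "D (\<kappa> m) \<omega> \<le> ennreal (1 / real (Suc m))"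
            using elim(3) \<open>\<omega> \<in> space M\<close> by (auto simp: B_def not_le less_imp_le)
        qed simp
        also have "2 * ennreal (1 / real (Suc m)) + ennreal (2 * e'\<^sup>2 * T) = ennreal (2 / real (Suc m) + 2 * e'\<^sup>2 * T)"
          using T by (subst ennreal_plus) (auto simp: ennreal_mult'[symmetric] ennreal_numeral[symmetric] simp del: ennreal_numeral of_nat_Suc)
        finally have "?Q \<le> 2 / real (Suc m) + 2 * e'\<^sup>2 * T"
          by (rule ennreal_le_iff[THEN iffD1, rotated]) (use T in simp)
        then have "C\<^sup>2 * ?Q \<le> C\<^sup>2 * (2 / real (Suc m) + 2 * e'\<^sup>2 * T)" by (rule mult_left_mono) simp
        also have "\<dots> < e" using elim(2) e'(2) by (simp add: distrib_left)
        finally have "C\<^sup>2 * ?Q < e" .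
        moreover have "V m \<omega> = C\<^sup>2 * ?Q"
          unfolding V_def using \<open>\<forall>s\<ge>0. H' s \<omega> = H s \<omega>\<close> s(4)[of m] by simp
        ultimately show ?case using ge0[of m] by simp
      qed
      then show "\<exists>no. \<forall>m\<ge>no. norm (V m \<omega> - 0) < e" by (simp add: eventually_sequentially)
    qed
  qed
  have [measurable]: "E q (?s m j) \<in> borel_measurable M" "I (?s m j) \<in> borel_measurable M" "W (?s m j) \<in> borel_measurable M"
      "H (?s m j) \<in> borel_measurable M" "k (?s m j) \<in> borel_measurable M" for q m j
    using Em Im s(4) W_measurable filt_measurable[OF H] filt_measurable[OF k(1)] by auto
  have R'm[measurable]: "R' m j \<in> borel_measurable M" for m j unfolding R'_def by measurable
  have Rm[measurable]: "R m j \<in> borel_measurable M" for m j unfolding R_def by measurable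
  have S'0: "tendsto_in_prob M (?S R') (\<lambda>_. 0)"
  proof (rule tendsto_in_prob_0_if_variance_control[OF Vm V0, where f = "\<lambda>x. x"])
    have "\<bar>?S R' m \<omega>\<bar> = ?S R' m \<omega>" for m \<omega> by (simp add: sum_nonneg)
    then show "prob {\<omega> \<in> space M. x \<le> \<bar>?S R' m \<omega>\<bar>} \<le> prob {\<omega> \<in> space M. \<eta> < V m \<omega>} + \<eta> / x"
      if "0 < x" "0 < \<eta>" for m x \<eta> using ebound(1)[OF that] by simp
  qed
  \<comment> \<open>It remains to pass from the elementary integrals back to \<open>I\<close>.\<close>
  let ?e = "\<lambda>m j \<omega>. R m j \<omega> - R' m j \<omega>"
  have C0: "0 \<le> C" using k(2) abs_ge_zero order_trans by blast
  have S''0: "AE \<omega> in M. (\<lambda>m. ?S ?e m \<omega>) \<longlonglongrightarrow> 0"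
    using aeB AE_space
  proof eventually_elim
    case (elim \<omega>)
    have "\<forall>\<^sub>F m in sequentially. norm (?S ?e m \<omega>) \<le> norm (1 / real (Suc m)) * (4 * C\<^sup>2)"
      using elim(1)
    proof eventually_elim
      case (elim m)
      let ?n = "real (Suc m)"
      have E: "\<bar>E (\<kappa> m) (?s m j) \<omega> - I (?s m j) \<omega>\<bar> \<le> (1 / ?n) ^ 3" if "j \<le> Suc m" for j
      proof -
        from that have "j \<in> {..Suc m}" by simp
        with elim \<open>\<omega> \<in> space M\<close> have "\<not> (1 / ?n) ^ 3 \<le> \<bar>E (\<kappa> m) (?s m j) \<omega> - I (?s m j) \<omega>\<bar>"
          unfolding B_def by blast
        then show ?thesis by simp
      qed
      have e: "\<bar>k (?s m j) \<omega> * ?e m j \<omega>\<bar> \<le> C * (2 * (1 / ?n) ^ 3)" if "j < Suc m" for j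
        unfolding abs_mult
      proof (rule mult_mono[OF k(2)])
        have "?e m j \<omega> = (I (?s m (Suc j)) \<omega> - E (\<kappa> m) (?s m (Suc j)) \<omega>) - (I (?s m j) \<omega> - E (\<kappa> m) (?s m j) \<omega>)"
          unfolding R_def R'_def by simp
        then show "\<bar>?e m j \<omega>\<bar> \<le> 2 * (1 / ?n) ^ 3" using E[of j] E[of "Suc j"] that by linarith
      qed (use C0 in auto)
      have sq: "(\<Sum>j\<in>{j\<in>{..<Suc m}. f j = l}. k (?s m j) \<omega> * ?e m j \<omega>)\<^sup>2 \<le> (2 * C * (1 / ?n)\<^sup>2)\<^sup>2" for l
      proof -
        have "\<bar>\<Sum>j\<in>{j\<in>{..<Suc m}. f j = l}. k (?s m j) \<omega> * ?e m j \<omega>\<bar> \<le> (\<Sum>j\<in>{j\<in>{..<Suc m}. f j = l}. C * (2 * (1 / ?n) ^ 3))"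
          by (rule order_trans[OF sum_abs sum_mono[OF e]]) simp
        also have "\<dots> \<le> (\<Sum>j<Suc m. C * (2 * (1 / ?n) ^ 3))"
          using C0 by (intro sum_mono2) auto
        also have "\<dots> = ?n * (C * (2 * (1 / ?n) ^ 3))" by simp
        also have "\<dots> = 2 * C * (1 / ?n)\<^sup>2"
          by (simp add: power2_eq_square power3_eq_cube del: of_nat_Suc)
        finally show ?thesis by (rule square_le_if_abs_le)
      qed
      have "?S ?e m \<omega> \<le> (\<Sum>l\<in>f ` {..<Suc m}. (2 * C * (1 / ?n)\<^sup>2)\<^sup>2)" by (intro sum_mono sq)
      also have "\<dots> = real (card (f ` {..<Suc m})) * (2 * C * (1 / ?n)\<^sup>2)\<^sup>2" by simp
      also have "\<dots> \<le> ?n * (2 * C * (1 / ?n)\<^sup>2)\<^sup>2"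
        using card_image_le[of "{..<Suc m}" f] by (intro mult_right_mono) (auto simp del: of_nat_Suc)
      also have "\<dots> = (1 / ?n) * (4 * C\<^sup>2) * (1 / ?n)\<^sup>2"
        by (simp add: power2_eq_square del: of_nat_Suc)
      also have "\<dots> \<le> (1 / ?n) * (4 * C\<^sup>2) * 1"
        by (intro mult_left_mono) (auto simp: power_le_one divide_le_eq)
      finally show ?case by (simp add: sum_nonneg)
    qed
    then show ?case by (rule tendsto_0_le[OF LIMSEQ_Suc[OF lim_1_over_n]])
  qed
  have S''P: "tendsto_in_prob M (?S ?e) (\<lambda>_. 0)"
    by (rule tendsto_in_prob_if_AE[OF _ _ S''0]) measurable
  have both: "tendsto_in_prob M (\<lambda>m \<omega>. ?S R' m \<omega> + ?S ?e m \<omega>) (\<lambda>_. 0)"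
    by (rule tendsto_in_prob_0_add[OF _ _ S'0 S''P]) measurable
  have "tendsto_in_prob M (\<lambda>m \<omega>. (?S R' m \<omega> + ?S ?e m \<omega>) + (?S R' m \<omega> + ?S ?e m \<omega>)) (\<lambda>_. 0)"
    by (rule tendsto_in_prob_0_add[OF _ _ both both]) measurable
  moreover have "\<bar>?S R m \<omega>\<bar> \<le> \<bar>(?S R' m \<omega> + ?S ?e m \<omega>) + (?S R' m \<omega> + ?S ?e m \<omega>)\<bar>" for m \<omega>
  proof -
    have "?S R m \<omega> \<le> (\<Sum>l\<in>f ` {..<Suc m}. 2 * (\<Sum>j\<in>{j\<in>{..<Suc m}. f j = l}. k (?s m j) \<omega> * R' m j \<omega>)\<^sup>2
        + 2 * (\<Sum>j\<in>{j\<in>{..<Suc m}. f j = l}. k (?s m j) \<omega> * ?e m j \<omega>)\<^sup>2)"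
    proof (rule sum_mono)
      fix l
      have "(\<Sum>j\<in>{j\<in>{..<Suc m}. f j = l}. k (?s m j) \<omega> * R m j \<omega>) =
        (\<Sum>j\<in>{j\<in>{..<Suc m}. f j = l}. k (?s m j) \<omega> * R' m j \<omega>) + (\<Sum>j\<in>{j\<in>{..<Suc m}. f j = l}. k (?s m j) \<omega> * ?e m j \<omega>)"
        by (simp only: sum.distrib[symmetric] distrib_left[symmetric]) simp
      moreover have sq2: "(a + b)\<^sup>2 \<le> 2 * a\<^sup>2 + 2 * b\<^sup>2" for a b :: real
        using sum_squares_bound[of a b] by (simp add: power2_sum)
      ultimately show "(\<Sum>j\<in>{j\<in>{..<Suc m}. f j = l}. k (?s m j) \<omega> * R m j \<omega>)\<^sup>2 \<le>
        2 * (\<Sum>j\<in>{j\<in>{..<Suc m}. f j = l}. k (?s m j) \<omega> * R' m j \<omega>)\<^sup>2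
        + 2 * (\<Sum>j\<in>{j\<in>{..<Suc m}. f j = l}. k (?s m j) \<omega> * ?e m j \<omega>)\<^sup>2" by (simp only: sq2)
    qed
    also have "\<dots> = (?S R' m \<omega> + ?S ?e m \<omega>) + (?S R' m \<omega> + ?S ?e m \<omega>)"
      by (simp only: sum.distrib sum_distrib_left[symmetric] mult_2)
    finally show ?thesis by (simp add: sum_nonneg)
  qed
  ultimately show ?thesis
    by (rule tendsto_in_prob_0_le[rotated, OF _ AE_I2]) measurable
qed

end

section \<open>The square root along a single path\<close>

text \<open>
  This is the deterministic half of Ito's formula for \<open>S = sqrt (x + \<delta>)\<close>. The identity
  \<open>\<Delta>x = 2 S \<Delta>S + (\<Delta>S)\<^sup>2\<close> gives \<open>\<Delta>S = \<Delta>x / (2 S) - (\<Delta>S)\<^sup>2 / (2 S)\<close> exactly. In the first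
  term \<open>\<Delta>x\<close> is replaced by the right-hand side of the equation, which produces the drift integral
  and the sums of the claim. In the second,
  \<open>(\<Delta>S)\<^sup>2 \<approx> (\<Delta>x)\<^sup>2 / (4 S\<^sup>2) \<approx> \<sigma>\<^sup>2 x (\<Delta>w)\<^sup>2 / (4 S\<^sup>2)\<close>, and \<open>(\<Delta>w)\<^sup>2\<close> may be replaced by the
  cell length. The four limits in the hypotheses are the ones that probability theory has to supply.
\<close>
lemma sqrt_path_expansion:
  fixes x w :: "real \<Rightarrow> real" and \<rho> :: "nat \<Rightarrow> nat \<Rightarrow> real" and r :: "nat \<Rightarrow> nat"
  assumes T: "0 < T" and \<delta>: "0 < \<delta>" and \<sigma>: "0 < \<sigma>"
    and x: "continuous_on {0..T} x" "\<And>s. s \<in> {0..T} \<Longrightarrow> 0 \<le> x s"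
  defines "S \<equiv> \<lambda>s. sqrt (x s + \<delta>)"
  defines "dw \<equiv> \<lambda>m j. w (grid T m (Suc j)) - w (grid T m j)"
  assumes inc: "\<And>m j. j < Suc m \<Longrightarrow> x (grid T m (Suc j)) - x (grid T m j) =
      integral {grid T m j..grid T m (Suc j)} (\<lambda>r. a - b * x r) + \<sigma> * (sqrt (x (grid T m j)) * dw m j + \<rho> m j)"
    and r: "\<And>n. n \<le> r n"
    and lim1: "(\<lambda>n. \<Sum>j<Suc (r n). (\<rho> (r n) j)\<^sup>2) \<longlonglongrightarrow> 0"
    and lim2: "(\<lambda>n. \<Sum>j<Suc (r n). (1 / (2 * S (grid T (r n) j))) * \<rho> (r n) j) \<longlonglongrightarrow> 0"
    and lim3: "(\<lambda>n. \<Sum>j<Suc (r n). (x (grid T (r n) j) / S (grid T (r n) j) ^ 3) * ((dw (r n) j)\<^sup>2 - T / real (Suc (r n)))) \<longlonglongrightarrow> 0"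
    and lim4: "(\<lambda>n. \<Sum>j<Suc (r n). (dw (r n) j)\<^sup>2 - T / real (Suc (r n))) \<longlonglongrightarrow> 0"
  shows "(\<lambda>n. \<Sum>j<Suc (r n). sqrt (x (grid T (r n) j)) / (2 * S (grid T (r n) j)) * dw (r n) j) \<longlonglongrightarrow>
    (S T - S 0 - integral {0..T} (\<lambda>s. (a - b * x s) / (2 * S s)) + \<sigma>\<^sup>2 / 8 * integral {0..T} (\<lambda>s. x s / S s ^ 3)) / \<sigma>"
proof -
  define s where "s n j = grid T (r n) j" for n j
  define A where "A n j = integral {s n j..s n (Suc j)} (\<lambda>r. a - b * x r)" for n j
  define d where "d n j = dw (r n) j" for n j
  define \<alpha> where "\<alpha> n j = A n j + \<sigma> * \<rho> (r n) j" for n j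
  define dx where "dx n j = x (s n (Suc j)) - x (s n j)" for n j
  define dS where "dS n j = S (s n (Suc j)) - S (s n j)" for n j
  have rinf: "filterlim r sequentially sequentially"
    using r by (intro filterlim_at_top_mono[OF filterlim_ident]) auto
  have T0: "0 \<le> T" using T by simp
  have sT: "s n j \<in> {0..T}" if "j \<le> Suc (r n)" for n j
    using grid_nonneg[OF T0] grid_le[OF T0 that] by (simp add: s_def)
  have S_ge: "sqrt \<delta> \<le> S q" "0 < S q" if "q \<in> {0..T}" for q
    using x(2)[OF that] \<delta> by (auto simp: S_def add_nonneg_pos)
  have S_sq: "(S q)\<^sup>2 = x q + \<delta>" if "q \<in> {0..T}" for q
    using x(2)[OF that] \<delta> by (simp add: S_def)
  have Sc: "continuous_on {0..T} S" unfolding S_def by (intro continuous_intros x)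
  have S0: "S q \<noteq> 0" if "q \<in> {0..T}" for q using S_ge(2)[OF that] by simp
  obtain B where B: "B > 0" "\<And>q. q \<in> {0..T} \<Longrightarrow> S q \<le> B"
  proof -
    have "bounded (S ` {0..T})" using Sc by (intro compact_imp_bounded compact_continuous_image) auto
    then show ?thesis using that by (force simp: bounded_pos)
  qed
  obtain C where C: "C > 0" "\<And>q. q \<in> {0..T} \<Longrightarrow> \<bar>a - b * x q\<bar> \<le> C"
  proof -
    have "bounded ((\<lambda>q. a - b * x q) ` {0..T})"
      by (intro compact_imp_bounded compact_continuous_image continuous_intros x) auto
    then show ?thesis using that by (force simp: bounded_pos)
  qed
  have xB: "sqrt (x q) \<le> B" if "q \<in> {0..T}" for q
  proof -
    have "sqrt (x q) \<le> S q" using \<delta> by (simp add: S_def)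
    then show ?thesis using B(2)[OF that] by simp
  qed
  define K where "K = 1 / sqrt \<delta> ^ 3"
  have K: "0 < K" using \<delta> by (simp add: K_def)
  have SK: "0 \<le> 1 / S q ^ 3" "1 / S q ^ 3 \<le> K" if "q \<in> {0..T}" for q
    using S_ge[OF that] \<delta> by (auto simp: K_def intro!: divide_left_mono power_mono mult_pos_pos)

  have limA: "(\<lambda>n. \<Sum>j<Suc (r n). 1 / (2 * S (s n j)) * A n j) \<longlonglongrightarrow> integral {0..T} (\<lambda>s. (a - b * x s) / (2 * S s))"
  proof -
    have "(\<lambda>m. \<Sum>j<Suc m. 1 / (2 * S (grid T m j)) * integral {grid T m j..grid T m (Suc j)} (\<lambda>r. a - b * x r))
      \<longlonglongrightarrow> integral {0..T} (\<lambda>s. 1 / (2 * S s) * (a - b * x s))"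
      using S0 by (intro grid_weighted_integral_tendsto[OF T0, of "\<lambda>q. 1 / (2 * S q)"] continuous_intros x Sc) auto
    from filterlim_compose[OF this rinf] show ?thesis by (simp add: A_def s_def)
  qed
  have lim_d2: "(\<lambda>n. \<Sum>j<Suc (r n). (d n j)\<^sup>2) \<longlonglongrightarrow> T"
  proof -
    have "(\<Sum>j<Suc (r n). (dw (r n) j)\<^sup>2 - T / real (Suc (r n))) = (\<Sum>j<Suc (r n). (d n j)\<^sup>2) - T" for n
      unfolding sum_subtractf d_def by simp
    then show ?thesis using lim4 by (simp add: LIM_zero_iff)
  qed
  have lim_xd2: "(\<lambda>n. \<Sum>j<Suc (r n). x (s n j) / S (s n j) ^ 3 * (d n j)\<^sup>2) \<longlonglongrightarrow> integral {0..T} (\<lambda>s. x s / S s ^ 3)"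
  proof -
    have "(\<lambda>m. \<Sum>j<Suc m. x (grid T m j) / S (grid T m j) ^ 3 * (T / real (Suc m))) \<longlonglongrightarrow> integral {0..T} (\<lambda>s. x s / S s ^ 3)"
      using S0 by (intro grid_riemann_sum_tendsto[OF T0, of "\<lambda>q. x q / S q ^ 3"] continuous_intros x Sc) auto
    from tendsto_add[OF lim3 filterlim_compose[OF this rinf]] show ?thesis
      by (simp only: sum.distrib[symmetric] s_def d_def distrib_left[symmetric]) simp
  qed
  have lim_\<alpha>2: "(\<lambda>n. \<Sum>j<Suc (r n). (\<alpha> n j)\<^sup>2) \<longlonglongrightarrow> 0"
  proof (rule tendsto_sandwich[OF _ _ tendsto_const])
    let ?U = "\<lambda>n. 2 * ((C * T)\<^sup>2 / real (Suc (r n))) + 2 * \<sigma>\<^sup>2 * (\<Sum>j<Suc (r n). (\<rho> (r n) j)\<^sup>2)"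
    have "(\<Sum>j<Suc (r n). (\<alpha> n j)\<^sup>2) \<le> ?U n" for n
    proof -
      have A: "(A n j)\<^sup>2 \<le> (C * (T / real (Suc (r n))))\<^sup>2" if j: "j < Suc (r n)" for j
      proof -
        have sub: "{s n j..s n (Suc j)} \<subseteq> {0..T}" using sT[of j n] sT[of "Suc j" n] j by auto
        have "norm (A n j) \<le> C * (s n (Suc j) - s n j)"
          unfolding A_def
          by (rule integral_bound) (use grid_mono[OF T0] C(2) sub in \<open>auto simp: s_def intro!: continuous_intros continuous_on_subset[OF x(1)]\<close>)
        then have "\<bar>A n j\<bar> \<le> C * (T / real (Suc (r n)))" by (simp only: s_def grid_diff real_norm_def)
        from power_mono[OF this abs_ge_zero, of 2] show ?thesis by simp
      qed
      have "(\<Sum>j<Suc (r n). (\<alpha> n j)\<^sup>2) \<le> (\<Sum>j<Suc (r n). 2 * (C * (T / real (Suc (r n))))\<^sup>2 + 2 * \<sigma>\<^sup>2 * (\<rho> (r n) j)\<^sup>2)"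
      proof (rule sum_mono)
        fix j assume "j \<in> {..<Suc (r n)}"
        then have "(A n j)\<^sup>2 \<le> (C * (T / real (Suc (r n))))\<^sup>2" by (intro A) simp
        then show "(\<alpha> n j)\<^sup>2 \<le> 2 * (C * (T / real (Suc (r n))))\<^sup>2 + 2 * \<sigma>\<^sup>2 * (\<rho> (r n) j)\<^sup>2"
          using square_sum_le[of "A n j" "\<sigma> * \<rho> (r n) j"] unfolding \<alpha>_def by (simp add: power_mult_distrib)
      qed
      also have "\<dots> = ?U n"
        by (simp only: sum.distrib sum_distrib_left[symmetric] sum_constant card_lessThan)
          (simp add: power_divide power_mult_distrib power2_eq_square del: of_nat_Suc)
      finally show ?thesis .
    qed
    then show "\<forall>\<^sub>F n in sequentially. (\<Sum>j<Suc (r n). (\<alpha> n j)\<^sup>2) \<le> ?U n" by simp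
    have "(\<lambda>n. (C * T)\<^sup>2 / real (Suc (r n))) \<longlonglongrightarrow> 0"
      by (rule filterlim_compose[OF LIMSEQ_Suc[OF lim_const_over_n] rinf])
    then have "?U \<longlonglongrightarrow> 2 * 0 + 2 * \<sigma>\<^sup>2 * 0" by (intro tendsto_intros lim1)
    then show "?U \<longlonglongrightarrow> 0" by simp
  qed (simp add: sum_nonneg)
  have dx: "dx n j = \<alpha> n j + \<sigma> * (sqrt (x (s n j)) * d n j)" if "j < Suc (r n)" for n j
    using inc[OF that] by (simp add: dx_def s_def \<alpha>_def A_def d_def algebra_simps)
  \<comment> \<open>The mixed term is controlled by the Cauchy-Schwarz inequality.\<close>
  have lim_cross: "(\<lambda>n. \<Sum>j<Suc (r n). 2 * \<sigma> / S (s n j) ^ 3 * sqrt (x (s n j)) * (\<alpha> n j * d n j)) \<longlonglongrightarrow> 0"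
  proof (rule Lim_null_comparison)
    let ?U = "\<lambda>n. 2 * \<sigma> * K * B * (sqrt (\<Sum>j<Suc (r n). (\<alpha> n j)\<^sup>2) * sqrt (\<Sum>j<Suc (r n). (d n j)\<^sup>2))"
    have "norm (\<Sum>j<Suc (r n). 2 * \<sigma> / S (s n j) ^ 3 * sqrt (x (s n j)) * (\<alpha> n j * d n j)) \<le> ?U n" for n
    proof -
      have "norm (\<Sum>j<Suc (r n). 2 * \<sigma> / S (s n j) ^ 3 * sqrt (x (s n j)) * (\<alpha> n j * d n j)) \<le> (\<Sum>j<Suc (r n). 2 * \<sigma> * K * B * (\<bar>\<alpha> n j\<bar> * \<bar>d n j\<bar>))"
      proof (rule sum_norm_le)
        fix j assume "j \<in> {..<Suc (r n)}"
        then have q: "s n j \<in> {0..T}" by (intro sT) simp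
        have "\<bar>2 * \<sigma> / S (s n j) ^ 3 * sqrt (x (s n j))\<bar> = 2 * \<sigma> * (1 / S (s n j) ^ 3) * sqrt (x (s n j))"
          using \<sigma> S_ge(2)[OF q] x(2)[OF q] by simp
        also have "\<dots> \<le> 2 * \<sigma> * K * B"
          using SK[OF q] xB[OF q] \<sigma> K x(2)[OF q] by (intro mult_mono) auto
        finally show "norm (2 * \<sigma> / S (s n j) ^ 3 * sqrt (x (s n j)) * (\<alpha> n j * d n j)) \<le> 2 * \<sigma> * K * B * (\<bar>\<alpha> n j\<bar> * \<bar>d n j\<bar>)"
          unfolding real_norm_def abs_mult[of _ "\<alpha> n j * d n j"] abs_mult[of "\<alpha> n j"] by (rule mult_right_mono) simp
      qed
      also have "\<dots> = 2 * \<sigma> * K * B * (\<Sum>j<Suc (r n). \<bar>\<alpha> n j\<bar> * \<bar>d n j\<bar>)" by (simp only: sum_distrib_left)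
      also have "\<dots> \<le> ?U n"
        using \<sigma> K B L2_set_mult_ineq[of "\<alpha> n" "d n" "{..<Suc (r n)}"] unfolding L2_set_def by (intro mult_left_mono) auto
      finally show ?thesis .
    qed
    then show "\<forall>\<^sub>F n in sequentially. norm (\<Sum>j<Suc (r n). 2 * \<sigma> / S (s n j) ^ 3 * sqrt (x (s n j)) * (\<alpha> n j * d n j)) \<le> ?U n" by simp
    have "?U \<longlonglongrightarrow> 2 * \<sigma> * K * B * (sqrt 0 * sqrt T)" by (intro tendsto_intros lim_\<alpha>2 lim_d2)
    then show "?U \<longlonglongrightarrow> 0" by simp
  qed
  have lim_\<alpha>S: "(\<lambda>n. \<Sum>j<Suc (r n). 1 / S (s n j) ^ 3 * (\<alpha> n j)\<^sup>2) \<longlonglongrightarrow> 0"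
  proof (rule Lim_null_comparison)
    have "norm (\<Sum>j<Suc (r n). 1 / S (s n j) ^ 3 * (\<alpha> n j)\<^sup>2) \<le> K * (\<Sum>j<Suc (r n). (\<alpha> n j)\<^sup>2)" for n
      unfolding sum_distrib_left
    proof (rule sum_norm_le)
      fix j assume "j \<in> {..<Suc (r n)}"
      then have q: "s n j \<in> {0..T}" by (intro sT) simp
      show "norm (1 / S (s n j) ^ 3 * (\<alpha> n j)\<^sup>2) \<le> K * (\<alpha> n j)\<^sup>2"
        using SK[OF q] K unfolding real_norm_def abs_mult by (intro mult_mono) auto
    qed
    then show "\<forall>\<^sub>F n in sequentially. norm (\<Sum>j<Suc (r n). 1 / S (s n j) ^ 3 * (\<alpha> n j)\<^sup>2) \<le> K * (\<Sum>j<Suc (r n). (\<alpha> n j)\<^sup>2)" by simp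
    show "(\<lambda>n. K * (\<Sum>j<Suc (r n). (\<alpha> n j)\<^sup>2)) \<longlonglongrightarrow> 0" using tendsto_mult[OF tendsto_const lim_\<alpha>2, of K] by simp
  qed
  have lim_dx2: "(\<lambda>n. \<Sum>j<Suc (r n). (dx n j)\<^sup>2 / S (s n j) ^ 3) \<longlonglongrightarrow> \<sigma>\<^sup>2 * integral {0..T} (\<lambda>s. x s / S s ^ 3)"
  proof -
    have eq: "(\<Sum>j<Suc (r n). (dx n j)\<^sup>2 / S (s n j) ^ 3) =
        (\<Sum>j<Suc (r n). 1 / S (s n j) ^ 3 * (\<alpha> n j)\<^sup>2) + (\<Sum>j<Suc (r n). 2 * \<sigma> / S (s n j) ^ 3 * sqrt (x (s n j)) * (\<alpha> n j * d n j))
        + \<sigma>\<^sup>2 * (\<Sum>j<Suc (r n). x (s n j) / S (s n j) ^ 3 * (d n j)\<^sup>2)" for n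
      unfolding sum_distrib_left sum.distrib[symmetric]
    proof (rule sum.cong[OF refl])
      fix j assume j: "j \<in> {..<Suc (r n)}"
      then have q: "s n j \<in> {0..T}" by (intro sT) simp
      have "(dx n j)\<^sup>2 = (\<alpha> n j)\<^sup>2 + 2 * \<sigma> * sqrt (x (s n j)) * (\<alpha> n j * d n j) + \<sigma>\<^sup>2 * ((sqrt (x (s n j)))\<^sup>2 * (d n j)\<^sup>2)"
        using dx[of j n] j by (simp add: power2_eq_square algebra_simps)
      moreover have "(sqrt (x (s n j)))\<^sup>2 = x (s n j)" using x(2)[OF q] by simp
      ultimately show "(dx n j)\<^sup>2 / S (s n j) ^ 3 = 1 / S (s n j) ^ 3 * (\<alpha> n j)\<^sup>2 + 2 * \<sigma> / S (s n j) ^ 3 * sqrt (x (s n j)) * (\<alpha> n j * d n j)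
        + \<sigma>\<^sup>2 * (x (s n j) / S (s n j) ^ 3 * (d n j)\<^sup>2)"
        by (simp add: add_divide_distrib mult.assoc)
    qed
    have "(\<lambda>n. (\<Sum>j<Suc (r n). 1 / S (s n j) ^ 3 * (\<alpha> n j)\<^sup>2) + (\<Sum>j<Suc (r n). 2 * \<sigma> / S (s n j) ^ 3 * sqrt (x (s n j)) * (\<alpha> n j * d n j))
        + \<sigma>\<^sup>2 * (\<Sum>j<Suc (r n). x (s n j) / S (s n j) ^ 3 * (d n j)\<^sup>2)) \<longlonglongrightarrow> 0 + 0 + \<sigma>\<^sup>2 * integral {0..T} (\<lambda>s. x s / S s ^ 3)"
      by (intro tendsto_add tendsto_mult tendsto_const lim_\<alpha>S lim_cross lim_xd2)
    then show ?thesis unfolding eq by simp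
  qed
  \<comment> \<open>With \<open>u\<close>, \<open>v\<close> the values of \<open>S\<close> at the two ends of a cell,
    \<open>(\<Delta>x)\<^sup>2 / (8 u\<^sup>3) - (\<Delta>S)\<^sup>2 / (2 u) = (\<Delta>S)\<^sup>2 (v - u) (3 u + v) / (8 u\<^sup>3)\<close>: a small factor
    \<open>v - u\<close> times a multiple of \<open>(\<Delta>x)\<^sup>2\<close>.\<close>
  have lim_err: "(\<lambda>n. \<Sum>j<Suc (r n). (dx n j)\<^sup>2 / S (s n j) ^ 3 / 8 - (dS n j)\<^sup>2 / (2 * S (s n j))) \<longlonglongrightarrow> 0"
  proof (rule LIMSEQ_I)
    fix e :: real assume e: "e > 0"
    define M where "M = B ^ 3 * (\<sigma>\<^sup>2 * integral {0..T} (\<lambda>s. x s / S s ^ 3) + 1)"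
    define c where "c = B * K / (8 * \<delta>)"
    have Int0: "0 \<le> integral {0..T} (\<lambda>s. x s / S s ^ 3)"
      using S0 SK x(2) by (intro integral_nonneg integrable_continuous_real continuous_intros x Sc) (auto intro!: divide_nonneg_nonneg order.strict_implies_order[OF S_ge(2)])
    have M: "0 < M" using B Int0 by (auto simp: M_def intro!: mult_pos_pos add_nonneg_pos)
    have c0: "0 < c" using B K \<delta> by (simp add: c_def)
    define e' where "e' = e / (2 * c * M)"
    have e': "0 < e'" "e' * c * M < e" using e M c0 by (auto simp: e'_def field_simps)
    have "\<forall>\<^sub>F n in sequentially. (\<Sum>j<Suc (r n). (dx n j)\<^sup>2 / S (s n j) ^ 3) < \<sigma>\<^sup>2 * integral {0..T} (\<lambda>s. x s / S s ^ 3) + 1"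
      using lim_dx2 by (rule order_tendstoD) simp
    moreover have "\<forall>\<^sub>F n in sequentially. \<forall>j<Suc (r n). \<forall>q\<in>{grid T (r n) j..grid T (r n) (Suc j)}. \<bar>S q - S (grid T (r n) j)\<bar> \<le> e'"
      using rinf eventually_grid_oscillation[OF T0 Sc e'(1)] unfolding filterlim_iff by blast
    ultimately have "\<forall>\<^sub>F n in sequentially. norm ((\<Sum>j<Suc (r n). (dx n j)\<^sup>2 / S (s n j) ^ 3 / 8 - (dS n j)\<^sup>2 / (2 * S (s n j))) - 0) < e"
    proof eventually_elim
      case (elim n)
      have dS: "\<bar>dS n j\<bar> \<le> e'" if "j < Suc (r n)" for j
        using elim(2) that grid_mono[OF T0, of j "Suc j" "r n"] unfolding dS_def s_def by auto
      have "norm (\<Sum>j<Suc (r n). (dx n j)\<^sup>2 / S (s n j) ^ 3 / 8 - (dS n j)\<^sup>2 / (2 * S (s n j))) \<le> (\<Sum>j<Suc (r n). e' * c * (dx n j)\<^sup>2)"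
      proof (rule sum_norm_le)
        fix j assume "j \<in> {..<Suc (r n)}"
        then have j: "j < Suc (r n)" and q: "s n j \<in> {0..T}" and q': "s n (Suc j) \<in> {0..T}" by (auto intro: sT simp del: atLeastAtMost_iff)
        define u v where "u = S (s n j)" and "v = S (s n (Suc j))"
        have uv: "sqrt \<delta> \<le> u" "sqrt \<delta> \<le> v" "0 < u" "0 < v" "u \<le> B" "v \<le> B"
          using S_ge q q' B(2) by (auto simp: u_def v_def)
        have dx: "dx n j = (v - u) * (v + u)"
          using S_sq[OF q] S_sq[OF q'] by (simp add: dx_def u_def v_def power2_eq_square algebra_simps)
        have eq: "(dx n j)\<^sup>2 / u ^ 3 / 8 - (v - u)\<^sup>2 / (2 * u) = (v - u)\<^sup>2 * ((v - u) * (3 * u + v)) / (8 * u ^ 3)"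
          unfolding dx using uv(3) by (simp add: field_simps power2_eq_square power3_eq_cube)
        have "4 * \<delta> \<le> (v + u)\<^sup>2"
        proof -
          have "(2 * sqrt \<delta>)\<^sup>2 \<le> (v + u)\<^sup>2" using uv \<delta> by (intro power_mono) auto
          then show ?thesis using \<delta> by (simp add: power_mult_distrib)
        qed
        then have "4 * \<delta> * (v - u)\<^sup>2 \<le> (v + u)\<^sup>2 * (v - u)\<^sup>2" by (rule mult_right_mono) simp
        then have sq: "(v - u)\<^sup>2 \<le> (dx n j)\<^sup>2 / (4 * \<delta>)" 
          using \<delta> by (simp only: dx power_mult_distrib pos_le_divide_eq mult.commute mult_pos_pos zero_less_numeral)
        have k: "1 / (8 * u ^ 3) \<le> K / 8" using SK(2)[OF q] by (simp add: u_def)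
        have "\<bar>(v - u)\<^sup>2 * ((v - u) * (3 * u + v)) / (8 * u ^ 3)\<bar> = (v - u)\<^sup>2 * (\<bar>v - u\<bar> * (3 * u + v)) * (1 / (8 * u ^ 3))"
          using uv by (simp add: abs_mult)
        also have "\<dots> \<le> (dx n j)\<^sup>2 / (4 * \<delta>) * (e' * (4 * B)) * (K / 8)"
          using sq dS[OF j] uv e'(1) k \<delta> K by (intro mult_mono) (auto simp: dS_def u_def v_def)
        also have "\<dots> = e' * c * (dx n j)\<^sup>2" by (simp add: c_def mult_ac)
        finally show "norm ((dx n j)\<^sup>2 / S (s n j) ^ 3 / 8 - (dS n j)\<^sup>2 / (2 * S (s n j))) \<le> e' * c * (dx n j)\<^sup>2"
          unfolding real_norm_def dS_def u_def[symmetric] v_def[symmetric] eq .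
      qed
      also have "\<dots> = e' * c * (\<Sum>j<Suc (r n). (dx n j)\<^sup>2)" by (simp only: sum_distrib_left)
      also have "(\<Sum>j<Suc (r n). (dx n j)\<^sup>2) \<le> M"
      proof -
        have "(\<Sum>j<Suc (r n). (dx n j)\<^sup>2) \<le> (\<Sum>j<Suc (r n). B ^ 3 * ((dx n j)\<^sup>2 / S (s n j) ^ 3))"
        proof (rule sum_mono)
          fix j assume "j \<in> {..<Suc (r n)}"
          then have q: "s n j \<in> {0..T}" by (intro sT) simp
          have "S (s n j) ^ 3 \<le> B ^ 3" using S_ge(2)[OF q] B(2)[OF q] by (intro power_mono) auto
          then have "1 \<le> B ^ 3 / S (s n j) ^ 3" using S_ge(2)[OF q] by simp
          then have "1 * (dx n j)\<^sup>2 \<le> B ^ 3 / S (s n j) ^ 3 * (dx n j)\<^sup>2" by (rule mult_right_mono) simp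
          then show "(dx n j)\<^sup>2 \<le> B ^ 3 * ((dx n j)\<^sup>2 / S (s n j) ^ 3)" by simp
        qed
        also have "\<dots> = B ^ 3 * (\<Sum>j<Suc (r n). (dx n j)\<^sup>2 / S (s n j) ^ 3)" by (simp only: sum_distrib_left)
        also have "\<dots> \<le> M" using elim(1) B unfolding M_def by (intro mult_left_mono) auto
        finally show ?thesis .
      qed
      finally show ?case using e' c0 by (simp add: mult_left_mono)
    qed
    then show "\<exists>no. \<forall>n\<ge>no. norm ((\<Sum>j<Suc (r n). (dx n j)\<^sup>2 / S (s n j) ^ 3 / 8 - (dS n j)\<^sup>2 / (2 * S (s n j))) - 0) < e"
      by (simp add: eventually_sequentially)
  qed
  have lim_dS2: "(\<lambda>n. \<Sum>j<Suc (r n). (dS n j)\<^sup>2 / (2 * S (s n j))) \<longlonglongrightarrow> \<sigma>\<^sup>2 / 8 * integral {0..T} (\<lambda>s. x s / S s ^ 3)"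
  proof -
    have "(\<lambda>n. (\<Sum>j<Suc (r n). (dx n j)\<^sup>2 / S (s n j) ^ 3) / 8 - (\<Sum>j<Suc (r n). (dx n j)\<^sup>2 / S (s n j) ^ 3 / 8 - (dS n j)\<^sup>2 / (2 * S (s n j))))
      \<longlonglongrightarrow> \<sigma>\<^sup>2 * integral {0..T} (\<lambda>s. x s / S s ^ 3) / 8 - 0"
      by (intro tendsto_diff tendsto_divide lim_dx2 lim_err tendsto_const) simp
    then show ?thesis by (simp only: sum_subtractf sum_divide_distrib) simp
  qed
  have exact: "(\<Sum>j<Suc (r n). sqrt (x (s n j)) / (2 * S (s n j)) * d n j) =
      (S T - S 0 - (\<Sum>j<Suc (r n). 1 / (2 * S (s n j)) * A n j) + (\<Sum>j<Suc (r n). (dS n j)\<^sup>2 / (2 * S (s n j)))) / \<sigma>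
      - (\<Sum>j<Suc (r n). 1 / (2 * S (s n j)) * \<rho> (r n) j)" for n
  proof -
    have "S T - S 0 = (\<Sum>j<Suc (r n). dS n j)"
      unfolding dS_def by (subst sum_lessThan_telescope) (simp add: s_def)
    also have "\<dots> = (\<Sum>j<Suc (r n). 1 / (2 * S (s n j)) * A n j + \<sigma> * (1 / (2 * S (s n j)) * \<rho> (r n) j)
        + \<sigma> * (sqrt (x (s n j)) / (2 * S (s n j)) * d n j) - (dS n j)\<^sup>2 / (2 * S (s n j)))"
    proof (rule sum.cong[OF refl])
      fix j assume "j \<in> {..<Suc (r n)}"
      then have j: "j < Suc (r n)" and q: "s n j \<in> {0..T}" and q': "s n (Suc j) \<in> {0..T}" by (auto intro: sT simp del: atLeastAtMost_iff)
      define u where "u = S (s n j)"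
      have u: "u > 0" using S_ge(2)[OF q] by (simp add: u_def)
      have "dx n j = 2 * u * dS n j + (dS n j)\<^sup>2"
        using S_sq[OF q] S_sq[OF q'] by (simp add: dx_def dS_def u_def power2_eq_square algebra_simps)
      then have "dS n j = dx n j / (2 * u) - (dS n j)\<^sup>2 / (2 * u)" using u by (simp add: field_simps)
      also have "dx n j / (2 * u) = 1 / (2 * u) * A n j + \<sigma> * (1 / (2 * u) * \<rho> (r n) j) + \<sigma> * (sqrt (x (s n j)) / (2 * u) * d n j)"
        unfolding dx[OF j] \<alpha>_def by (simp add: add_divide_distrib)
      finally show "dS n j = 1 / (2 * S (s n j)) * A n j + \<sigma> * (1 / (2 * S (s n j)) * \<rho> (r n) j)
        + \<sigma> * (sqrt (x (s n j)) / (2 * S (s n j)) * d n j) - (dS n j)\<^sup>2 / (2 * S (s n j))"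
        by (simp only: u_def)
    qed
    also have "\<dots> = (\<Sum>j<Suc (r n). 1 / (2 * S (s n j)) * A n j) + \<sigma> * (\<Sum>j<Suc (r n). 1 / (2 * S (s n j)) * \<rho> (r n) j)
        + \<sigma> * (\<Sum>j<Suc (r n). sqrt (x (s n j)) / (2 * S (s n j)) * d n j) - (\<Sum>j<Suc (r n). (dS n j)\<^sup>2 / (2 * S (s n j)))"
      by (simp only: sum_subtractf sum.distrib sum_distrib_left)
    finally have main: "S T - S 0 = \<dots>" .
    have alg: "P = (D - p + q) / \<sigma> - z" if "D = p + \<sigma> * z + \<sigma> * P - q" for D P p q z
      using that \<sigma> by (simp add: field_simps)
    show ?thesis by (rule alg[OF main])
  qed
  have lim2': "(\<lambda>n. \<Sum>j<Suc (r n). 1 / (2 * S (s n j)) * \<rho> (r n) j) \<longlonglongrightarrow> 0"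
    using lim2 unfolding s_def .
  have "(\<lambda>n. \<Sum>j<Suc (r n). sqrt (x (s n j)) / (2 * S (s n j)) * d n j) \<longlonglongrightarrow>
    (S T - S 0 - integral {0..T} (\<lambda>s. (a - b * x s) / (2 * S s)) + \<sigma>\<^sup>2 / 8 * integral {0..T} (\<lambda>s. x s / S s ^ 3)) / \<sigma> - 0"
    unfolding exact using \<sigma> by (intro tendsto_diff tendsto_add tendsto_divide tendsto_const limA lim_dS2 lim2') auto
  then show ?thesis by (simp add: s_def d_def)
qed

section \<open>The regularised square root of a Cox-Ingersoll-Ross process\<close>

lemma (in brownian) grid_orthogonal:
  fixes k :: "real \<Rightarrow> 'a \<Rightarrow> real" and h :: "real \<Rightarrow> real" and m :: nat
  assumes T: "0 < T" and k: "\<And>s. 0 \<le> s \<Longrightarrow> k s \<in> borel_measurable (F s)" "\<And>s \<omega>. \<bar>k s \<omega>\<bar> \<le> C"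
    and h: "h \<in> borel_measurable borel"
  defines "D \<equiv> \<lambda>j \<omega>. h (W (grid T m (Suc j)) \<omega> - W (grid T m j) \<omega>)"
  assumes D: "\<And>j. integrable M (\<lambda>\<omega>. (D j \<omega>)\<^sup>2)" "\<And>j. expectation (D j) = 0" "\<And>j. expectation (\<lambda>\<omega>. (D j \<omega>)\<^sup>2) = q"
  shows "integrable M (\<lambda>\<omega>. (\<Sum>j<Suc m. k (grid T m j) \<omega> * D j \<omega>)\<^sup>2)"
    and "expectation (\<lambda>\<omega>. (\<Sum>j<Suc m. k (grid T m j) \<omega> * D j \<omega>)\<^sup>2) =
      (\<Sum>j<Suc m. expectation (\<lambda>\<omega>. (k (grid T m j) \<omega>)\<^sup>2) * q)"
proof -
  have T0: "0 \<le> T" using T by simp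
  have g: "0 \<le> grid T m j \<and> grid T m j < grid T m (Suc j)" for j
    using grid_nonneg[OF T0] grid_less[OF T] by blast
  have ord: "grid T m (Suc i) \<le> grid T m j \<or> grid T m (Suc j) \<le> grid T m i" if "i \<noteq> j" for i j
    using that grid_mono[OF T0, of "Suc i" j m] grid_mono[OF T0, of "Suc j" i m] by linarith
  have kb: "\<exists>C. \<forall>\<omega>\<in>space M. \<bar>k (grid T m j) \<omega>\<bar> \<le> C" for j using k(2) by blast
  note km = k(1)[OF grid_nonneg[OF T0]]
  note o = orthogonal_increments[where A = "{..<Suc m}" and u = "grid T m" and v = "\<lambda>j. grid T m (Suc j)"
      and h = "\<lambda>_. h" and c = "\<lambda>j. k (grid T m j)"]
  note D' = D[unfolded D_def]
  show "integrable M (\<lambda>\<omega>. (\<Sum>j<Suc m. k (grid T m j) \<omega> * D j \<omega>)\<^sup>2)"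
    unfolding D_def by (rule o(1)) (rule finite_lessThan g ord km kb h D'(1) D'(2) | assumption)+
  have "expectation (\<lambda>\<omega>. (\<Sum>j<Suc m. k (grid T m j) \<omega> * D j \<omega>)\<^sup>2) =
      (\<Sum>j<Suc m. expectation (\<lambda>\<omega>. (k (grid T m j) \<omega>)\<^sup>2) * expectation (\<lambda>\<omega>. (D j \<omega>)\<^sup>2))"
    unfolding D_def by (rule o(2)) (rule finite_lessThan g ord km kb h D'(1) D'(2) | assumption)+
  then show "expectation (\<lambda>\<omega>. (\<Sum>j<Suc m. k (grid T m j) \<omega> * D j \<omega>)\<^sup>2) =
      (\<Sum>j<Suc m. expectation (\<lambda>\<omega>. (k (grid T m j) \<omega>)\<^sup>2) * q)" by (simp only: D(3))
qed

text \<open>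
  The summands are orthogonal, and each has variance of the order of the squared cell length.
\<close>
lemma (in brownian) quadratic_variation:
  fixes k :: "real \<Rightarrow> 'a \<Rightarrow> real"
  assumes T: "0 < T" and k: "\<And>s. 0 \<le> s \<Longrightarrow> k s \<in> borel_measurable (F s)" "\<And>s \<omega>. \<bar>k s \<omega>\<bar> \<le> C"
  defines "Q \<equiv> \<lambda>m \<omega>. \<Sum>j<Suc m. k (grid T m j) \<omega> * ((W (grid T m (Suc j)) \<omega> - W (grid T m j) \<omega>)\<^sup>2 - T / real (Suc m))"
  shows "tendsto_in_prob M Q (\<lambda>_. 0)"
proof -
  have T0: "0 \<le> T" using T by simp
  let ?\<Delta> = "\<lambda>m. T / real (Suc m)"
  let ?h = "\<lambda>m x. x\<^sup>2 - ?\<Delta> m"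
  let ?D = "\<lambda>m j \<omega>. W (grid T m (Suc j)) \<omega> - W (grid T m j) \<omega>"
  have g: "0 \<le> grid T m j" "grid T m j < grid T m (Suc j)" for m j
    using grid_nonneg[OF T0] grid_less[OF T] by auto
  note int = W_incr_integrable[OF g]
  note mom = W_incr_moments[OF g, unfolded grid_diff]
  have sq: "(?h m (?D m j \<omega>))\<^sup>2 = ?D m j \<omega> ^ 4 - 2 * ?\<Delta> m * (?D m j \<omega>)\<^sup>2 + (?\<Delta> m)\<^sup>2" for m j \<omega>
  proof -
    have "(y\<^sup>2 - d)\<^sup>2 = y ^ 4 - 2 * d * y\<^sup>2 + d\<^sup>2" for y d :: real
      by (simp add: power2_eq_square power4_eq_xxxx algebra_simps)
    then show ?thesis .
  qed
  have hi: "integrable M (\<lambda>\<omega>. (?h m (?D m j \<omega>))\<^sup>2)" for m j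
    unfolding sq by (intro Bochner_Integration.integrable_add Bochner_Integration.integrable_diff integrable_mult_right int) simp
  have h2: "expectation (\<lambda>\<omega>. (?h m (?D m j \<omega>))\<^sup>2) = 2 * (?\<Delta> m)\<^sup>2" for m j
  proof -
    have "expectation (\<lambda>\<omega>. (?h m (?D m j \<omega>))\<^sup>2) = 3 * (?\<Delta> m)\<^sup>2 - 2 * ?\<Delta> m * ?\<Delta> m + (?\<Delta> m)\<^sup>2"
      unfolding sq using int[of m j 4] int[of m j 2]
      by (simp add: mom prob_space del: of_nat_Suc)
    then show ?thesis by (simp add: power2_eq_square del: of_nat_Suc)
  qed
  have h0: "expectation (\<lambda>\<omega>. ?h m (?D m j \<omega>)) = 0" for m j
    using int[of m j 2] by (simp add: mom prob_space del: of_nat_Suc)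
  have [measurable]: "W (grid T m j) \<in> borel_measurable M" "k (grid T m j) \<in> borel_measurable M" for m j
    using W_measurable[OF g(1)] filt_measurable[OF k(1)[OF g(1)]] by auto
  show ?thesis
  proof (rule tendsto_in_prob_0_if_L2)
    have hm: "?h m \<in> borel_measurable borel" for m by measurable
    show "integrable M (\<lambda>\<omega>. (Q m \<omega>)\<^sup>2)" for m unfolding Q_def by (rule grid_orthogonal(1)[OF T k hm hi h0 h2])
    have ort: "expectation (\<lambda>\<omega>. (Q m \<omega>)\<^sup>2) = (\<Sum>j<Suc m. expectation (\<lambda>\<omega>. (k (grid T m j) \<omega>)\<^sup>2) * (2 * (?\<Delta> m)\<^sup>2))" for m
      unfolding Q_def by (rule grid_orthogonal(2)[OF T k hm hi h0 h2])
    show "Q m \<in> borel_measurable M" for m unfolding Q_def by measurable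
    show "(\<lambda>m. expectation (\<lambda>\<omega>. (Q m \<omega>)\<^sup>2)) \<longlonglongrightarrow> 0"
    proof (rule tendsto_sandwich[OF _ _ tendsto_const])
      have "expectation (\<lambda>\<omega>. (Q m \<omega>)\<^sup>2) \<le> C\<^sup>2 * 2 * T\<^sup>2 / real (Suc m)" for m
      proof -
        have "expectation (\<lambda>\<omega>. (k (grid T m j) \<omega>)\<^sup>2) \<le> C\<^sup>2" for j
        proof -
          have le: "(k (grid T m j) \<omega>)\<^sup>2 \<le> C\<^sup>2" for \<omega> by (rule square_le_if_abs_le[OF k(2)])
          have "expectation (\<lambda>\<omega>. (k (grid T m j) \<omega>)\<^sup>2) \<le> expectation (\<lambda>_. C\<^sup>2)"
            by (rule integral_mono[OF integrable_const_bound[of _ "C\<^sup>2"]]) (use le in auto)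
          then show ?thesis by (simp add: prob_space)
        qed
        then have "expectation (\<lambda>\<omega>. (Q m \<omega>)\<^sup>2) \<le> (\<Sum>j<Suc m. C\<^sup>2 * (2 * (?\<Delta> m)\<^sup>2))"
          unfolding ort by (intro sum_mono mult_right_mono) auto
        also have "\<dots> = C\<^sup>2 * 2 * T\<^sup>2 / real (Suc m)"
          by (simp add: power2_eq_square del: of_nat_Suc)
        finally show ?thesis .
      qed
      then show "\<forall>\<^sub>F m in sequentially. expectation (\<lambda>\<omega>. (Q m \<omega>)\<^sup>2) \<le> C\<^sup>2 * 2 * T\<^sup>2 / real (Suc m)" by simp
      show "(\<lambda>m. C\<^sup>2 * 2 * T\<^sup>2 / real (Suc m)) \<longlonglongrightarrow> 0" by (rule LIMSEQ_Suc[OF lim_const_over_n])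
    qed simp
  qed
qed

text \<open>
  The process \<open>X\<close> is adapted but continuous only almost surely; \<open>Xc\<close> is a version that is
  continuous everywhere but need not be adapted.
\<close>
locale cir_solution = brownian M F W for M :: "'a measure" and F W +
  fixes X I Xc :: "real \<Rightarrow> 'a \<Rightarrow> real" and x0 a b \<sigma> :: real
  assumes \<sigma>: "0 < \<sigma>"
    and X_adapted: "\<And>s. 0 \<le> s \<Longrightarrow> X s \<in> borel_measurable (F s)"
    and X_nonneg: "\<And>s \<omega>. 0 \<le> X s \<omega>"
    and X_cont: "continuous_process M X"
    and ito: "ito_integral M F W (\<lambda>s \<omega>. sqrt (X s \<omega>)) I"
    and eq: "AE \<omega> in M. \<forall>t\<ge>0. X t \<omega> = x0 + (LBINT s:{0..t}. a - b * X s \<omega>) + \<sigma> * I t \<omega>"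
    and Xc_eq: "AE \<omega> in M. \<forall>s\<ge>0. Xc s \<omega> = X s \<omega>"
    and Xc_nonneg: "\<And>s \<omega>. 0 \<le> Xc s \<omega>"
    and Xc_cont: "\<And>\<omega>. continuous_on UNIV (\<lambda>s. Xc s \<omega>)"
    and Xc_measurable [measurable]: "\<And>s. Xc s \<in> borel_measurable M"
begin

lemma sqrt_ratio_bounds:
  assumes "0 \<le> x" "0 < \<delta>"
  shows "0 \<le> sqrt x / (2 * sqrt (x + \<delta>))" "sqrt x / (2 * sqrt (x + \<delta>)) \<le> 1 / 2"
    "0 \<le> (1 / 2 - sqrt x / (2 * sqrt (x + \<delta>)))\<^sup>2" "(1 / 2 - sqrt x / (2 * sqrt (x + \<delta>)))\<^sup>2 \<le> 1 / 4"
proof -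
  have "0 < sqrt (x + \<delta>)" "sqrt x \<le> sqrt (x + \<delta>)" using assms by auto
  then show 1: "0 \<le> sqrt x / (2 * sqrt (x + \<delta>))" "sqrt x / (2 * sqrt (x + \<delta>)) \<le> 1 / 2"
    using assms by (auto simp: divide_le_eq)
  have "(1 / 2 - sqrt x / (2 * sqrt (x + \<delta>)))\<^sup>2 \<le> (1 / 2)\<^sup>2" using 1 by (intro power_mono) auto
  then show "(1 / 2 - sqrt x / (2 * sqrt (x + \<delta>)))\<^sup>2 \<le> 1 / 4" by (simp add: power2_eq_square)
qed simp

text \<open>
  Its expectation bounds the mean square of the difference between \<open>W / 2\<close> and the stochastic
  integral in Ito's formula for \<open>sqrt (X + \<delta>)\<close>, whose integrand is \<open>sqrt X / (2 sqrt (X + \<delta>))\<close>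
  up to the factor \<open>\<sigma>\<close>.
\<close>
definition defect :: "real \<Rightarrow> real \<Rightarrow> 'a \<Rightarrow> real" where
  "defect \<delta> T \<omega> = integral {0..T} (\<lambda>s. (1 / 2 - sqrt (Xc s \<omega>) / (2 * sqrt (Xc s \<omega> + \<delta>)))\<^sup>2)"

lemma defect_continuous:
  "0 < \<delta> \<Longrightarrow> continuous_on A (\<lambda>s. (1 / 2 - sqrt (Xc s \<omega>) / (2 * sqrt (Xc s \<omega> + \<delta>)))\<^sup>2)"
  using Xc_nonneg[of _ \<omega>]
  by (intro continuous_intros continuous_on_subset[OF Xc_cont]) (auto simp: add_nonneg_eq_0_iff)

lemma defect_bounds: "0 < \<delta> \<Longrightarrow> 0 \<le> T \<Longrightarrow> 0 \<le> defect \<delta> T \<omega>" "0 < \<delta> \<Longrightarrow> 0 \<le> T \<Longrightarrow> defect \<delta> T \<omega> \<le> T / 4"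
proof -
  assume \<delta>: "0 < \<delta>" and T: "0 \<le> T"
  show "0 \<le> defect \<delta> T \<omega>"
    unfolding defect_def by (intro integral_nonneg integrable_continuous_real defect_continuous \<delta>) simp
  have "defect \<delta> T \<omega> \<le> integral {0..T} (\<lambda>s. 1 / 4)"
    unfolding defect_def using sqrt_ratio_bounds(4)[OF Xc_nonneg \<delta>]
    by (intro integral_le integrable_continuous_real defect_continuous \<delta>) auto
  then show "defect \<delta> T \<omega> \<le> T / 4" using T by simp
qed

lemma defect_riemann:
  assumes \<delta>: "0 < \<delta>" and T: "0 \<le> T"
  shows "(\<lambda>m. \<Sum>j<Suc m. (1 / 2 - sqrt (Xc (grid T m j) \<omega>) / (2 * sqrt (Xc (grid T m j) \<omega> + \<delta>)))\<^sup>2 * (T / real (Suc m)))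
    \<longlonglongrightarrow> defect \<delta> T \<omega>"
  unfolding defect_def by (rule grid_riemann_sum_tendsto[OF T defect_continuous[OF \<delta>]])

lemma defect_measurable:
  assumes \<delta>: "0 < \<delta>" and T: "0 \<le> T"
  shows "defect \<delta> T \<in> borel_measurable M"
  by (rule borel_measurable_LIMSEQ_metric[OF _ defect_riemann[OF \<delta> T]]) measurable

lemma defect_integrable: "0 < \<delta> \<Longrightarrow> 0 \<le> T \<Longrightarrow> integrable M (defect \<delta> T)"
  using defect_bounds defect_measurable by (intro integrable_const_bound[of _ "T / 4"]) auto

text \<open>
  The equation of the process, in a form that refers to one exceptional null set for all times.
\<close>
lemma X_increment:
  "AE \<omega> in M. continuous_on {0..} (\<lambda>s. X s \<omega>) \<and> (\<forall>s t. 0 \<le> s \<and> s \<le> t \<longrightarrow>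
    X t \<omega> - X s \<omega> = integral {s..t} (\<lambda>r. a - b * X r \<omega>) + \<sigma> * (I t \<omega> - I s \<omega>))"
proof -
  have "AE \<omega> in M. continuous_on {0..} (\<lambda>s. X s \<omega>)"
    using X_cont unfolding continuous_process_def by blast
  with eq show ?thesis
  proof eventually_elim
    case (elim \<omega>)
    have c: "continuous_on {p..q} (\<lambda>r. a - b * X r \<omega>)" if "0 \<le> p" for p q
      by (intro continuous_intros continuous_on_subset[OF elim(2)]) (use that in auto)
    have lb: "(LBINT s:{0..t}. a - b * X s \<omega>) = integral {0..t} (\<lambda>r. a - b * X r \<omega>)" for t
      by (rule set_borel_integral_eq_integral(2)[OF borel_integrable_atLeastAtMost'[OF c]]) simp
    have "X t \<omega> - X s \<omega> = integral {s..t} (\<lambda>r. a - b * X r \<omega>) + \<sigma> * (I t \<omega> - I s \<omega>)" if "0 \<le> s" "s \<le> t" for s t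
    proof -
      have "integral {0..s} (\<lambda>r. a - b * X r \<omega>) + integral {s..t} (\<lambda>r. a - b * X r \<omega>) = integral {0..t} (\<lambda>r. a - b * X r \<omega>)"
        by (rule Henstock_Kurzweil_Integration.integral_combine[OF that integrable_continuous_real[OF c]]) simp
      moreover have "X t \<omega> = x0 + integral {0..t} (\<lambda>r. a - b * X r \<omega>) + \<sigma> * I t \<omega>"
        "X s \<omega> = x0 + integral {0..s} (\<lambda>r. a - b * X r \<omega>) + \<sigma> * I s \<omega>"
        using elim(1) that lb by auto
      ultimately show ?thesis by (simp add: algebra_simps)
    qed
    with elim(2) show ?case by blast
  qed
qed

text \<open>
  This is Ito's formula for \<open>sqrt (X + \<delta>)\<close>, with the stochastic integral written as
  \<open>W / 2\<close> minus a remainder \<open>V\<close> that the isometry controls.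
\<close>
lemma ito_formula_sqrt:
  assumes T: "0 < T" and \<delta>: "0 < \<delta>"
  shows "\<exists>V \<in> borel_measurable M.
    (AE \<omega> in M. sqrt (X T \<omega> + \<delta>) - sqrt (X 0 \<omega> + \<delta>) =
       integral {0..T} (\<lambda>s. (a - b * X s \<omega>) / (2 * sqrt (X s \<omega> + \<delta>)))
       - \<sigma>\<^sup>2 / 8 * integral {0..T} (\<lambda>s. X s \<omega> / sqrt (X s \<omega> + \<delta>) ^ 3)
       + \<sigma> * (W T \<omega> / 2 - V \<omega>)) \<and>
    (\<integral>\<^sup>+\<omega>. ennreal ((V \<omega>)\<^sup>2) \<partial>M) \<le> ennreal (expectation (defect \<delta> T))"
proof -
  have T0: "0 \<le> T" using T by simp
  let ?s = "grid T"
  let ?S = "\<lambda>s \<omega>. sqrt (X s \<omega> + \<delta>)"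
  let ?dW = "\<lambda>m j \<omega>. W (?s m (Suc j)) \<omega> - W (?s m j) \<omega>"
  define R where "R m j \<omega> = I (?s m (Suc j)) \<omega> - I (?s m j) \<omega> - sqrt (X (?s m j) \<omega>) * ?dW m j \<omega>" for m j \<omega>
  define k1 where "k1 s \<omega> = 1 / (2 * ?S s \<omega>)" for s \<omega>
  define k2 where "k2 s \<omega> = X s \<omega> / ?S s \<omega> ^ 3" for s \<omega>
  define g where "g s \<omega> = sqrt (X s \<omega>) / (2 * ?S s \<omega>)" for s \<omega>
  have Spos: "0 < ?S s \<omega>" "sqrt \<delta> \<le> ?S s \<omega>" "(?S s \<omega>)\<^sup>2 = X s \<omega> + \<delta>" for s \<omega>
    using X_nonneg[of s \<omega>] \<delta> by (auto simp: add_nonneg_pos)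
  have k1: "\<And>s. 0 \<le> s \<Longrightarrow> k1 s \<in> borel_measurable (F s)" "\<And>s \<omega>. \<bar>k1 s \<omega>\<bar> \<le> 1 / (2 * sqrt \<delta>)"
  proof -
    fix s :: real and \<omega>
    show "0 \<le> s \<Longrightarrow> k1 s \<in> borel_measurable (F s)" using X_adapted[of s] unfolding k1_def by measurable
    show "\<bar>k1 s \<omega>\<bar> \<le> 1 / (2 * sqrt \<delta>)"
      using Spos[of s \<omega>] \<delta> unfolding k1_def by (auto intro!: divide_left_mono)
  qed
  have k2: "\<And>s. 0 \<le> s \<Longrightarrow> k2 s \<in> borel_measurable (F s)" "\<And>s \<omega>. \<bar>k2 s \<omega>\<bar> \<le> 1 / sqrt \<delta>"
  proof -
    fix s :: real and \<omega>
    show "0 \<le> s \<Longrightarrow> k2 s \<in> borel_measurable (F s)" using X_adapted[of s] unfolding k2_def by measurable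
    have "\<bar>k2 s \<omega>\<bar> = X s \<omega> / ?S s \<omega> ^ 3" unfolding k2_def using X_nonneg[of s \<omega>] Spos(1)[of s \<omega>] by simp
    also have "\<dots> \<le> (?S s \<omega>)\<^sup>2 / ?S s \<omega> ^ 3"
      using Spos[of s \<omega>] \<delta> by (intro divide_right_mono) auto
    also have "\<dots> = 1 / ?S s \<omega>" using Spos(1)[of s \<omega>] by (simp add: power2_eq_square power3_eq_cube)
    also have "\<dots> \<le> 1 / sqrt \<delta>" using Spos[of s \<omega>] \<delta> by (intro divide_left_mono) auto
    finally show "\<bar>k2 s \<omega>\<bar> \<le> 1 / sqrt \<delta>" .
  qed
  have gm: "\<And>s. 0 \<le> s \<Longrightarrow> g s \<in> borel_measurable (F s)"
    using X_adapted unfolding g_def by measurable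
  have gb: "0 \<le> g s \<omega>" "g s \<omega> \<le> 1 / 2" for s \<omega>
    using sqrt_ratio_bounds[OF X_nonneg \<delta>] by (auto simp: g_def)
  have HX: "\<And>s. 0 \<le> s \<Longrightarrow> (\<lambda>\<omega>. sqrt (X s \<omega>)) \<in> borel_measurable (F s)" using X_adapted by measurable
  have Hc: "continuous_process M (\<lambda>s \<omega>. sqrt (X s \<omega>))"
    using X_cont unfolding continuous_process_def stochastic_process_def
    by (auto intro!: borel_measurable_sqrt elim!: AE_mp intro: continuous_on_real_sqrt)
  have sm[measurable]: "W (?s m j) \<in> borel_measurable M" "X (?s m j) \<in> borel_measurable M" "I (?s m j) \<in> borel_measurable M" for m j
    using W_measurable filt_measurable[OF X_adapted] grid_nonneg[OF T0, of m j] ito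
    unfolding ito_integral_def continuous_process_def stochastic_process_def by auto
  have [measurable]: "R m j \<in> borel_measurable M" for m j unfolding R_def by measurable
  have [measurable]: "k1 (?s m j) \<in> borel_measurable M" "k2 (?s m j) \<in> borel_measurable M" "g (?s m j) \<in> borel_measurable M" for m j
    unfolding k1_def k2_def g_def by measurable
  \<comment> \<open>The four sums whose limits the pathwise expansion requires. They vanish in probability; the sum of
    their absolute values (or squares) then vanishes almost surely along one common subsequence.\<close>
  define Z1 where "Z1 m \<omega> = (\<Sum>j<Suc m. (R m j \<omega>)\<^sup>2)" for m \<omega>
  define Z2 where "Z2 m \<omega> = (\<Sum>j<Suc m. k1 (?s m j) \<omega> * R m j \<omega>)" for m \<omega>
  define Z3 where "Z3 m \<omega> = (\<Sum>j<Suc m. k2 (?s m j) \<omega> * ((?dW m j \<omega>)\<^sup>2 - T / real (Suc m)))" for m \<omega>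
  define Z4 where "Z4 m \<omega> = (\<Sum>j<Suc m. 1 * ((?dW m j \<omega>)\<^sup>2 - T / real (Suc m)))" for m \<omega>
  have [measurable]: "Z1 m \<in> borel_measurable M" "Z2 m \<in> borel_measurable M" "Z3 m \<in> borel_measurable M" "Z4 m \<in> borel_measurable M" for m
    unfolding Z1_def Z2_def Z3_def Z4_def by measurable
  have P1: "tendsto_in_prob M Z1 (\<lambda>_. 0)"
  proof -
    have "{j \<in> {..<Suc m}. j = l} = {l}" if "l \<in> {..<Suc m}" for m l using that by auto
    then have "(\<Sum>l\<in>(\<lambda>j. j) ` {..<Suc m}. (\<Sum>j\<in>{j\<in>{..<Suc m}. j = l}. 1 * R m j \<omega>)\<^sup>2) = Z1 m \<omega>" for m \<omega>
      unfolding Z1_def image_ident by (intro sum.cong refl) simp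
    then show ?thesis
      using ito_increment_approximation[OF HX Hc ito T, of "\<lambda>_ _. 1" 1 "\<lambda>j. j"]
      by (simp add: R_def[symmetric] del: of_nat_Suc)
  qed
  have P2: "tendsto_in_prob M (\<lambda>m \<omega>. (Z2 m \<omega>)\<^sup>2) (\<lambda>_. 0)"
  proof -
    have "(\<lambda>_. 0) ` {..<Suc m} = {0 :: nat}" for m by auto
    then have "(\<Sum>l\<in>(\<lambda>_. 0 :: nat) ` {..<Suc m}. (\<Sum>j\<in>{j\<in>{..<Suc m}. 0 = l}. k1 (?s m j) \<omega> * R m j \<omega>)\<^sup>2) = (Z2 m \<omega>)\<^sup>2" for m \<omega>
      unfolding Z2_def by (simp add: lessThan_def del: of_nat_Suc sum.lessThan_Suc)
    then show ?thesis
      using ito_increment_approximation[OF HX Hc ito T k1, of "\<lambda>_. 0 :: nat"]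
      by (simp only: R_def[symmetric])
  qed
  have P3: "tendsto_in_prob M (\<lambda>m \<omega>. \<bar>Z3 m \<omega>\<bar>) (\<lambda>_. 0)"
    using quadratic_variation[OF T k2] unfolding Z3_def[symmetric] tendsto_in_prob_def by simp
  have P4: "tendsto_in_prob M (\<lambda>m \<omega>. \<bar>Z4 m \<omega>\<bar>) (\<lambda>_. 0)"
    using quadratic_variation[OF T, of "\<lambda>_ _. 1" 1] unfolding Z4_def[symmetric] tendsto_in_prob_def by simp
  have PZ: "tendsto_in_prob M (\<lambda>m \<omega>. (Z1 m \<omega> + (Z2 m \<omega>)\<^sup>2) + (\<bar>Z3 m \<omega>\<bar> + \<bar>Z4 m \<omega>\<bar>)) (\<lambda>_. 0)"
    by (rule tendsto_in_prob_0_add[OF _ _ tendsto_in_prob_0_add[OF _ _ P1 P2] tendsto_in_prob_0_add[OF _ _ P3 P4]]) measurable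
  have "\<exists>r. (\<forall>n. n \<le> r n) \<and> (AE \<omega> in M. (\<lambda>n. (Z1 (r n) \<omega> + (Z2 (r n) \<omega>)\<^sup>2) + (\<bar>Z3 (r n) \<omega>\<bar> + \<bar>Z4 (r n) \<omega>\<bar>)) \<longlonglongrightarrow> 0)"
    by (rule tendsto_in_prob_AE_subsequence[OF _ _ PZ]) measurable
  then obtain r where r: "\<And>n. n \<le> r n"
    and Z0: "AE \<omega> in M. (\<lambda>n. (Z1 (r n) \<omega> + (Z2 (r n) \<omega>)\<^sup>2) + (\<bar>Z3 (r n) \<omega>\<bar> + \<bar>Z4 (r n) \<omega>\<bar>)) \<longlonglongrightarrow> 0" by blast
  define J where "J \<omega> = (?S T \<omega> - ?S 0 \<omega> - integral {0..T} (\<lambda>s. (a - b * X s \<omega>) / (2 * ?S s \<omega>))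
      + \<sigma>\<^sup>2 / 8 * integral {0..T} (\<lambda>s. X s \<omega> / ?S s \<omega> ^ 3)) / \<sigma>" for \<omega>
  have limJ: "AE \<omega> in M. (\<lambda>n. \<Sum>j<Suc (r n). g (?s (r n) j) \<omega> * ?dW (r n) j \<omega>) \<longlonglongrightarrow> J \<omega>"
    using Z0 X_increment
  proof eventually_elim
    case (elim \<omega>)
    have Z1': "0 \<le> Z1 m \<omega>" for m unfolding Z1_def by (simp add: sum_nonneg)
    have squeeze: "f \<longlonglongrightarrow> 0"
      if "\<And>n. 0 \<le> f n" "\<And>n. f n \<le> (Z1 (r n) \<omega> + (Z2 (r n) \<omega>)\<^sup>2) + (\<bar>Z3 (r n) \<omega>\<bar> + \<bar>Z4 (r n) \<omega>\<bar>)" for f :: "nat \<Rightarrow> real"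
      by (rule tendsto_sandwich[OF _ _ tendsto_const elim(1)]) (use that in auto)
    have z1: "(\<lambda>n. Z1 (r n) \<omega>) \<longlonglongrightarrow> 0" and z2: "(\<lambda>n. (Z2 (r n) \<omega>)\<^sup>2) \<longlonglongrightarrow> 0"
      and z3: "(\<lambda>n. \<bar>Z3 (r n) \<omega>\<bar>) \<longlonglongrightarrow> 0" and z4: "(\<lambda>n. \<bar>Z4 (r n) \<omega>\<bar>) \<longlonglongrightarrow> 0"
      using Z1' by (intro squeeze; simp)+
    have z2': "(\<lambda>n. Z2 (r n) \<omega>) \<longlonglongrightarrow> 0" using z2 by (simp add: power_tendsto_0_iff)
    have z3': "(\<lambda>n. Z3 (r n) \<omega>) \<longlonglongrightarrow> 0" "(\<lambda>n. Z4 (r n) \<omega>) \<longlonglongrightarrow> 0"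
      using z3 z4 by (simp_all only: tendsto_rabs_zero_iff)
    show ?case
      unfolding J_def g_def
    proof (rule sqrt_path_expansion[where \<rho> = "\<lambda>m j. R m j \<omega>", OF T \<delta> \<sigma>])
      show "continuous_on {0..T} (\<lambda>s. X s \<omega>)" using elim(2) by (auto intro: continuous_on_subset)
      show "0 \<le> X s \<omega>" for s by (rule X_nonneg)
      show "X (?s m (Suc j)) \<omega> - X (?s m j) \<omega> = integral {?s m j..?s m (Suc j)} (\<lambda>r. a - b * X r \<omega>) +
          \<sigma> * (sqrt (X (?s m j) \<omega>) * ?dW m j \<omega> + R m j \<omega>)" for m j
        using elim(2) grid_nonneg[OF T0, of m j] grid_mono[OF T0, of j "Suc j" m] by (simp add: R_def)
      show "(\<lambda>n. \<Sum>j<Suc (r n). (R (r n) j \<omega>)\<^sup>2) \<longlonglongrightarrow> 0" using z1 by (simp only: Z1_def)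
      show "(\<lambda>n. \<Sum>j<Suc (r n). 1 / (2 * ?S (?s (r n) j) \<omega>) * R (r n) j \<omega>) \<longlonglongrightarrow> 0" using z2' by (simp only: Z2_def k1_def)
      show "(\<lambda>n. \<Sum>j<Suc (r n). X (?s (r n) j) \<omega> / ?S (?s (r n) j) \<omega> ^ 3 * ((?dW (r n) j \<omega>)\<^sup>2 - T / real (Suc (r n)))) \<longlonglongrightarrow> 0"
        using z3' by (simp only: Z3_def k2_def)
      show "(\<lambda>n. \<Sum>j<Suc (r n). (?dW (r n) j \<omega>)\<^sup>2 - T / real (Suc (r n))) \<longlonglongrightarrow> 0"
        using z3' by (simp only: Z4_def mult_1)
    qed (rule r)
  qed
  \<comment> \<open>\<open>U\<close> approximates \<open>W / 2\<close> minus the stochastic integral; its second moment is computed exactly.\<close>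
  define U where "U n \<omega> = (\<Sum>j<Suc (r n). (1 / 2 - g (?s (r n) j) \<omega>) * ?dW (r n) j \<omega>)" for n \<omega>
  have [measurable]: "U n \<in> borel_measurable M" for n unfolding U_def by measurable
  define V where "V \<omega> = lim (\<lambda>n. U n \<omega>)" for \<omega>
  have Vm[measurable]: "V \<in> borel_measurable M" unfolding V_def by measurable
  have W0: "AE \<omega> in M. W 0 \<omega> = 0" using bm unfolding brownian_motion_def by blast
  have limU: "AE \<omega> in M. (\<lambda>n. U n \<omega>) \<longlonglongrightarrow> W T \<omega> / 2 - J \<omega>"
    using limJ W0
  proof eventually_elim
    case (elim \<omega>)
    have tel: "(\<Sum>j<Suc m. ?dW m j \<omega>) = W T \<omega>" for m
      by (subst sum_lessThan_telescope) (simp add: elim(2))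
    have "U n \<omega> = W T \<omega> / 2 - (\<Sum>j<Suc (r n). g (?s (r n) j) \<omega> * ?dW (r n) j \<omega>)" for n
    proof -
      have "U n \<omega> = 1 / 2 * (\<Sum>j<Suc (r n). ?dW (r n) j \<omega>) - (\<Sum>j<Suc (r n). g (?s (r n) j) \<omega> * ?dW (r n) j \<omega>)"
        by (simp only: U_def left_diff_distrib sum_distrib_left flip: sum_subtractf)
      then show ?thesis unfolding tel by simp
    qed
    then show ?case using tendsto_diff[OF tendsto_const elim(1), of "W T \<omega> / 2"] by simp
  qed
  have VU: "AE \<omega> in M. V \<omega> = W T \<omega> / 2 - J \<omega> \<and> (\<lambda>n. U n \<omega>) \<longlonglongrightarrow> V \<omega>"
    using limU by eventually_elim (simp add: V_def limI)
  have identity: "AE \<omega> in M. ?S T \<omega> - ?S 0 \<omega> =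
       integral {0..T} (\<lambda>s. (a - b * X s \<omega>) / (2 * ?S s \<omega>))
       - \<sigma>\<^sup>2 / 8 * integral {0..T} (\<lambda>s. X s \<omega> / ?S s \<omega> ^ 3)
       + \<sigma> * (W T \<omega> / 2 - V \<omega>)"
    using VU
  proof eventually_elim
    case (elim \<omega>)
    then have 1: "\<sigma> * (W T \<omega> / 2 - V \<omega>) = \<sigma> * J \<omega>" by (simp only: diff_diff_eq2 add_diff_cancel_left')
    have 2: "\<sigma> * J \<omega> = ?S T \<omega> - ?S 0 \<omega> - integral {0..T} (\<lambda>s. (a - b * X s \<omega>) / (2 * ?S s \<omega>))
      + \<sigma>\<^sup>2 / 8 * integral {0..T} (\<lambda>s. X s \<omega> / ?S s \<omega> ^ 3)"
      unfolding J_def by (rule nonzero_mult_div_cancel_left[THEN trans[OF times_divide_eq_right]]) (use \<sigma> in simp)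
    show ?case unfolding 1 2 by linarith
  qed
  have bound: "(\<integral>\<^sup>+\<omega>. ennreal ((V \<omega>)\<^sup>2) \<partial>M) \<le> ennreal (expectation (defect \<delta> T))"
  proof -
    let ?q = "\<lambda>m \<omega>. \<Sum>j<Suc m. (1 / 2 - sqrt (Xc (?s m j) \<omega>) / (2 * sqrt (Xc (?s m j) \<omega> + \<delta>)))\<^sup>2 * (T / real (Suc m))"
    have rinf: "filterlim r sequentially sequentially"
      using r by (intro filterlim_at_top_mono[OF filterlim_ident]) auto
    have g2: "0 \<le> (1 / 2 - g s \<omega>)\<^sup>2" "(1 / 2 - g s \<omega>)\<^sup>2 \<le> 1" for s \<omega>
      using sqrt_ratio_bounds(4)[OF X_nonneg \<delta>, of s \<omega>] by (auto simp: g_def)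
    have EU: "integrable M (\<lambda>\<omega>. (U n \<omega>)\<^sup>2)" "expectation (\<lambda>\<omega>. (U n \<omega>)\<^sup>2) = expectation (?q (r n))" for n
    proof -
      have s: "0 \<le> ?s m j" "?s m j < ?s m (Suc j)" for m j
        using grid_nonneg[OF T0] grid_less[OF T] by auto
      have km: "(\<lambda>\<omega>. 1 / 2 - g q \<omega>) \<in> borel_measurable (F q)" if "0 \<le> q" for q
        using gm[OF that] by measurable
      have kb: "\<bar>1 / 2 - g q \<omega>\<bar> \<le> 1 / 2" for q \<omega>
        using gb[of q \<omega>] by (simp add: abs_le_iff)
      have dW: "integrable M (\<lambda>\<omega>. (?dW m j \<omega>)\<^sup>2)" "expectation (?dW m j) = 0" "expectation (\<lambda>\<omega>. (?dW m j \<omega>)\<^sup>2) = T / real (Suc m)" for m j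
        using W_incr_integrable[OF s] W_incr_moments(1)[OF s] W_incr_moments(2)[OF s] by (simp_all only: grid_diff)
      note o = grid_orthogonal[OF T km kb measurable_ident_sets[OF refl] dW, of "r n"]
      show "integrable M (\<lambda>\<omega>. (U n \<omega>)\<^sup>2)" unfolding U_def by (rule o(1))
      have "expectation (\<lambda>\<omega>. (U n \<omega>)\<^sup>2) = (\<Sum>j<Suc (r n). expectation (\<lambda>\<omega>. (1 / 2 - g (?s (r n) j) \<omega>)\<^sup>2) * (T / real (Suc (r n))))"
        unfolding U_def by (rule o(2))
      also have "\<dots> = (\<Sum>j<Suc (r n). expectation (\<lambda>\<omega>. (1 / 2 - g (?s (r n) j) \<omega>)\<^sup>2 * (T / real (Suc (r n)))))"
        by (simp only: integral_mult_left_zero)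
      also have "\<dots> = expectation (\<lambda>\<omega>. \<Sum>j<Suc (r n). (1 / 2 - g (?s (r n) j) \<omega>)\<^sup>2 * (T / real (Suc (r n))))"
        by (rule Bochner_Integration.integral_sum[symmetric], intro integrable_mult_left integrable_const_bound[of _ 1])
          (use g2 in \<open>auto intro!: AE_I2\<close>)
      also have "\<dots> = expectation (?q (r n))"
      proof (rule integral_cong_AE)
        show "AE \<omega> in M. (\<Sum>j<Suc (r n). (1 / 2 - g (?s (r n) j) \<omega>)\<^sup>2 * (T / real (Suc (r n)))) = ?q (r n) \<omega>"
          using Xc_eq by eventually_elim (simp add: g_def grid_nonneg[OF T0] del: of_nat_Suc)
      qed measurable
      finally show "expectation (\<lambda>\<omega>. (U n \<omega>)\<^sup>2) = expectation (?q (r n))" .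
    qed
    have "(\<lambda>m. expectation (?q m)) \<longlonglongrightarrow> expectation (defect \<delta> T)"
    proof (rule integral_dominated_convergence[where w = "\<lambda>_. T / 4"])
      show "defect \<delta> T \<in> borel_measurable M" by (rule defect_measurable[OF \<delta> T0])
      show "AE \<omega> in M. (\<lambda>m. ?q m \<omega>) \<longlonglongrightarrow> defect \<delta> T \<omega>" using defect_riemann[OF \<delta> T0] by simp
      have "norm (?q m \<omega>) \<le> T / 4" for m \<omega>
      proof -
        have "norm (?q m \<omega>) \<le> (\<Sum>j<Suc m. 1 / 4 * (T / real (Suc m)))"
        proof (rule sum_norm_le)
          fix j
          show "norm ((1 / 2 - sqrt (Xc (?s m j) \<omega>) / (2 * sqrt (Xc (?s m j) \<omega> + \<delta>)))\<^sup>2 * (T / real (Suc m))) \<le> 1 / 4 * (T / real (Suc m))"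
            using sqrt_ratio_bounds(3,4)[OF Xc_nonneg \<delta>, of "?s m j" \<omega>] T0
            unfolding real_norm_def abs_mult by (intro mult_mono) auto
        qed
        also have "\<dots> = T / 4" by (simp del: of_nat_Suc)
        finally show ?thesis .
      qed
      then show "AE \<omega> in M. norm (?q m \<omega>) \<le> T / 4" for m by (rule AE_I2)
      show "?q m \<in> borel_measurable M" for m by measurable
      show "integrable M (\<lambda>_. T / 4)" by simp
    qed
    then have lim: "(\<lambda>n. ennreal (expectation (\<lambda>\<omega>. (U n \<omega>)\<^sup>2))) \<longlonglongrightarrow> ennreal (expectation (defect \<delta> T))"
      unfolding EU(2) by (rule tendsto_ennrealI[OF filterlim_compose[OF _ rinf]])
    have "(\<integral>\<^sup>+\<omega>. ennreal ((V \<omega>)\<^sup>2) \<partial>M) = (\<integral>\<^sup>+\<omega>. liminf (\<lambda>n. ennreal ((U n \<omega>)\<^sup>2)) \<partial>M)"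
    proof (rule nn_integral_cong_AE)
      show "AE \<omega> in M. ennreal ((V \<omega>)\<^sup>2) = liminf (\<lambda>n. ennreal ((U n \<omega>)\<^sup>2))"
        using VU
      proof eventually_elim
        case (elim \<omega>)
        then have "(\<lambda>n. ennreal ((U n \<omega>)\<^sup>2)) \<longlonglongrightarrow> ennreal ((V \<omega>)\<^sup>2)" by (intro tendsto_ennrealI tendsto_power) auto
        then show ?case by (rule lim_imp_Liminf[OF sequentially_bot, symmetric])
      qed
    qed
    also have "\<dots> \<le> liminf (\<lambda>n. \<integral>\<^sup>+\<omega>. ennreal ((U n \<omega>)\<^sup>2) \<partial>M)"
      by (rule nn_integral_liminf[of "\<lambda>n \<omega>. ennreal ((U n \<omega>)\<^sup>2)"]) measurable
    also have "\<dots> = liminf (\<lambda>n. ennreal (expectation (\<lambda>\<omega>. (U n \<omega>)\<^sup>2)))"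
      by (simp only: nn_integral_eq_integral[OF EU(1) AE_I2[OF zero_le_power2]])
    also have "\<dots> = ennreal (expectation (defect \<delta> T))"
      using lim by (rule lim_imp_Liminf[OF sequentially_bot])
    finally show ?thesis .
  qed
  show ?thesis by (rule bexI[where x = V]) (rule conjI[OF identity bound], rule Vm)
qed

end

section \<open>The singular equation driven by a path\<close>

text \<open>
  The division is that of the extended nonnegative reals, so that for \<open>\<epsilon> > 0\<close> a finite value
  forces \<open>y\<close> to be positive almost everywhere on \<open>[0, t]\<close>.
\<close>
definition singular_integral :: "real \<Rightarrow> (real \<Rightarrow> real) \<Rightarrow> real \<Rightarrow> ennreal" where
  "singular_integral \<epsilon> y t = (\<integral>\<^sup>+s\<in>{0..t}. ennreal \<epsilon> / ennreal (y s) \<partial>lborel)"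

text \<open>
  The equation of the square root of a Cox-Ingersoll-Ross process. It contains no stochastic
  integral and is meaningful for a single path \<open>w\<close>.
\<close>
definition singular_solution ::
  "real \<Rightarrow> real \<Rightarrow> real \<Rightarrow> (real \<Rightarrow> real) \<Rightarrow> real \<Rightarrow> (real \<Rightarrow> real) \<Rightarrow> bool" where
  "singular_solution y0 \<beta> c w \<epsilon> y \<longleftrightarrow> continuous_on {0..} y \<and> (\<forall>t\<ge>0. 0 \<le> y t) \<and>
     (\<forall>t\<ge>0. singular_integral \<epsilon> y t < \<infinity> \<and>
       y t = y0 + enn2real (singular_integral \<epsilon> y t) / 2 - \<beta> * integral {0..t} y + c * w t)"

lemma singular_integral_mono: "s \<le> t \<Longrightarrow> singular_integral \<epsilon> y s \<le> singular_integral \<epsilon> y t"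
  unfolding singular_integral_def
proof (rule nn_integral_mono)
  fix u assume "s \<le> t"
  then have "indicator {0..s} u \<le> (indicator {0..t} u :: ennreal)" by (intro indicator_leI) auto
  then show "ennreal \<epsilon> / ennreal (y u) * indicator {0..s} u \<le> ennreal \<epsilon> / ennreal (y u) * indicator {0..t} u"
    by (rule mult_left_mono) simp
qed

lemma singular_integral_0: "singular_integral \<epsilon> y 0 = 0"
proof -
  have "singular_integral \<epsilon> y 0 = (\<integral>\<^sup>+s. 0 \<partial>(lborel::real measure))"
    unfolding singular_integral_def
  proof (rule nn_integral_cong_AE)
    have "AE s in (lborel::real measure). s \<noteq> 0" by (rule AE_lborel_singleton)
    then show "AE s in lborel. ennreal \<epsilon> / ennreal (y s) * indicator {0..0} s = 0"
      by eventually_elim simp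
  qed
  then show ?thesis by simp
qed

lemma singular_integral_increment_le:
  assumes y: "continuous_on {0..} y" and st: "0 \<le> s" "s \<le> t" and fin: "singular_integral \<epsilon> y t < \<infinity>"
    and \<epsilon>: "0 \<le> \<epsilon>" and h: "0 < h" and le: "\<And>u. u \<in> {s..t} \<Longrightarrow> h \<le> y u"
  shows "enn2real (singular_integral \<epsilon> y t) - enn2real (singular_integral \<epsilon> y s) \<le> \<epsilon> / h * (t - s)"
proof -
  let ?f = "\<lambda>u. ennreal \<epsilon> / ennreal (y u)"
  have m: "(\<lambda>u. ?f u * indicator A u) \<in> borel_measurable lborel" if A: "A \<in> sets borel" "A \<subseteq> {0..}" for A
  proof -
    have "(\<lambda>u. indicator {0..} u *\<^sub>R y u) \<in> borel_measurable borel"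
      by (rule borel_measurable_continuous_on_indicator[OF _ y]) simp
    then have "(\<lambda>u. ennreal \<epsilon> / ennreal (indicator {0..} u *\<^sub>R y u) * indicator A u) \<in> borel_measurable lborel"
      using A by measurable
    also have "(\<lambda>u. ennreal \<epsilon> / ennreal (indicator {0..} u *\<^sub>R y u) * indicator A u) = (\<lambda>u. ?f u * indicator A u)"
      using A(2) by (auto simp: fun_eq_iff indicator_def)
    finally show ?thesis .
  qed
  have "singular_integral \<epsilon> y t = (\<integral>\<^sup>+u. ?f u * indicator {0..s} u + ?f u * indicator {s<..t} u \<partial>lborel)"
    unfolding singular_integral_def by (rule nn_integral_cong) (use st in \<open>auto simp: indicator_def\<close>)
  also have "\<dots> = singular_integral \<epsilon> y s + (\<integral>\<^sup>+u. ?f u * indicator {s<..t} u \<partial>lborel)"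
    unfolding singular_integral_def by (rule nn_integral_add; rule m) (use st in auto)
  also have "\<dots> \<le> singular_integral \<epsilon> y s + (\<integral>\<^sup>+u. ennreal (\<epsilon> / h) * indicator {s<..t} u \<partial>lborel)"
  proof (intro add_left_mono nn_integral_mono)
    fix u
    show "?f u * indicator {s<..t} u \<le> ennreal (\<epsilon> / h) * indicator {s<..t} u"
    proof (cases "u \<in> {s<..t}")
      case True
      then have "h \<le> y u" by (intro le) auto
      then have "?f u = ennreal (\<epsilon> / y u)" using h \<epsilon> by (intro divide_ennreal) auto
      also have "\<dots> \<le> ennreal (\<epsilon> / h)" using \<open>h \<le> y u\<close> h \<epsilon> by (intro ennreal_leI divide_left_mono) auto
      finally show ?thesis using True by simp
    qed simp
  qed
  also have "(\<integral>\<^sup>+u. ennreal (\<epsilon> / h) * indicator {s<..t} u \<partial>lborel) = ennreal (\<epsilon> / h * (t - s))"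
    using st \<epsilon> h by (simp add: nn_integral_cmult_indicator ennreal_mult'[symmetric])
  finally have le: "singular_integral \<epsilon> y t \<le> singular_integral \<epsilon> y s + ennreal (\<epsilon> / h * (t - s))" .
  have fin': "singular_integral \<epsilon> y s < \<infinity>"
    using singular_integral_mono[OF st(2)] fin by (rule order.strict_trans1)
  have "enn2real (singular_integral \<epsilon> y t) \<le> enn2real (singular_integral \<epsilon> y s + ennreal (\<epsilon> / h * (t - s)))"
    using le fin' by (intro enn2real_mono) auto
  also have "\<dots> = enn2real (singular_integral \<epsilon> y s) + \<epsilon> / h * (t - s)"
    using fin' st \<epsilon> h by (subst enn2real_plus) auto
  finally show ?thesis by simp
qed

section \<open>Removing the regularisation along a single path\<close>

lemma integral_eq_lborel:
  fixes f :: "real \<Rightarrow> real"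
  assumes "continuous_on {0..T} f"
  shows "integral {0..T} f = (\<integral>s. indicator {0..T} s * f s \<partial>lborel)"
    and "integrable lborel (\<lambda>s. indicator {0..T} s * f s)"
  using borel_integrable_atLeastAtMost'[OF assms] set_borel_integral_eq_integral(2)[of "{0..T}" f]
  by (simp_all add: set_lebesgue_integral_def set_integrable_def)

lemma nn_integral_eq_integral_Icc:
  fixes f :: "real \<Rightarrow> real"
  assumes f: "continuous_on {0..T} f" and nn: "\<And>s. s \<in> {0..T} \<Longrightarrow> 0 \<le> f s"
  shows "(\<integral>\<^sup>+s\<in>{0..T}. ennreal (f s) \<partial>lborel) = ennreal (integral {0..T} f)"
proof -
  have "(\<integral>\<^sup>+s\<in>{0..T}. ennreal (f s) \<partial>lborel) = (\<integral>\<^sup>+s. ennreal (indicator {0..T} s * f s) \<partial>lborel)"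
    by (intro nn_integral_cong) (simp add: indicator_def)
  also have "\<dots> = ennreal (\<integral>s. indicator {0..T} s * f s \<partial>lborel)"
    by (rule nn_integral_eq_integral[OF integral_eq_lborel(2)[OF f]]) (use nn in \<open>auto simp: indicator_def\<close>)
  finally show ?thesis by (simp only: integral_eq_lborel(1)[OF f])
qed

lemma frequently_le_if_liminf_finite:
  fixes X :: "nat \<Rightarrow> ennreal"
  assumes "liminf X < \<infinity>"
  shows "\<exists>B::real. \<exists>\<^sub>F l in sequentially. X l < ennreal B"
proof -
  obtain r where r: "0 \<le> r" "liminf X = ennreal r" using assms by (cases "liminf X") auto
  have "\<not> (\<forall>\<^sub>F l in sequentially. ennreal (r + 1) \<le> X l)"
  proof
    assume "\<forall>\<^sub>F l in sequentially. ennreal (r + 1) \<le> X l"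
    then have "ennreal (r + 1) \<le> liminf X" by (rule Liminf_bounded)
    then show False using r by (simp add: ennreal_le_iff)
  qed
  then have "\<exists>\<^sub>F l in sequentially. X l < ennreal (r + 1)"
    by (simp add: frequently_def not_less)
  then show ?thesis by blast
qed

lemma liminf_finite_if_frequently_le:
  fixes X :: "nat \<Rightarrow> ennreal"
  assumes "\<exists>\<^sub>F l in sequentially. X l \<le> ennreal B"
  shows "liminf X < \<infinity>"
proof -
  have "liminf X \<le> ennreal B"
  proof (rule ccontr)
    assume "\<not> liminf X \<le> ennreal B"
    then have "ennreal B < liminf X" by simp
    then have "\<forall>\<^sub>F l in sequentially. ennreal B < X l" by (rule less_LiminfD)
    with assms show False by (simp add: frequently_def not_le)
  qed
  then show ?thesis by (rule order.strict_trans1) simp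
qed

text \<open>
  The case \<open>x = 0\<close>, with the limit \<open>\<infinity>\<close>, is what later rules out a zero set of positive measure.
\<close>
lemma tendsto_ennreal_divide_sqrt:
  assumes \<epsilon>: "0 < \<epsilon>" and x: "0 \<le> x"
  shows "(\<lambda>l. ennreal (\<epsilon> / sqrt (x + 1 / real (Suc l)))) \<longlonglongrightarrow> ennreal \<epsilon> / ennreal (sqrt x)"
proof (cases "x = 0")
  case True
  have "filterlim (\<lambda>l. \<epsilon> * sqrt (real (Suc l))) at_top sequentially"
    by (intro filterlim_tendsto_pos_mult_at_top[OF tendsto_const \<epsilon>] filterlim_compose[OF sqrt_at_top]
      filterlim_compose[OF filterlim_real_sequentially] filterlim_Suc)
  then have lim: "(\<lambda>l. ennreal (\<epsilon> * sqrt (real (Suc l)))) \<longlonglongrightarrow> \<infinity>"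
    by (simp only: infinity_ennreal_def ennreal_tendsto_top_eq_at_top)
  show ?thesis using lim \<epsilon> True by (simp add: real_sqrt_divide ennreal_divide_zero del: of_nat_Suc)
next
  case False
  then have "0 < sqrt x" using x by simp
  have "(\<lambda>l. ennreal (\<epsilon> / sqrt (x + 1 / real (Suc l)))) \<longlonglongrightarrow> ennreal (\<epsilon> / sqrt (x + 0))"
    using False by (intro tendsto_intros LIMSEQ_Suc[OF lim_1_over_n]) auto
  then show ?thesis using \<open>0 < sqrt x\<close> \<epsilon> by (simp add: divide_ennreal)
qed

text \<open>
  A path of the process, regularised by \<open>d l = 1 / (l + 1)\<close>; \<open>w\<close> stands for half the terminal value
  of the Brownian path and \<open>v l\<close> for the remainder in Ito's formula.
\<close>
locale sqrt_path =
  fixes x :: "real \<Rightarrow> real" and v :: "nat \<Rightarrow> real" and T \<epsilon> b \<sigma> w :: real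
  assumes T: "0 < T" and \<epsilon>: "0 < \<epsilon>" and b: "0 < b" and \<sigma>: "0 < \<sigma>"
    and x: "continuous_on {0..T} x" "\<And>s. s \<in> {0..T} \<Longrightarrow> 0 \<le> x s"
begin

abbreviation d :: "nat \<Rightarrow> real" where "d l \<equiv> 1 / real (Suc l)"
definition S :: "nat \<Rightarrow> real \<Rightarrow> real" where "S l s = sqrt (x s + d l)"

lemma S_pos: "s \<in> {0..T} \<Longrightarrow> 0 < S l s"
  using x(2)[of s] by (simp add: S_def add_nonneg_pos del: of_nat_Suc)

lemma S_ge: "sqrt (x s) \<le> S l s"
  by (simp add: S_def)

lemma S_sq: "s \<in> {0..T} \<Longrightarrow> (S l s)\<^sup>2 = x s + d l"
  using x(2)[of s] by (simp add: S_def del: of_nat_Suc)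

lemma S_cont: "continuous_on {0..T} (S l)"
  unfolding S_def by (intro continuous_intros x)

lemma S_nz: "s \<in> {0..T} \<Longrightarrow> S l s \<noteq> 0"
  using S_pos[of s l] by simp

lemma x_div_S_le: "s \<in> {0..T} \<Longrightarrow> x s / S l s \<le> sqrt (x s)"
  using mult_left_mono[OF S_ge[of s l], of "sqrt (x s)"] x(2)[of s] S_pos[of s l] by (simp add: divide_le_eq)

lemma S_tendsto: "(\<lambda>l. S l s) \<longlonglongrightarrow> sqrt (x s)"
proof -
  have "(\<lambda>l. S l s) \<longlonglongrightarrow> sqrt (x s + 0)"
    unfolding S_def by (intro tendsto_intros LIMSEQ_Suc[OF lim_1_over_n])
  then show ?thesis by simp
qed

abbreviation K :: ennreal where "K \<equiv> singular_integral \<epsilon> (\<lambda>s. sqrt (x s)) T"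

lemma x_measurable: "(\<lambda>s. indicator {0..T} s * x s) \<in> borel_measurable lborel"
  using integral_eq_lborel(2)[OF x(1)] by (rule borel_measurable_integrable)

lemma integrand_measurable:
  "(\<lambda>s. ennreal \<epsilon> / ennreal (sqrt (x s)) * indicator {0..T} s) \<in> borel_measurable lborel"
proof -
  have "(\<lambda>s. ennreal \<epsilon> / ennreal (sqrt (indicator {0..T} s * x s)) * indicator {0..T} s) \<in> borel_measurable lborel"
    using x_measurable by measurable
  also have "(\<lambda>s. ennreal \<epsilon> / ennreal (sqrt (indicator {0..T} s * x s)) * indicator {0..T} s) =
    (\<lambda>s. ennreal \<epsilon> / ennreal (sqrt (x s)) * indicator {0..T} s)"
    by (auto simp: indicator_def)
  finally show ?thesis .
qed

lemma x_pos_if_K_finite: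
  assumes "K < \<infinity>"
  shows "AE s in lborel. s \<in> {0..T} \<longrightarrow> 0 < x s"
proof -
  have "AE s in lborel. ennreal \<epsilon> / ennreal (sqrt (x s)) * indicator {0..T} s \<noteq> \<infinity>"
    using assms unfolding singular_integral_def by (intro nn_integral_PInf_AE integrand_measurable) simp
  then show ?thesis
  proof eventually_elim
    case (elim s)
    show ?case
    proof
      assume s: "s \<in> {0..T}"
      with elim have "x s \<noteq> 0" using \<epsilon> by (auto simp: ennreal_divide_zero)
      with x(2)[OF s] show "0 < x s" by simp
    qed
  qed
qed

lemma limit_integrable:
  assumes "K < \<infinity>"
  shows "integrable lborel (\<lambda>s. indicator {0..T} s * (\<epsilon> / sqrt (x s)))"
    and "(\<integral>s. indicator {0..T} s * (\<epsilon> / sqrt (x s)) \<partial>lborel) = enn2real K"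
proof -
  have m: "(\<lambda>s. indicator {0..T} s * (\<epsilon> / sqrt (x s))) \<in> borel_measurable lborel"
  proof -
    have "(\<lambda>s. indicator {0..T} s * (\<epsilon> / sqrt (indicator {0..T} s * x s))) \<in> borel_measurable lborel"
      using x_measurable by measurable
    also have "(\<lambda>s. indicator {0..T} s * (\<epsilon> / sqrt (indicator {0..T} s * x s))) = (\<lambda>s. indicator {0..T} s * (\<epsilon> / sqrt (x s)))"
      by (auto simp: indicator_def)
    finally show ?thesis .
  qed
  have nn: "0 \<le> indicator {0..T} s * (\<epsilon> / sqrt (x s))" for s
    using x(2)[of s] \<epsilon> by (auto simp: indicator_def)
  have "(\<integral>\<^sup>+s. ennreal (indicator {0..T} s * (\<epsilon> / sqrt (x s))) \<partial>lborel) = K"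
    unfolding singular_integral_def
  proof (rule nn_integral_cong_AE)
    show "AE s in lborel. ennreal (indicator {0..T} s * (\<epsilon> / sqrt (x s))) = ennreal \<epsilon> / ennreal (sqrt (x s)) * indicator {0..T} s"
      using x_pos_if_K_finite[OF assms]
    proof eventually_elim
      case (elim s)
      then show ?case using \<epsilon> by (auto simp: indicator_def divide_ennreal)
    qed
  qed
  then show "integrable lborel (\<lambda>s. indicator {0..T} s * (\<epsilon> / sqrt (x s)))"
      "(\<integral>s. indicator {0..T} s * (\<epsilon> / sqrt (x s)) \<partial>lborel) = enn2real K"
    using assms m nn by (auto intro!: integrableI_nonneg simp: integral_eq_nn_integral)
qed

text \<open>
  Dominated convergence off the zero set of \<open>x\<close>, which is negligible if the singular integral is
  finite.
\<close>
lemma integral_tendsto_if_dominated: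
  fixes f :: "nat \<Rightarrow> real \<Rightarrow> real" and g h :: "real \<Rightarrow> real"
  assumes K: "K < \<infinity>" and f: "\<And>l. continuous_on {0..T} (f l)"
    and h: "integrable lborel (\<lambda>s. indicator {0..T} s * h s)"
    and g: "(\<lambda>s. indicator {0..T} s * g s) \<in> borel_measurable lborel"
    and lim: "\<And>s. s \<in> {0..T} \<Longrightarrow> 0 < x s \<Longrightarrow> (\<lambda>l. f l s) \<longlonglongrightarrow> g s"
    and bd: "\<And>l s. s \<in> {0..T} \<Longrightarrow> 0 < x s \<Longrightarrow> \<bar>f l s\<bar> \<le> h s"
  shows "(\<lambda>l. integral {0..T} (f l)) \<longlonglongrightarrow> (\<integral>s. indicator {0..T} s * g s \<partial>lborel)"
  unfolding integral_eq_lborel(1)[OF f]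
proof (rule integral_dominated_convergence[OF g _ h])
  show "(\<lambda>s. indicator {0..T} s * f l s) \<in> borel_measurable lborel" for l
    using integral_eq_lborel(2)[OF f] by (rule borel_measurable_integrable)
  show "AE s in lborel. (\<lambda>l. indicator {0..T} s * f l s) \<longlonglongrightarrow> indicator {0..T} s * g s"
    using x_pos_if_K_finite[OF K]
  proof eventually_elim
    case (elim s)
    then show ?case using lim[of s] by (cases "s \<in> {0..T}") simp_all
  qed
  show "AE s in lborel. norm (indicator {0..T} s * f l s) \<le> indicator {0..T} s * h s" for l
    using x_pos_if_K_finite[OF K]
  proof eventually_elim
    case (elim s)
    then show ?case using bd[of s l] by (cases "s \<in> {0..T}") simp_all
  qed
qed

lemma defect_tendsto_0:
  assumes K: "K < \<infinity>"
  shows "(\<lambda>l. integral {0..T} (\<lambda>s. (1 / 2 - sqrt (x s) / (2 * sqrt (x s + d l)))\<^sup>2)) \<longlonglongrightarrow> 0"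
proof -
  let ?f = "\<lambda>l s. (1 / 2 - sqrt (x s) / (2 * S l s))\<^sup>2"
  have "(\<lambda>l. integral {0..T} (?f l)) \<longlonglongrightarrow> (\<integral>s. indicator {0..T} s * 0 \<partial>lborel)"
  proof (rule integral_tendsto_if_dominated[OF K])
    show "continuous_on {0..T} (?f l)" for l
      using S_nz by (intro continuous_intros x S_cont) auto
    show "integrable lborel (\<lambda>s. indicator {0..T} s * (1::real))"
      by (rule integral_eq_lborel(2)[OF continuous_on_const])
    fix s assume s: "s \<in> {0..T}" "0 < x s"
    then have "(\<lambda>l. ?f l s) \<longlonglongrightarrow> (1 / 2 - sqrt (x s) / (2 * sqrt (x s)))\<^sup>2"
      by (intro tendsto_intros S_tendsto) auto
    with s show "(\<lambda>l. ?f l s) \<longlonglongrightarrow> 0" by simp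
    fix l
    have "0 \<le> sqrt (x s) / (2 * S l s)" "sqrt (x s) / (2 * S l s) \<le> 1 / 2"
      using S_pos[OF s(1), of l] S_ge[of s l] x(2)[OF s(1)] by (auto simp: divide_le_eq)
    then have "?f l s \<le> 1\<^sup>2" by (intro power_mono) auto
    then show "\<bar>?f l s\<bar> \<le> 1" by simp
  qed simp
  then show ?thesis by (simp add: S_def)
qed

context
  assumes identity: "\<And>l. sqrt (x T + d l) - sqrt (x 0 + d l) =
      integral {0..T} (\<lambda>s. (\<sigma>\<^sup>2 / 4 + \<epsilon> - b * x s) / (2 * sqrt (x s + d l)))
      - \<sigma>\<^sup>2 / 8 * integral {0..T} (\<lambda>s. x s / sqrt (x s + d l) ^ 3) + \<sigma> * (w - v l)"
begin

text \<open>
  The coefficient \<open>\<sigma>\<^sup>2 / 4\<close> is the one that the second-order term cancels, up to a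
  multiple of \<open>d / S\<^sup>3\<close>, whose integral vanishes in the limit.
\<close>
lemma regularised_identity:
  "S l T - S l 0 = integral {0..T} (\<lambda>s. \<epsilon> / (2 * S l s)) + \<sigma>\<^sup>2 / 8 * integral {0..T} (\<lambda>s. d l / S l s ^ 3)
    - b / 2 * integral {0..T} (\<lambda>s. x s / S l s) + \<sigma> * (w - v l)"
proof -
  have i: "(\<lambda>s. \<epsilon> / (2 * S l s)) integrable_on {0..T}" "(\<lambda>s. \<sigma>\<^sup>2 / 8 * (d l / S l s ^ 3)) integrable_on {0..T}"
    "(\<lambda>s. b / 2 * (x s / S l s)) integrable_on {0..T}" "(\<lambda>s. \<sigma>\<^sup>2 / 8 * (x s / S l s ^ 3)) integrable_on {0..T}"
    "(\<lambda>s. (\<sigma>\<^sup>2 / 4 + \<epsilon> - b * x s) / (2 * S l s)) integrable_on {0..T}"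
    using S_nz by (auto intro!: integrable_continuous_real continuous_intros x S_cont)
  have p: "(\<sigma>\<^sup>2 / 4 + \<epsilon> - b * x s) / (2 * S l s) - \<sigma>\<^sup>2 / 8 * (x s / S l s ^ 3) =
     \<epsilon> / (2 * S l s) + \<sigma>\<^sup>2 / 8 * (d l / S l s ^ 3) - b / 2 * (x s / S l s)" if s: "s \<in> {0..T}" for s
  proof -
    define u where "u = S l s"
    have u: "u \<noteq> 0" using S_nz[OF s] by (simp add: u_def)
    have xs: "x s = u\<^sup>2 - d l" using S_sq[OF s, of l] by (simp add: u_def)
    have "1 / u = (x s + d l) / u ^ 3" using u xs by (simp add: power2_eq_square power3_eq_cube)
    then have "\<sigma>\<^sup>2 / 8 * (1 / u) = \<sigma>\<^sup>2 / 8 * (x s / u ^ 3) + \<sigma>\<^sup>2 / 8 * (d l / u ^ 3)"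
      by (simp only: add_divide_distrib distrib_left)
    moreover have "(\<sigma>\<^sup>2 / 4 + \<epsilon> - b * x s) / (2 * u) = \<sigma>\<^sup>2 / 8 * (1 / u) + \<epsilon> / (2 * u) - b / 2 * (x s / u)"
      using u by (simp add: add_divide_distrib diff_divide_distrib)
    ultimately show ?thesis unfolding u_def by linarith
  qed
  have "integral {0..T} (\<lambda>s. (\<sigma>\<^sup>2 / 4 + \<epsilon> - b * x s) / (2 * S l s)) - integral {0..T} (\<lambda>s. \<sigma>\<^sup>2 / 8 * (x s / S l s ^ 3))
    = integral {0..T} (\<lambda>s. (\<sigma>\<^sup>2 / 4 + \<epsilon> - b * x s) / (2 * S l s) - \<sigma>\<^sup>2 / 8 * (x s / S l s ^ 3))"
    by (rule Henstock_Kurzweil_Integration.integral_diff[symmetric]) (use i in auto)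
  also have "\<dots> = integral {0..T} (\<lambda>s. \<epsilon> / (2 * S l s) + \<sigma>\<^sup>2 / 8 * (d l / S l s ^ 3) - b / 2 * (x s / S l s))"
    by (rule Henstock_Kurzweil_Integration.integral_cong) (rule p)
  also have "\<dots> = integral {0..T} (\<lambda>s. \<epsilon> / (2 * S l s)) + integral {0..T} (\<lambda>s. \<sigma>\<^sup>2 / 8 * (d l / S l s ^ 3))
     - integral {0..T} (\<lambda>s. b / 2 * (x s / S l s))"
    by (simp only: Henstock_Kurzweil_Integration.integral_diff Henstock_Kurzweil_Integration.integral_add
        integrable_add i)
  finally show ?thesis
    using identity[of l] unfolding S_def[symmetric] integral_mult_right by linarith
qed

text \<open>
  All terms of the identity other than the singular integral are bounded along a subsequence of
  indices on which the remainders \<open>v l\<close> are bounded. Hence so are the regularised integrals, and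
  Fatou's lemma carries the bound over to the limit.
\<close>
lemma K_finite:
  assumes "liminf (\<lambda>l. ennreal ((v l)\<^sup>2)) < \<infinity>"
  shows "K < \<infinity>"
proof -
  obtain B where B: "\<exists>\<^sub>F l in sequentially. ennreal ((v l)\<^sup>2) < ennreal B"
    using frequently_le_if_liminf_finite[OF assms] by blast
  define C where "C = sqrt (x T + 1) + b / 2 * integral {0..T} (\<lambda>s. sqrt (x s)) + \<sigma> * \<bar>w\<bar> + \<sigma> * (1 + B)"
  have c: "continuous_on {0..T} (\<lambda>s. \<epsilon> / S l s)" for l
    using S_nz by (intro continuous_intros S_cont) auto
  have bound: "integral {0..T} (\<lambda>s. \<epsilon> / S l s) \<le> 2 * C" if "ennreal ((v l)\<^sup>2) < ennreal B" for l
  proof -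
    have "(v l)\<^sup>2 < B" using that by (simp add: ennreal_less_iff)
    moreover have "\<bar>v l\<bar> \<le> 1 + (v l)\<^sup>2"
      using sum_squares_bound[of "\<bar>v l\<bar>" 1] by (simp add: power2_eq_square)
    ultimately have "\<bar>v l\<bar> \<le> 1 + B" by simp
    then have "\<sigma> * (v l - w) \<le> \<sigma> * \<bar>w\<bar> + \<sigma> * (1 + B)"
      using \<sigma> unfolding distrib_left[symmetric] by (intro mult_left_mono) auto
    moreover have "S l T \<le> sqrt (x T + 1)" by (simp add: S_def divide_le_eq)
    moreover have "0 \<le> S l 0" using S_pos[of 0 l] T by simp
    moreover have "0 \<le> \<sigma>\<^sup>2 / 8 * integral {0..T} (\<lambda>s. d l / S l s ^ 3)"
      using S_nz S_pos[THEN less_imp_le] by (intro mult_nonneg_nonneg integral_nonneg integrable_continuous_real continuous_intros S_cont) auto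
    moreover have "b / 2 * integral {0..T} (\<lambda>s. x s / S l s) \<le> b / 2 * integral {0..T} (\<lambda>s. sqrt (x s))"
    proof (intro mult_left_mono integral_le integrable_continuous_real continuous_intros x S_cont ballI)
      fix s assume s: "s \<in> {0..T}"
      show "S l s \<noteq> 0" by (rule S_nz[OF s])
      show "x s / S l s \<le> sqrt (x s)" by (rule x_div_S_le[OF s])
    qed (use b in auto)
    moreover have "integral {0..T} (\<lambda>s. \<epsilon> / (2 * S l s)) = integral {0..T} (\<lambda>s. \<epsilon> / S l s) / 2"
    proof -
      have "(\<lambda>s. \<epsilon> / (2 * S l s)) = (\<lambda>s. 1 / 2 * (\<epsilon> / S l s))" by auto
      then show ?thesis by (simp only: integral_mult_right)
    qed
    ultimately show ?thesis using regularised_identity[of l] unfolding C_def by (simp add: right_diff_distrib)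
  qed
  have "K = (\<integral>\<^sup>+s. liminf (\<lambda>l. ennreal (\<epsilon> / S l s) * indicator {0..T} s) \<partial>lborel)"
    unfolding singular_integral_def
  proof (rule nn_integral_cong)
    fix s
    show "ennreal \<epsilon> / ennreal (sqrt (x s)) * indicator {0..T} s = liminf (\<lambda>l. ennreal (\<epsilon> / S l s) * indicator {0..T} s)"
    proof (cases "s \<in> {0..T}")
      case True
      have "(\<lambda>l. ennreal (\<epsilon> / S l s)) \<longlonglongrightarrow> ennreal \<epsilon> / ennreal (sqrt (x s))"
        unfolding S_def by (rule tendsto_ennreal_divide_sqrt[OF \<epsilon> x(2)[OF True]])
      from lim_imp_Liminf[OF sequentially_bot this] True show ?thesis by simp
    qed (simp add: Liminf_const)
  qed
  also have "\<dots> \<le> liminf (\<lambda>l. \<integral>\<^sup>+s. ennreal (\<epsilon> / S l s) * indicator {0..T} s \<partial>lborel)"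
  proof (rule nn_integral_liminf)
    fix l
    have "(\<lambda>s. ennreal (indicator {0..T} s * (\<epsilon> / S l s))) \<in> borel_measurable lborel"
      using borel_measurable_integrable[OF integral_eq_lborel(2)[OF c]] by measurable
    also have "(\<lambda>s. ennreal (indicator {0..T} s * (\<epsilon> / S l s))) = (\<lambda>s. ennreal (\<epsilon> / S l s) * indicator {0..T} s)"
      by (auto simp: indicator_def)
    finally show "(\<lambda>s. ennreal (\<epsilon> / S l s) * indicator {0..T} s) \<in> borel_measurable lborel" .
  qed
  also have "\<dots> = liminf (\<lambda>l. ennreal (integral {0..T} (\<lambda>s. \<epsilon> / S l s)))"
  proof -
    have "(\<integral>\<^sup>+s. ennreal (\<epsilon> / S l s) * indicator {0..T} s \<partial>lborel) = ennreal (integral {0..T} (\<lambda>s. \<epsilon> / S l s))" for l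
      by (rule nn_integral_eq_integral_Icc[OF c]) (use \<epsilon> S_pos in \<open>auto intro!: divide_nonneg_pos\<close>)
    then show ?thesis by simp
  qed
  also have "\<dots> < \<infinity>"
  proof (rule liminf_finite_if_frequently_le)
    show "\<exists>\<^sub>F l in sequentially. ennreal (integral {0..T} (\<lambda>s. \<epsilon> / S l s)) \<le> ennreal (2 * C)"
      using B by (rule frequently_elim1) (rule ennreal_leI[OF bound])
  qed
  finally show ?thesis .
qed

lemma sqrt_equation:
  assumes K: "K < \<infinity>" and r: "\<And>n. n \<le> r n" and v: "(\<lambda>n. v (r n)) \<longlonglongrightarrow> 0"
  shows "sqrt (x T) - sqrt (x 0) = enn2real K / 2 - b / 2 * integral {0..T} (\<lambda>s. sqrt (x s)) + \<sigma> * w"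
proof -
  have rinf: "filterlim r sequentially sequentially"
    using r by (intro filterlim_at_top_mono[OF filterlim_ident]) auto
  note int = limit_integrable[OF K]
  have c: "continuous_on {0..T} (\<lambda>s. \<epsilon> / (2 * S l s))" "continuous_on {0..T} (\<lambda>s. d l / S l s ^ 3)"
    "continuous_on {0..T} (\<lambda>s. x s / S l s)" "continuous_on {0..T} (\<lambda>s. sqrt (x s))" for l
    using S_nz by (intro continuous_intros S_cont x; auto)+
  have S_inv: "1 / S l s \<le> 1 / sqrt (x s)" if "s \<in> {0..T}" "0 < x s" for l s
    using S_ge[of s l] S_pos[OF that(1), of l] that by (intro divide_left_mono) auto
  have 1: "(\<lambda>l. integral {0..T} (\<lambda>s. \<epsilon> / (2 * S l s))) \<longlonglongrightarrow> enn2real K / 2"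
  proof -
    have "(\<lambda>l. integral {0..T} (\<lambda>s. \<epsilon> / (2 * S l s))) \<longlonglongrightarrow> (\<integral>s. indicator {0..T} s * (\<epsilon> / sqrt (x s) / 2) \<partial>lborel)"
    proof (rule integral_tendsto_if_dominated[OF K c(1) int(1)])
      show "(\<lambda>s. indicator {0..T} s * (\<epsilon> / sqrt (x s) / 2)) \<in> borel_measurable lborel"
        using borel_measurable_divide[OF borel_measurable_integrable[OF int(1)] borel_measurable_const[of 2]] by simp
      fix s assume s: "s \<in> {0..T}" "0 < x s"
      then have "(\<lambda>l. \<epsilon> / (2 * S l s)) \<longlonglongrightarrow> \<epsilon> / (2 * sqrt (x s))" by (intro tendsto_intros S_tendsto) auto
      then show "(\<lambda>l. \<epsilon> / (2 * S l s)) \<longlonglongrightarrow> \<epsilon> / sqrt (x s) / 2" by (simp add: mult.commute)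
      fix l
      have "\<epsilon> / (2 * S l s) \<le> \<epsilon> / S l s" using \<epsilon> S_pos[OF s(1), of l] by (intro divide_left_mono) auto
      also have "\<dots> = \<epsilon> * (1 / S l s)" by simp
      also have "\<dots> \<le> \<epsilon> * (1 / sqrt (x s))" using S_inv[OF s] \<epsilon> by (intro mult_left_mono) auto
      finally show "\<bar>\<epsilon> / (2 * S l s)\<bar> \<le> \<epsilon> / sqrt (x s)" using \<epsilon> S_pos[OF s(1), of l] by simp
    qed
    moreover have "(\<integral>s. indicator {0..T} s * (\<epsilon> / sqrt (x s) / 2) \<partial>lborel) = enn2real K / 2"
      using int(2) by (simp only: times_divide_eq_right integral_divide_zero)
    ultimately show ?thesis by (simp only:)
  qed
  have 2: "(\<lambda>l. integral {0..T} (\<lambda>s. d l / S l s ^ 3)) \<longlonglongrightarrow> 0"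
  proof -
    have "(\<lambda>l. integral {0..T} (\<lambda>s. d l / S l s ^ 3)) \<longlonglongrightarrow> (\<integral>s. indicator {0..T} s * 0 \<partial>lborel)"
    proof (rule integral_tendsto_if_dominated[OF K c(2)])
      show "integrable lborel (\<lambda>s. indicator {0..T} s * (1 / sqrt (x s)))"
        using integrable_mult_right[OF int(1), of "1 / \<epsilon>"] \<epsilon> by simp
      fix s assume s: "s \<in> {0..T}" "0 < x s"
      then have "(\<lambda>l. d l / S l s ^ 3) \<longlonglongrightarrow> 0 / sqrt (x s) ^ 3"
        by (intro tendsto_intros S_tendsto LIMSEQ_Suc[OF lim_1_over_n]) auto
      then show "(\<lambda>l. d l / S l s ^ 3) \<longlonglongrightarrow> 0" by simp
      fix l
      have "d l / S l s ^ 3 \<le> (S l s)\<^sup>2 / S l s ^ 3"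
        using S_sq[OF s(1), of l] s(2) S_pos[OF s(1), of l] by (intro divide_right_mono) auto
      also have "\<dots> = 1 / S l s" using S_nz[OF s(1), of l] by (simp add: power2_eq_square power3_eq_cube)
      also have "\<dots> \<le> 1 / sqrt (x s)" by (rule S_inv[OF s])
      finally have "d l / S l s ^ 3 \<le> 1 / sqrt (x s)" .
      moreover have "0 \<le> d l / S l s ^ 3" using S_pos[OF s(1), of l] by simp
      ultimately show "\<bar>d l / S l s ^ 3\<bar> \<le> 1 / sqrt (x s)" by (simp only: abs_of_nonneg)
    qed simp
    then show ?thesis by simp
  qed
  have 3: "(\<lambda>l. integral {0..T} (\<lambda>s. x s / S l s)) \<longlonglongrightarrow> integral {0..T} (\<lambda>s. sqrt (x s))"
    unfolding integral_eq_lborel(1)[OF c(4)]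
  proof (rule integral_tendsto_if_dominated[OF K c(3) integral_eq_lborel(2)[OF c(4)]
        borel_measurable_integrable[OF integral_eq_lborel(2)[OF c(4)]]])
    fix s assume s: "s \<in> {0..T}" "0 < x s"
    then have "(\<lambda>l. x s / S l s) \<longlonglongrightarrow> x s / sqrt (x s)" by (intro tendsto_intros S_tendsto) auto
    then show "(\<lambda>l. x s / S l s) \<longlonglongrightarrow> sqrt (x s)" using s(2) by (simp add: real_div_sqrt)
    show "\<bar>x s / S l s\<bar> \<le> sqrt (x s)" for l
      using x_div_S_le[OF s(1), of l] S_pos[OF s(1), of l] s(2) by simp
  qed
  have "(\<lambda>n. S (r n) T - S (r n) 0) \<longlonglongrightarrow> enn2real K / 2 + \<sigma>\<^sup>2 / 8 * 0 - b / 2 * integral {0..T} (\<lambda>s. sqrt (x s)) + \<sigma> * (w - 0)"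
    unfolding regularised_identity
    by (intro tendsto_intros v filterlim_compose[OF 1 rinf] filterlim_compose[OF 2 rinf] filterlim_compose[OF 3 rinf])
  moreover have "(\<lambda>n. S (r n) T - S (r n) 0) \<longlonglongrightarrow> sqrt (x T) - sqrt (x 0)"
    by (intro tendsto_diff filterlim_compose[OF S_tendsto rinf])
  ultimately have "sqrt (x T) - sqrt (x 0) = enn2real K / 2 + \<sigma>\<^sup>2 / 8 * 0 - b / 2 * integral {0..T} (\<lambda>s. sqrt (x s)) + \<sigma> * (w - 0)"
    by (rule LIMSEQ_unique[rotated])
  then show ?thesis by simp
qed

end

end

text \<open>
  The value of \<open>K\<close> at \<open>t\<close> lies between its values at rationals on both sides of \<open>t\<close>, and these
  converge to \<open>2 \<phi> t\<close>. This passes from almost sure equality at each rational time to equality at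
  all times.
\<close>
lemma monotone_eq_continuous_if_eq_on_Rats:
  fixes \<phi> :: "real \<Rightarrow> real" and K :: "real \<Rightarrow> ennreal"
  assumes \<phi>: "continuous_on {0..} \<phi>" and mono: "\<And>s t. s \<le> t \<Longrightarrow> K s \<le> K t"
    and q: "\<And>q. q \<in> \<rat> \<Longrightarrow> 0 < q \<Longrightarrow> K q < \<infinity> \<and> \<phi> q = enn2real (K q) / 2"
    and t: "0 < t"
  shows "K t < \<infinity>" "\<phi> t = enn2real (K t) / 2"
proof -
  obtain p where p: "p \<in> \<rat>" "t < p" using Rats_dense_in_real[of t "t + 1"] by auto
  then show fin: "K t < \<infinity>" using mono[of t p] q[of p] t by (auto intro: order.strict_trans1)
  have mono2: "enn2real (K s) \<le> enn2real (K s')" if "s \<le> s'" "K s' < \<infinity>" for s s'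
    using mono[OF that(1)] that(2) by (intro enn2real_mono) auto
  have cont: "\<forall>e>0. \<exists>d>0. \<forall>s\<in>{0..}. dist s t < d \<longrightarrow> dist (\<phi> s) (\<phi> t) < e"
    using \<phi> t unfolding continuous_on_iff by auto
  show "\<phi> t = enn2real (K t) / 2"
  proof (rule ccontr)
    assume ne: "\<phi> t \<noteq> enn2real (K t) / 2"
    define e where "e = \<bar>\<phi> t - enn2real (K t) / 2\<bar>"
    have "e > 0" using ne by (simp add: e_def)
    then obtain d where d: "d > 0" "\<And>s. 0 \<le> s \<Longrightarrow> dist s t < d \<Longrightarrow> dist (\<phi> s) (\<phi> t) < e" using cont by (metis atLeast_iff)
    obtain q1 where q1: "q1 \<in> \<rat>" "t < q1" "q1 < t + d" using Rats_dense_in_real[of t "t + d"] d by auto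
    obtain q2 where q2: "q2 \<in> \<rat>" "max 0 (t - d) < q2" "q2 < t" using Rats_dense_in_real[of "max 0 (t - d)" t] d t by auto
    have 1: "K q1 < \<infinity>" "\<phi> q1 = enn2real (K q1) / 2" using q[of q1] q1 t by auto
    have 2: "K q2 < \<infinity>" "\<phi> q2 = enn2real (K q2) / 2" using q[of q2] q2 by auto
    have "enn2real (K t) / 2 \<le> \<phi> q1" using mono2[of t q1] 1 q1 t by simp
    moreover have "\<phi> q2 \<le> enn2real (K t) / 2" using mono2[of q2 t] 2 q2 fin by simp
    moreover have "\<bar>\<phi> q1 - \<phi> t\<bar> < e" using d(2)[of q1] q1 t by (simp add: dist_real_def)
    moreover have "\<bar>\<phi> q2 - \<phi> t\<bar> < e" using d(2)[of q2] q2 by (simp add: dist_real_def)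
    ultimately show False unfolding e_def by linarith
  qed
qed

section \<open>The equation for the square root of a Cox-Ingersoll-Ross process\<close>

context cir_solution
begin

text \<open>
  Two rounds with the regularisation parameter tending to 0. In the first, the remainders are only
  known to be bounded in mean square; this suffices for the singular integral to be finite, hence for
  \<open>X\<close> to be positive at almost every time. Therefore the defect vanishes in the limit, and so do the
  remainders along a subsequence. The second round then yields the equation.
\<close>
lemma sqrt_equation_fixed_time:
  assumes T: "0 < T" and \<epsilon>: "0 < \<epsilon>" and b: "0 < b" and a: "a = \<sigma>\<^sup>2 / 4 + \<epsilon>"
  shows "AE \<omega> in M. singular_integral \<epsilon> (\<lambda>s. sqrt (X s \<omega>)) T < \<infinity> \<and>
    sqrt (X T \<omega>) - sqrt (X 0 \<omega>) =
      enn2real (singular_integral \<epsilon> (\<lambda>s. sqrt (X s \<omega>)) T) / 2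
      - b / 2 * integral {0..T} (\<lambda>s. sqrt (X s \<omega>)) + \<sigma> * (W T \<omega> / 2)"
proof -
  let ?d = "\<lambda>l. 1 / real (Suc l)"
  let ?K = "\<lambda>\<omega>. singular_integral \<epsilon> (\<lambda>s. sqrt (X s \<omega>)) T"
  have T0: "0 \<le> T" using T by simp
  have d: "0 < ?d l" for l by simp
  let ?good = "\<lambda>l V. V \<in> borel_measurable M \<and>
    ((AE \<omega> in M. sqrt (X T \<omega> + ?d l) - sqrt (X 0 \<omega> + ?d l) =
       integral {0..T} (\<lambda>s. (a - b * X s \<omega>) / (2 * sqrt (X s \<omega> + ?d l)))
       - \<sigma>\<^sup>2 / 8 * integral {0..T} (\<lambda>s. X s \<omega> / sqrt (X s \<omega> + ?d l) ^ 3)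
       + \<sigma> * (W T \<omega> / 2 - V \<omega>)) \<and>
    (\<integral>\<^sup>+\<omega>. ennreal ((V \<omega>)\<^sup>2) \<partial>M) \<le> ennreal (expectation (defect (?d l) T)))"
  have "\<forall>l. \<exists>V. ?good l V"
    using ito_formula_sqrt[OF T d] unfolding Bex_def by (rule allI)
  from choice[OF this] obtain V where V: "\<forall>l. ?good l (V l)" ..
  have Vm[measurable]: "V l \<in> borel_measurable M" for l by (rule V[rule_format, THEN conjunct1])
  have id: "AE \<omega> in M. \<forall>l. sqrt (X T \<omega> + ?d l) - sqrt (X 0 \<omega> + ?d l) =
       integral {0..T} (\<lambda>s. (\<sigma>\<^sup>2 / 4 + \<epsilon> - b * X s \<omega>) / (2 * sqrt (X s \<omega> + ?d l)))
       - \<sigma>\<^sup>2 / 8 * integral {0..T} (\<lambda>s. X s \<omega> / sqrt (X s \<omega> + ?d l) ^ 3)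
       + \<sigma> * (W T \<omega> / 2 - V l \<omega>)"
    unfolding AE_all_countable a[symmetric] by (rule allI) (rule V[rule_format, THEN conjunct2, THEN conjunct1])
  have V2: "(\<integral>\<^sup>+\<omega>. ennreal ((V l \<omega>)\<^sup>2) \<partial>M) \<le> ennreal (expectation (defect (?d l) T))" for l
    by (rule V[rule_format, THEN conjunct2, THEN conjunct2])
  have Ed: "expectation (defect (?d l) T) \<le> T / 4" for l
  proof -
    have "expectation (defect (?d l) T) \<le> expectation (\<lambda>_. T / 4)"
      by (rule integral_mono[OF defect_integrable[OF d T0]]) (use defect_bounds(2)[OF d T0] in auto)
    then show ?thesis by (simp add: prob_space)
  qed
  have "AE \<omega> in M. liminf (\<lambda>l. ennreal ((V l \<omega>)\<^sup>2)) \<noteq> \<infinity>"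
  proof (rule nn_integral_PInf_AE)
    have "(\<integral>\<^sup>+\<omega>. liminf (\<lambda>l. ennreal ((V l \<omega>)\<^sup>2)) \<partial>M) \<le> liminf (\<lambda>l. \<integral>\<^sup>+\<omega>. ennreal ((V l \<omega>)\<^sup>2) \<partial>M)"
      by (rule nn_integral_liminf[of "\<lambda>l \<omega>. ennreal ((V l \<omega>)\<^sup>2)"]) measurable
    also have "\<dots> < \<infinity>"
    proof (rule liminf_finite_if_frequently_le)
      have "(\<integral>\<^sup>+\<omega>. ennreal ((V l \<omega>)\<^sup>2) \<partial>M) \<le> ennreal (T / 4)" for l
        by (rule order_trans[OF V2 ennreal_leI[OF Ed]])
      then show "\<exists>\<^sub>F l in sequentially. (\<integral>\<^sup>+\<omega>. ennreal ((V l \<omega>)\<^sup>2) \<partial>M) \<le> ennreal (T / 4)" by simp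
    qed
    finally show "(\<integral>\<^sup>+\<omega>. liminf (\<lambda>l. ennreal ((V l \<omega>)\<^sup>2)) \<partial>M) \<noteq> \<infinity>" by simp
  qed measurable
  then have liminf: "AE \<omega> in M. liminf (\<lambda>l. ennreal ((V l \<omega>)\<^sup>2)) < \<infinity>"
    by eventually_elim (simp add: top.not_eq_extremum)
  have cont: "AE \<omega> in M. continuous_on {0..} (\<lambda>s. X s \<omega>)" using X_cont unfolding continuous_process_def by blast
  have path: "sqrt_path (\<lambda>s. X s \<omega>) T \<epsilon> b \<sigma>" if "continuous_on {0..} (\<lambda>s. X s \<omega>)" for \<omega>
    using T \<epsilon> b \<sigma> X_nonneg that by (intro sqrt_path.intro) (auto intro: continuous_on_subset)
  have Kfin: "AE \<omega> in M. ?K \<omega> < \<infinity>"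
    using id liminf cont
  proof eventually_elim
    case (elim \<omega>)
    show ?case
      by (rule sqrt_path.K_finite[OF path[OF elim(3)] elim(1)[rule_format] elim(2)])
  qed
  have "AE \<omega> in M. (\<lambda>l. defect (?d l) T \<omega>) \<longlonglongrightarrow> 0"
    using Kfin cont Xc_eq
  proof eventually_elim
    case (elim \<omega>)
    have "defect (?d l) T \<omega> = integral {0..T} (\<lambda>s. (1 / 2 - sqrt (X s \<omega>) / (2 * sqrt (X s \<omega> + ?d l)))\<^sup>2)" for l
      unfolding defect_def by (rule Henstock_Kurzweil_Integration.integral_cong) (use elim(3) in simp)
    then show ?case
      using sqrt_path.defect_tendsto_0[OF path[OF elim(2)] elim(1)] by (simp only:)
  qed
  then have "(\<lambda>l. expectation (defect (?d l) T)) \<longlonglongrightarrow> expectation (\<lambda>_. 0)"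
  proof (rule integral_dominated_convergence[where w = "\<lambda>_. T / 4", rotated 3])
    show "AE \<omega> in M. norm (defect (?d l) T \<omega>) \<le> T / 4" for l
      using defect_bounds[OF d[of l] T0] by (intro AE_I2) (simp del: of_nat_Suc)
    show "defect (?d l) T \<in> borel_measurable M" for l by (rule defect_measurable[OF d T0])
  qed simp_all
  then have Ed0: "(\<lambda>l. expectation (defect (?d l) T)) \<longlonglongrightarrow> 0" by simp
  have V2i: "integrable M (\<lambda>\<omega>. (V l \<omega>)\<^sup>2)" for l
  proof (rule integrableI_nonneg)
    show "(\<integral>\<^sup>+\<omega>. ennreal ((V l \<omega>)\<^sup>2) \<partial>M) < \<infinity>" by (rule order.strict_trans1[OF V2]) simp
  qed auto
  have V2E: "expectation (\<lambda>\<omega>. (V l \<omega>)\<^sup>2) \<le> expectation (defect (?d l) T)" for l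
  proof -
    have "ennreal (expectation (\<lambda>\<omega>. (V l \<omega>)\<^sup>2)) \<le> ennreal (expectation (defect (?d l) T))"
      using V2[of l] nn_integral_eq_integral[OF V2i AE_I2[OF zero_le_power2], of l] by simp
    then show ?thesis
      by (rule ennreal_le_iff[THEN iffD1, rotated]) (use defect_bounds(1)[OF d T0] in \<open>auto intro: integral_nonneg_AE\<close>)
  qed
  have "tendsto_in_prob M V (\<lambda>_. 0)"
  proof (rule tendsto_in_prob_0_if_L2[OF Vm V2i])
    show "(\<lambda>l. expectation (\<lambda>\<omega>. (V l \<omega>)\<^sup>2)) \<longlonglongrightarrow> 0"
      by (rule tendsto_sandwich[OF _ _ tendsto_const Ed0]) (use V2E in auto)
  qed
  then have "\<exists>r. (\<forall>n. n \<le> r n) \<and> (AE \<omega> in M. (\<lambda>n. V (r n) \<omega>) \<longlonglongrightarrow> 0)"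
    by (rule tendsto_in_prob_AE_subsequence[rotated 2]) auto
  then obtain r where r: "\<And>n. n \<le> r n" and Vr: "AE \<omega> in M. (\<lambda>n. V (r n) \<omega>) \<longlonglongrightarrow> 0" by blast
  show ?thesis
    using id Kfin cont Vr
  proof eventually_elim
    case (elim \<omega>)
    show ?case
      using sqrt_path.sqrt_equation[OF path[OF elim(3)] elim(1)[rule_format] elim(2) r elim(4)] elim(2)
      by blast
  qed
qed

end

lemma (in brownian) ito_integral_at_0:
  assumes "ito_integral M F W H I"
  shows "AE \<omega> in M. I 0 \<omega> = 0"
proof -
  obtain N \<tau> \<xi> where ed: "\<And>k. elementary_data M F (N k) (\<tau> k) (\<xi> k)"
    and P: "tendsto_in_prob M (\<lambda>k. elementary_integral W (N k) (\<tau> k) (\<xi> k) 0) (I 0)"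
    using assms unfolding ito_integral_def by blast
  have Im: "I 0 \<in> borel_measurable M"
    using assms unfolding ito_integral_def continuous_process_def stochastic_process_def by blast
  have "elementary_integral W (N k) (\<tau> k) (\<xi> k) 0 = (\<lambda>_. 0)" for k
  proof
    fix \<omega>
    have m: "mono (\<tau> k)" "0 \<le> \<tau> k 0" using ed[of k] unfolding elementary_data_def by auto
    have "0 \<le> \<tau> k i" for i using monoD[OF m(1), of 0 i] m(2) by simp
    then have "min 0 (\<tau> k i) = 0" for i by (simp add: min_def)
    then show "elementary_integral W (N k) (\<tau> k) (\<xi> k) 0 \<omega> = 0" unfolding elementary_integral_def by simp
  qed
  with P have "tendsto_in_prob M (\<lambda>k _. 0) (I 0)" by simp
  from tendsto_in_prob_AE_subsequence[OF borel_measurable_const Im this]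
  have "AE \<omega> in M. (\<lambda>n::nat. 0) \<longlonglongrightarrow> I 0 \<omega>" by blast
  then show ?thesis by eventually_elim (metis LIMSEQ_unique tendsto_const)
qed

text \<open>
  From rational times, of which there are countably many, the equation extends to all times.
\<close>
lemma (in cir_solution) sqrt_singular_solution:
  assumes \<epsilon>: "0 < \<epsilon>" and b: "0 < b" and a: "a = \<sigma>\<^sup>2 / 4 + \<epsilon>"
  shows "AE \<omega> in M. singular_solution (sqrt x0) (b / 2) (\<sigma> / 2) (\<lambda>t. W t \<omega>) \<epsilon> (\<lambda>t. sqrt (X t \<omega>))"
proof -
  let ?K = "\<lambda>t \<omega>. singular_integral \<epsilon> (\<lambda>s. sqrt (X s \<omega>)) t"
  have rat: "AE \<omega> in M. \<forall>q\<in>\<rat> \<inter> {0<..}. ?K q \<omega> < \<infinity> \<and> sqrt (X q \<omega>) - sqrt (X 0 \<omega>) = enn2real (?K q \<omega>) / 2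
      - b / 2 * integral {0..q} (\<lambda>s. sqrt (X s \<omega>)) + \<sigma> * (W q \<omega> / 2)"
  proof (rule AE_ball_countable')
    show "countable (\<rat> \<inter> {0<..} :: real set)" by (rule countable_Int1[OF countable_rat])
  qed (rule sqrt_equation_fixed_time[OF _ \<epsilon> b a], simp)
  have Wc: "AE \<omega> in M. continuous_on {0..} (\<lambda>t. W t \<omega>)" and W0: "AE \<omega> in M. W 0 \<omega> = 0"
    using bm unfolding brownian_motion_def continuous_process_def by blast+
  have Xcont: "AE \<omega> in M. continuous_on {0..} (\<lambda>t. X t \<omega>)"
    using X_cont unfolding continuous_process_def by blast
  show ?thesis
    using rat Wc W0 Xcont eq ito_integral_at_0[OF ito]
  proof eventually_elim
    case (elim \<omega>)
    note Xc = elim(4) and Wc = elim(2)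
    have "(LBINT s:{0..0}. a - b * X s \<omega>) = 0"
      using set_borel_integral_eq_integral(2)[OF borel_integrable_atLeastAtMost'[of 0 0 "\<lambda>s. a - b * X s \<omega>"]] by simp
    then have X0: "X 0 \<omega> = x0" using elim(5)[rule_format, of 0] elim(6) by simp
    let ?\<phi> = "\<lambda>t. sqrt (X t \<omega>) - sqrt (X 0 \<omega>) + b / 2 * integral {0..t} (\<lambda>s. sqrt (X s \<omega>)) - \<sigma> * (W t \<omega> / 2)"
    have intc: "continuous_on {0..} (\<lambda>t. integral {0..t} (\<lambda>s. sqrt (X s \<omega>)))"
      by (intro continuous_on_atLeast_if_Icc indefinite_integral_continuous_1 integrable_continuous_real
          continuous_intros continuous_on_subset[OF Xc]) auto
    have \<phi>: "continuous_on {0..} ?\<phi>"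
      by (intro continuous_intros intc Xc Wc) simp
    have "?K t \<omega> < \<infinity> \<and> ?\<phi> t = enn2real (?K t \<omega>) / 2" if "0 \<le> t" for t
    proof (cases "t = 0")
      case True
      then show ?thesis using elim(3) by (simp add: singular_integral_0)
    next
      case False
      with that have t: "0 < t" by simp
      have q: "?K q \<omega> < \<infinity> \<and> ?\<phi> q = enn2real (?K q \<omega>) / 2" if "q \<in> \<rat>" "0 < q" for q
      proof -
        from that have "q \<in> \<rat> \<inter> {0<..}" by simp
        with elim(1) have "?K q \<omega> < \<infinity> \<and> sqrt (X q \<omega>) - sqrt (X 0 \<omega>) = enn2real (?K q \<omega>) / 2
          - b / 2 * integral {0..q} (\<lambda>s. sqrt (X s \<omega>)) + \<sigma> * (W q \<omega> / 2)" by (rule bspec)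
        then show ?thesis by (elim conjE) simp
      qed
      show ?thesis
        using monotone_eq_continuous_if_eq_on_Rats[of ?\<phi> "\<lambda>t. ?K t \<omega>", OF \<phi> singular_integral_mono q t] by (intro conjI)
    qed
    then have sol: "?K t \<omega> < \<infinity> \<and> sqrt (X t \<omega>) = sqrt x0 + enn2real (?K t \<omega>) / 2
        - b / 2 * integral {0..t} (\<lambda>s. sqrt (X s \<omega>)) + \<sigma> / 2 * W t \<omega>" if "0 \<le> t" for t
      using that X0 by fastforce
    have "\<forall>t\<ge>0. 0 \<le> sqrt (X t \<omega>)" using X_nonneg by simp
    with continuous_on_real_sqrt[OF Xc] sol show ?case unfolding singular_solution_def by blast
  qed
qed

lemma ito_integral_cong:
  assumes H: "AE \<omega> in M. \<forall>s\<ge>0. H s \<omega> = H' s \<omega>" and I: "ito_integral M F W H I"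
  shows "ito_integral M F W H' I"
proof -
  obtain N \<tau> \<xi> where ed: "\<forall>k. elementary_data M F (N k) (\<tau> k) (\<xi> k)"
    and L2: "AE \<omega> in M. \<forall>T\<ge>0. (\<lambda>k. \<integral>\<^sup>+s\<in>{0..T}.
              ennreal ((elementary_process (N k) (\<tau> k) (\<xi> k) s \<omega> - H s \<omega>)\<^sup>2) \<partial>lborel) \<longlonglongrightarrow> 0"
    and P: "\<forall>t\<ge>0. tendsto_in_prob M (\<lambda>k. elementary_integral W (N k) (\<tau> k) (\<xi> k) t) (I t)"
    and c: "continuous_process M I"
    using I unfolding ito_integral_def by blast
  have "AE \<omega> in M. \<forall>T\<ge>0. (\<lambda>k. \<integral>\<^sup>+s\<in>{0..T}.
              ennreal ((elementary_process (N k) (\<tau> k) (\<xi> k) s \<omega> - H' s \<omega>)\<^sup>2) \<partial>lborel) \<longlonglongrightarrow> 0"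
    using L2 H
  proof eventually_elim
    case (elim \<omega>)
    have "(\<integral>\<^sup>+s\<in>{0..T}. ennreal ((elementary_process (N k) (\<tau> k) (\<xi> k) s \<omega> - H' s \<omega>)\<^sup>2) \<partial>lborel) =
      (\<integral>\<^sup>+s\<in>{0..T}. ennreal ((elementary_process (N k) (\<tau> k) (\<xi> k) s \<omega> - H s \<omega>)\<^sup>2) \<partial>lborel)" for k T
      by (rule nn_integral_cong) (use elim(2) in \<open>simp add: indicator_def\<close>)
    with elim(1) show ?case by simp
  qed
  with ed P c show ?thesis unfolding ito_integral_def by blast
qed

text \<open>
  The solution is replaced by its positive part, which is almost surely the same process, adapted,
  and nonnegative everywhere.
\<close>
lemma cir_sqrt_singular_solution:
  assumes M: "prob_space M" and bm: "brownian_motion M W" and y0: "0 < y0" and \<epsilon>: "0 < \<epsilon>"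
    and cir: "cir_process M W (y0\<^sup>2) (\<sigma>\<^sup>2 / 4 + \<epsilon>) b \<sigma> X"
  shows "AE \<omega> in M. singular_solution y0 (b / 2) (\<sigma> / 2) (\<lambda>t. W t \<omega>) \<epsilon> (\<lambda>t. sqrt (X t \<omega>))"
proof -
  obtain F I where F: "brownian_filtration M F W" "\<forall>t\<ge>0. X t \<in> borel_measurable (F t)"
      "ito_integral M F W (\<lambda>s \<omega>. sqrt (X s \<omega>)) I"
    and eq: "AE \<omega> in M. \<forall>t\<ge>0. X t \<omega> = y0\<^sup>2 + (LBINT s:{0..t}. \<sigma>\<^sup>2 / 4 + \<epsilon> - b * X s \<omega>) + \<sigma> * I t \<omega>"
    and pos: "0 < b" "0 < \<sigma>" and c: "continuous_process M X" and nn: "AE \<omega> in M. \<forall>t\<ge>0. 0 \<le> X t \<omega>"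
    using cir unfolding cir_process_def by blast
  obtain Xv where Xv: "AE \<omega> in M. \<forall>s\<ge>0. Xv s \<omega> = X s \<omega>"
    "\<And>\<omega>. continuous_on UNIV (\<lambda>s. Xv s \<omega>)" "\<And>s. Xv s \<in> borel_measurable M"
    by (rule continuous_version[OF c]) (rule that, assumption+)
  define X' where "X' s \<omega> = max 0 (X s \<omega>)" for s \<omega>
  define Xc where "Xc s \<omega> = max 0 (Xv s \<omega>)" for s \<omega>
  have X': "AE \<omega> in M. \<forall>s\<ge>0. X s \<omega> = X' s \<omega>"
    using nn by eventually_elim (simp add: X'_def)
  have Xcont: "AE \<omega> in M. continuous_on {0..} (\<lambda>t. X t \<omega>)" using c unfolding continuous_process_def by blast
  have "cir_solution M F W X' I Xc (y0\<^sup>2) (\<sigma>\<^sup>2 / 4 + \<epsilon>) b \<sigma>"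
  proof (intro cir_solution.intro brownian.intro brownian_axioms.intro cir_solution_axioms.intro M bm F(1) pos(2))
    show "X' s \<in> borel_measurable (F s)" if "0 \<le> s" for s
      unfolding X'_def by (intro borel_measurable_max borel_measurable_const) (use F(2) that in blast)
    show "0 \<le> X' s \<omega>" "0 \<le> Xc s \<omega>" for s \<omega> by (simp_all add: X'_def Xc_def)
    have "X' t \<in> borel_measurable M" if "0 \<le> t" for t
      unfolding X'_def using c that
      by (intro borel_measurable_max borel_measurable_const) (auto simp: continuous_process_def stochastic_process_def)
    moreover have "AE \<omega> in M. continuous_on {0..} (\<lambda>t. X' t \<omega>)"
      using Xcont by eventually_elim (auto simp: X'_def intro!: continuous_intros)
    ultimately show "continuous_process M X'" unfolding continuous_process_def stochastic_process_def by blast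
    have "AE \<omega> in M. \<forall>s\<ge>0. sqrt (X s \<omega>) = sqrt (X' s \<omega>)" using X' by eventually_elim simp
    then show "ito_integral M F W (\<lambda>s \<omega>. sqrt (X' s \<omega>)) I" using F(3) by (rule ito_integral_cong)
    show "AE \<omega> in M. \<forall>t\<ge>0. X' t \<omega> = y0\<^sup>2 + (LBINT s:{0..t}. \<sigma>\<^sup>2 / 4 + \<epsilon> - b * X' s \<omega>) + \<sigma> * I t \<omega>"
      using eq X'
    proof eventually_elim
      case (elim \<omega>)
      have "(LBINT s:{0..t}. \<sigma>\<^sup>2 / 4 + \<epsilon> - b * X' s \<omega>) = (LBINT s:{0..t}. \<sigma>\<^sup>2 / 4 + \<epsilon> - b * X s \<omega>)" for t
        unfolding set_lebesgue_integral_def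
        by (rule Bochner_Integration.integral_cong) (use elim(2) in \<open>auto simp: indicator_def\<close>)
      then show ?case using elim by simp
    qed
    show "AE \<omega> in M. \<forall>s\<ge>0. Xc s \<omega> = X' s \<omega>"
      using Xv(1) by eventually_elim (simp add: Xc_def X'_def)
    show "continuous_on UNIV (\<lambda>s. Xc s \<omega>)" for \<omega> unfolding Xc_def by (intro continuous_intros Xv(2))
    show "Xc s \<in> borel_measurable M" for s unfolding Xc_def using Xv(3) by measurable
  qed
  then interpret cir_solution M F W X' I Xc "y0\<^sup>2" "\<sigma>\<^sup>2 / 4 + \<epsilon>" b \<sigma> .
  show ?thesis
    using sqrt_singular_solution[OF \<epsilon> pos(1) refl] Xcont X'
  proof eventually_elim
    case (elim \<omega>)
    have K: "singular_integral \<epsilon> (\<lambda>s. sqrt (X' s \<omega>)) t = singular_integral \<epsilon> (\<lambda>s. sqrt (X s \<omega>)) t" for t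
      unfolding singular_integral_def by (rule nn_integral_cong) (use elim(3) in \<open>simp add: indicator_def\<close>)
    have J: "integral {0..t} (\<lambda>s. sqrt (X' s \<omega>)) = integral {0..t} (\<lambda>s. sqrt (X s \<omega>))" for t
      by (rule Henstock_Kurzweil_Integration.integral_cong) (use elim(3) in simp)
    have "\<forall>t\<ge>0. 0 \<le> sqrt (X' t \<omega>) \<and> (singular_integral \<epsilon> (\<lambda>s. sqrt (X s \<omega>)) t < \<infinity> \<and>
        sqrt (X' t \<omega>) = y0 + enn2real (singular_integral \<epsilon> (\<lambda>s. sqrt (X s \<omega>)) t) / 2
          - b / 2 * integral {0..t} (\<lambda>s. sqrt (X s \<omega>)) + \<sigma> / 2 * W t \<omega>)"
      using elim(1) y0 unfolding singular_solution_def K J real_sqrt_abs abs_of_pos[OF y0] by blast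
    moreover have "X' t \<omega> = X t \<omega>" if "0 \<le> t" for t using elim(3) that by simp
    ultimately have "\<forall>t\<ge>0. 0 \<le> sqrt (X t \<omega>) \<and> (singular_integral \<epsilon> (\<lambda>s. sqrt (X s \<omega>)) t < \<infinity> \<and>
        sqrt (X t \<omega>) = y0 + enn2real (singular_integral \<epsilon> (\<lambda>s. sqrt (X s \<omega>)) t) / 2
          - b / 2 * integral {0..t} (\<lambda>s. sqrt (X s \<omega>)) + \<sigma> / 2 * W t \<omega>)"
      by metis
    with continuous_on_real_sqrt[OF elim(2)] show ?case unfolding singular_solution_def by blast
  qed
qed


section \<open>Stability of the singular equation\<close>

text \<open>
  The last point of the compact set where \<open>d \<le> h\<close>; at it, equality holds by the intermediate value theorem.
\<close>
lemma last_passage: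
  fixes d :: "real \<Rightarrow> real"
  assumes d: "continuous_on {0..t} d" and t: "0 \<le> t" and h: "d 0 < h" "h < d t"
  shows "\<exists>s\<in>{0..t}. d s = h \<and> (\<forall>u\<in>{s..t}. h \<le> d u)"
proof -
  have cl: "closed ({0..t} \<inter> d -` {..h})" by (rule continuous_closed_preimage[OF d]) auto
  have "compact ({0..t} \<inter> ({0..t} \<inter> d -` {..h}))" by (rule compact_Int_closed[OF compact_Icc cl])
  then have "compact ({0..t} \<inter> d -` {..h})" by simp
  moreover have "{0..t} \<inter> d -` {..h} \<noteq> {}" using t h by auto
  ultimately obtain s where s: "s \<in> {0..t} \<inter> d -` {..h}" "\<And>u. u \<in> {0..t} \<inter> d -` {..h} \<Longrightarrow> u \<le> s"
    using compact_attains_sup by meson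
  have above: "h < d u" if "s < u" "u \<le> t" for u
    using s(2)[of u] s(1) that by force
  have "d s = h"
  proof (rule ccontr)
    assume "d s \<noteq> h"
    then have "d s \<le> h" "d s < h" using s(1) by auto
    have "continuous_on {s..t} d" using d by (rule continuous_on_subset) (use s(1) in auto)
    then obtain u where u: "s \<le> u" "u \<le> t" "d u = h"
      using IVT'[of d s h t] \<open>d s \<le> h\<close> h s(1) by auto
    then show False using above[of u] \<open>d s < h\<close> by (cases "u = s") auto
  qed
  moreover have "h \<le> d u" if "u \<in> {s..t}" for u
    using above[of u] that \<open>d s = h\<close> by (cases "u = s") auto
  ultimately show ?thesis using s(1) by blast
qed

text \<open>
  If \<open>y\<close> exceeds \<open>y'\<close> by \<open>D\<close> at time \<open>t\<close>, then since the last time of a difference \<open>D / 2\<close> the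
  solution \<open>y\<close> was at least \<open>D / 2\<close>, so that its singular drift was at most \<open>\<epsilon> / D\<close>. That
  drift alone can have raised the difference, the terms with \<open>y'\<close> and with \<open>\<beta>\<close> only lower it. Hence
  \<open>D / 2 \<le> \<epsilon> t / D\<close>.
\<close>
lemma singular_solution_difference:
  assumes y: "singular_solution y0 \<beta> c w \<epsilon> y" and y': "singular_solution y0 \<beta> c w \<epsilon>' y'"
    and \<epsilon>: "0 \<le> \<epsilon>" and \<beta>: "0 \<le> \<beta>" and t: "0 \<le> t"
  shows "y t - y' t \<le> sqrt (2 * \<epsilon> * t)"
proof (cases "y t \<le> y' t")
  case True
  moreover have "0 \<le> sqrt (2 * \<epsilon> * t)" using \<epsilon> t by simp
  ultimately show ?thesis by linarith
next
  case False
  define D where "D = y t - y' t"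
  have D: "0 < D" using False by (simp add: D_def)
  have yc: "continuous_on {0..} y" "continuous_on {0..} y'"
    and nn: "\<And>s. 0 \<le> s \<Longrightarrow> 0 \<le> y' s"
    and fin: "\<And>s. 0 \<le> s \<Longrightarrow> singular_integral \<epsilon> y s < \<infinity>" "\<And>s. 0 \<le> s \<Longrightarrow> singular_integral \<epsilon>' y' s < \<infinity>"
    and eq: "\<And>s. 0 \<le> s \<Longrightarrow> y s = y0 + enn2real (singular_integral \<epsilon> y s) / 2 - \<beta> * integral {0..s} y + c * w s"
      "\<And>s. 0 \<le> s \<Longrightarrow> y' s = y0 + enn2real (singular_integral \<epsilon>' y' s) / 2 - \<beta> * integral {0..s} y' + c * w s"
    using y y' unfolding singular_solution_def by auto
  have c0: "continuous_on {p..q} y" "continuous_on {p..q} y'" if "0 \<le> p" for p q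
    using that by (auto intro: continuous_on_subset[OF yc(1)] continuous_on_subset[OF yc(2)])
  have "\<exists>s\<in>{0..t}. y s - y' s = D / 2 \<and> (\<forall>u\<in>{s..t}. D / 2 \<le> y u - y' u)"
  proof (rule last_passage)
    show "continuous_on {0..t} (\<lambda>s. y s - y' s)" by (intro continuous_intros c0) auto
    show "y 0 - y' 0 < D / 2" using eq[of 0] D by (simp add: singular_integral_0)
    show "D / 2 < y t - y' t" using D by (simp add: D_def)
  qed (rule t)
  then obtain s where s: "0 \<le> s" "s \<le> t" "y s - y' s = D / 2" and ge: "\<And>u. u \<in> {s..t} \<Longrightarrow> D / 2 \<le> y u - y' u" by auto
  \<comment> \<open>Since time \<open>s\<close>, the solution \<open>y\<close> has been at least \<open>D / 2\<close>.\<close>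
  have K: "enn2real (singular_integral \<epsilon> y t) - enn2real (singular_integral \<epsilon> y s) \<le> \<epsilon> / (D / 2) * (t - s)"
  proof (rule singular_integral_increment_le[OF yc(1) s(1,2) fin(1)[OF t] \<epsilon>])
    fix u assume u: "u \<in> {s..t}"
    then show "D / 2 \<le> y u" using ge[OF u] nn[of u] s(1) by simp
  qed (use D in simp)
  have K': "enn2real (singular_integral \<epsilon>' y' s) \<le> enn2real (singular_integral \<epsilon>' y' t)"
    using singular_integral_mono[OF s(2)] fin(2)[OF t] by (intro enn2real_mono) auto
  have comb: "integral {0..t} f = integral {0..s} f + integral {s..t} f" if "continuous_on {0..t} f" for f :: "real \<Rightarrow> real"
    using Henstock_Kurzweil_Integration.integral_combine[OF s(1,2) integrable_continuous_real[OF that]] by simp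
  have I: "integral {s..t} y' \<le> integral {s..t} y"
  proof (rule integral_le)
    fix u assume u: "u \<in> {s..t}"
    show "y' u \<le> y u" using ge[OF u] D by simp
  qed (use c0 s(1) in \<open>auto intro: integrable_continuous_real\<close>)
  have \<beta>I: "\<beta> * integral {s..t} y' \<le> \<beta> * integral {s..t} y"
    "\<beta> * integral {0..t} y = \<beta> * integral {0..s} y + \<beta> * integral {s..t} y"
    "\<beta> * integral {0..t} y' = \<beta> * integral {0..s} y' + \<beta> * integral {s..t} y'"
    using comb[OF c0(1)] comb[OF c0(2)] mult_left_mono[OF I \<beta>] by (simp_all add: distrib_left)
  define z where "z = \<epsilon> / (D / 2) * (t - s)"
  have "y t - y' t = D" by (simp add: D_def)
  with \<beta>I have "D - D / 2 \<le> z / 2"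
    using eq(1)[OF t] eq(2)[OF t] eq(1)[OF s(1)] eq(2)[OF s(1)] K[folded z_def] K' s(3) by linarith
  also have "z / 2 = \<epsilon> / (D / 2) * (t - s) / 2" by (simp only: z_def)
  also have "\<dots> = \<epsilon> * (t - s) / D" using D by simp
  also have "\<dots> \<le> \<epsilon> * t / D" using s \<epsilon> D by (intro divide_right_mono mult_left_mono) auto
  finally have "D * D \<le> 2 * \<epsilon> * t" using D by (simp add: field_simps)
  then have "D \<le> sqrt (2 * \<epsilon> * t)" by (intro real_le_rsqrt) (simp add: power2_eq_square)
  then show ?thesis by (simp only: D_def)
qed

locale singular_limit =
  fixes y0 \<beta> c :: real and w :: "real \<Rightarrow> real" and \<epsilon> :: "nat \<Rightarrow> real" and y :: "nat \<Rightarrow> real \<Rightarrow> real"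
  assumes \<beta>: "0 \<le> \<beta>" and w: "continuous_on {0..} w" "w 0 = 0"
    and \<epsilon>: "\<And>n. 0 < \<epsilon> n" "decseq \<epsilon>" "\<epsilon> \<longlonglongrightarrow> 0"
    and sol: "\<And>n. singular_solution y0 \<beta> c w (\<epsilon> n) (y n)"
begin

definition Y :: "real \<Rightarrow> real" where "Y t = lim (\<lambda>n. y n t)"
text \<open>
  The reflection term is read off from the equation of the limit.
\<close>
definition L :: "real \<Rightarrow> real" where "L t = Y t - y0 + \<beta> * integral {0..t} Y - c * w t"
abbreviation K :: "nat \<Rightarrow> real \<Rightarrow> real" where "K n t \<equiv> enn2real (singular_integral (\<epsilon> n) (y n) t)"

lemma sol_facts:
  shows y_cont: "continuous_on {0..} (y n)" and y_nonneg: "0 \<le> t \<Longrightarrow> 0 \<le> y n t"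
    and K_finite: "0 \<le> t \<Longrightarrow> singular_integral (\<epsilon> n) (y n) t < \<infinity>"
    and y_eq: "0 \<le> t \<Longrightarrow> y n t = y0 + K n t / 2 - \<beta> * integral {0..t} (y n) + c * w t"
  using sol[of n] unfolding singular_solution_def by auto

lemma y_cauchy:
  assumes t: "0 \<le> t" and nm: "n \<le> m"
  shows "\<bar>y m t - y n t\<bar> \<le> sqrt (2 * \<epsilon> n * t)"
proof -
  have "y n t - y m t \<le> sqrt (2 * \<epsilon> n * t)" "y m t - y n t \<le> sqrt (2 * \<epsilon> m * t)"
    using singular_solution_difference[OF sol sol less_imp_le[OF \<epsilon>(1)] \<beta> t] by auto
  moreover have "sqrt (2 * \<epsilon> m * t) \<le> sqrt (2 * \<epsilon> n * t)"
    using decseqD[OF \<epsilon>(2) nm] t by (intro real_sqrt_le_mono mult_right_mono mult_left_mono) auto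
  ultimately show ?thesis by linarith
qed

lemma rate_tendsto: "(\<lambda>n. sqrt (2 * \<epsilon> n * t)) \<longlonglongrightarrow> 0"
proof -
  have "(\<lambda>n. sqrt (2 * \<epsilon> n * t)) \<longlonglongrightarrow> sqrt (2 * 0 * t)" by (intro tendsto_intros \<epsilon>)
  then show ?thesis by simp
qed

lemma y_tendsto: assumes t: "0 \<le> t" shows "(\<lambda>n. y n t) \<longlonglongrightarrow> Y t"
proof -
  have "Cauchy (\<lambda>n. y n t)"
  proof (rule metric_CauchyI)
    fix e :: real assume "e > 0"
    then have "\<forall>\<^sub>F n in sequentially. sqrt (2 * \<epsilon> n * t) < e / 2"
      using rate_tendsto[of t] by (intro order_tendstoD) auto
    then obtain N where N: "sqrt (2 * \<epsilon> N * t) < e / 2" by (auto simp: eventually_sequentially)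
    have "dist (y m t) (y n t) < e" if "m \<ge> N" "n \<ge> N" for m n
      using y_cauchy[OF t that(1)] y_cauchy[OF t that(2)] N by (simp add: dist_real_def)
    then show "\<exists>M. \<forall>m\<ge>M. \<forall>n\<ge>M. dist (y m t) (y n t) < e" by blast
  qed
  then show ?thesis unfolding Y_def by (simp add: Cauchy_convergent_iff convergent_LIMSEQ_iff)
qed

lemma Y_nonneg: "0 \<le> t \<Longrightarrow> 0 \<le> Y t"
  using y_tendsto y_nonneg by (intro LIMSEQ_le_const[of "\<lambda>n. y n t"]) auto

lemma Y_rate: assumes t: "0 \<le> t" shows "\<bar>Y t - y n t\<bar> \<le> sqrt (2 * \<epsilon> n * t)"
proof (rule LIMSEQ_le_const2)
  show "(\<lambda>m. \<bar>y m t - y n t\<bar>) \<longlonglongrightarrow> \<bar>Y t - y n t\<bar>" by (intro tendsto_intros y_tendsto t)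
  show "\<exists>N. \<forall>m\<ge>N. \<bar>y m t - y n t\<bar> \<le> sqrt (2 * \<epsilon> n * t)" using y_cauchy[OF t] by blast
qed

lemma rate_mono: "t \<le> T \<Longrightarrow> sqrt (2 * \<epsilon> n * t) \<le> sqrt (2 * \<epsilon> n * T)"
  using \<epsilon>(1)[of n] by (intro real_sqrt_le_mono mult_left_mono) auto

lemma Y_cont_Icc: "continuous_on {0..T} Y"
proof (rule uniform_limit_theorem)
  show "\<forall>\<^sub>F n in sequentially. continuous_on {0..T} (y n)"
    using continuous_on_subset[OF y_cont] by (intro always_eventually) auto
  show "uniform_limit {0..T} y Y sequentially"
  proof (rule uniform_limitI)
    fix e :: real assume "e > 0"
    then have "\<forall>\<^sub>F n in sequentially. sqrt (2 * \<epsilon> n * T) < e"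
      using rate_tendsto[of T] by (intro order_tendstoD) auto
    then show "\<forall>\<^sub>F n in sequentially. \<forall>t\<in>{0..T}. dist (y n t) (Y t) < e"
    proof eventually_elim
      case (elim n)
      show ?case
      proof
        fix t assume "t \<in> {0..T}"
        then have "0 \<le> t" "t \<le> T" by auto
        from order.strict_trans1[OF order_trans[OF Y_rate[OF this(1)] rate_mono[OF this(2)]] elim]
        show "dist (y n t) (Y t) < e" by (simp only: dist_real_def abs_minus_commute)
      qed
    qed
  qed
qed simp

lemma Y_cont: "continuous_on {0..} Y"
  by (rule continuous_on_atLeast_if_Icc[OF Y_cont_Icc])

lemma L_cont: "continuous_on {0..} L"
proof (rule continuous_on_atLeast_if_Icc)
  fix T
  show "continuous_on {0..T} L"
    unfolding L_def
    by (intro continuous_intros Y_cont_Icc indefinite_integral_continuous_1 integrable_continuous_real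
        continuous_on_subset[OF w(1)]) auto
qed

lemma L_rate:
  assumes t: "0 \<le> t" "t \<le> T"
  shows "\<bar>L t - K n t / 2\<bar> \<le> (1 + \<beta> * T) * sqrt (2 * \<epsilon> n * T)"
proof -
  have yc: "continuous_on {0..t} (y n)" by (rule continuous_on_subset[OF y_cont]) auto
  have "L t - K n t / 2 = (Y t - y n t) + \<beta> * (integral {0..t} Y - integral {0..t} (y n))"
    using y_eq[OF t(1), of n] by (simp add: L_def algebra_simps)
  also have "integral {0..t} Y - integral {0..t} (y n) = integral {0..t} (\<lambda>s. Y s - y n s)"
    by (rule Henstock_Kurzweil_Integration.integral_diff[symmetric]) (intro integrable_continuous_real Y_cont_Icc yc)+
  finally have eq: "L t - K n t / 2 = (Y t - y n t) + \<beta> * integral {0..t} (\<lambda>s. Y s - y n s)" .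
  have "norm (integral {0..t} (\<lambda>s. Y s - y n s)) \<le> sqrt (2 * \<epsilon> n * T) * (t - 0)"
  proof (rule integral_bound[OF t(1)])
    show "continuous_on {0..t} (\<lambda>s. Y s - y n s)" by (intro continuous_intros Y_cont_Icc yc)
    fix s assume "s \<in> {0..t}"
    then have "0 \<le> s" "s \<le> T" using t by auto
    from order_trans[OF Y_rate[OF this(1)] rate_mono[OF this(2)]]
    show "norm (Y s - y n s) \<le> sqrt (2 * \<epsilon> n * T)" by (simp only: real_norm_def)
  qed
  also have "\<dots> \<le> sqrt (2 * \<epsilon> n * T) * T" using t \<epsilon>(1)[of n] by (intro mult_left_mono) auto
  finally have "\<beta> * \<bar>integral {0..t} (\<lambda>s. Y s - y n s)\<bar> \<le> \<beta> * (sqrt (2 * \<epsilon> n * T) * T)"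
    using \<beta> by (intro mult_left_mono) auto
  moreover have "\<bar>Y t - y n t\<bar> \<le> sqrt (2 * \<epsilon> n * T)"
    using Y_rate[OF t(1), of n] rate_mono[OF t(2), of n] by linarith
  moreover have "\<bar>L t - K n t / 2\<bar> \<le> \<bar>Y t - y n t\<bar> + \<beta> * \<bar>integral {0..t} (\<lambda>s. Y s - y n s)\<bar>"
    unfolding eq using abs_triangle_ineq[of "Y t - y n t" "\<beta> * integral {0..t} (\<lambda>s. Y s - y n s)"] \<beta>
    by (simp add: abs_mult)
  ultimately show ?thesis by (simp add: algebra_simps)
qed

lemma L_tendsto: assumes t: "0 \<le> t" shows "(\<lambda>n. K n t / 2) \<longlonglongrightarrow> L t"
proof -
  have "(\<lambda>n. (1 + \<beta> * t) * sqrt (2 * \<epsilon> n * t)) \<longlonglongrightarrow> (1 + \<beta> * t) * 0"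
    by (intro tendsto_mult tendsto_const rate_tendsto)
  then have lim: "(\<lambda>n. (1 + \<beta> * t) * sqrt (2 * \<epsilon> n * t)) \<longlonglongrightarrow> 0" by simp
  have "(\<lambda>n. K n t / 2 - L t) \<longlonglongrightarrow> 0"
  proof (rule Lim_null_comparison[OF _ lim])
    have "norm (K n t / 2 - L t) \<le> (1 + \<beta> * t) * sqrt (2 * \<epsilon> n * t)" for n
      using L_rate[OF t order_refl, of n] by (simp only: real_norm_def abs_minus_commute)
    then show "\<forall>\<^sub>F n in sequentially. norm (K n t / 2 - L t) \<le> (1 + \<beta> * t) * sqrt (2 * \<epsilon> n * t)" by simp
  qed
  then show ?thesis by (simp add: LIM_zero_iff)
qed

lemma L_0: "L 0 = 0"
proof -
  have "(\<lambda>n. K n 0 / 2) = (\<lambda>_. 0)" by (simp add: singular_integral_0)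
  then have "(\<lambda>_. 0) \<longlonglongrightarrow> L 0" using L_tendsto[of 0] by simp
  from LIMSEQ_unique[OF this tendsto_const] show ?thesis .
qed

lemma L_mono:
  assumes st: "0 \<le> s" "s \<le> t" shows "L s \<le> L t"
proof -
  have t: "0 \<le> t" using st by simp
  have "K n s \<le> K n t" for n
    by (rule enn2real_mono[OF singular_integral_mono[OF st(2)]]) (use K_finite[OF t, of n] in simp)
  then have "\<exists>N. \<forall>n\<ge>N. K n s / 2 \<le> K n t / 2" by (simp add: divide_right_mono)
  then show ?thesis by (rule LIMSEQ_le[OF L_tendsto[OF st(1)] L_tendsto[OF t]])
qed

text \<open>
  Near a time with \<open>Y > 0\<close>, the solutions \<open>y n\<close> are uniformly bounded below, so that their
  singular drifts \<open>\<epsilon> n / y n\<close> vanish in the limit.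
\<close>
lemma growth_point_zero:
  assumes g: "growth_point L t"
  shows "Y t = 0"
proof (rule ccontr)
  assume "Y t \<noteq> 0"
  have t: "0 \<le> t" using g by (simp add: growth_point_def)
  have pos: "0 < Y t" using Y_nonneg[OF t] \<open>Y t \<noteq> 0\<close> by simp
  obtain \<delta> where \<delta>: "\<delta> > 0" "\<And>s. 0 \<le> s \<Longrightarrow> dist s t < \<delta> \<Longrightarrow> dist (Y s) (Y t) < Y t / 2"
  proof -
    have "0 < Y t / 2" using pos by simp
    then show ?thesis using Y_cont t that unfolding continuous_on_iff by (meson atLeast_iff)
  qed
  define p q where "p = max 0 (t - \<delta> / 2)" and "q = t + \<delta> / 2"
  have pq: "0 \<le> p" "p \<le> q" "0 \<le> q" using t \<delta>(1) by (auto simp: p_def q_def)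
  have near: "Y t / 2 \<le> Y s" if "s \<in> {p..q}" for s
  proof -
    have "dist s t < \<delta>" using that \<delta>(1) by (auto simp: p_def q_def dist_real_def)
    then have "dist (Y s) (Y t) < Y t / 2" using that pq by (intro \<delta>(2)) auto
    then show ?thesis by (simp add: dist_real_def abs_if split: if_splits)
  qed
  have "\<forall>\<^sub>F n in sequentially. sqrt (2 * \<epsilon> n * q) < Y t / 4"
    using rate_tendsto[of q] pos by (intro order_tendstoD) auto
  then have "\<forall>\<^sub>F n in sequentially. K n q / 2 - K n p / 2 \<le> \<epsilon> n * ((q - p) / (Y t / 4) / 2)"
  proof eventually_elim
    case (elim n)
    have "K n q - K n p \<le> \<epsilon> n / (Y t / 4) * (q - p)"
    proof (rule singular_integral_increment_le[OF y_cont pq(1,2) K_finite[OF pq(3)]])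
      fix s assume s: "s \<in> {p..q}"
      then have "0 \<le> s" "s \<le> q" using pq by auto
      from order_trans[OF Y_rate[OF this(1)] rate_mono[OF this(2)], of n]
      show "Y t / 4 \<le> y n s" using near[OF s] elim unfolding abs_le_iff by linarith
    qed (use \<epsilon>(1)[of n] pos in auto)
    moreover have "\<epsilon> n / h * (q - p) = 2 * (\<epsilon> n * ((q - p) / h / 2))" for h by simp
    ultimately have "K n q - K n p \<le> 2 * (\<epsilon> n * ((q - p) / (Y t / 4) / 2))" by metis
    then show ?case by linarith
  qed
  then have "L q - L p \<le> 0"
  proof (rule tendsto_le[OF sequentially_bot, rotated 2])
    show "(\<lambda>n. K n q / 2 - K n p / 2) \<longlonglongrightarrow> L q - L p" using pq by (intro tendsto_diff L_tendsto)
    show "(\<lambda>n. \<epsilon> n * ((q - p) / (Y t / 4) / 2)) \<longlonglongrightarrow> 0"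
      by (rule tendsto_mult_left_zero[OF \<epsilon>(3)])
  qed
  moreover have "L p < L q" using g \<delta>(1) unfolding growth_point_def p_def q_def by simp
  ultimately show False by simp
qed

end

section \<open>Convergence to the reflected Ornstein-Uhlenbeck process\<close>

lemma SUP_ereal_tendsto_0:
  fixes f :: "nat \<Rightarrow> real \<Rightarrow> real"
  assumes T: "0 < T" and f: "\<And>n t. t \<in> {0..T} \<Longrightarrow> 0 \<le> f n t" "\<And>n t. t \<in> {0..T} \<Longrightarrow> f n t \<le> e n"
    and e: "e \<longlonglongrightarrow> 0"
  shows "(\<lambda>n. SUP t\<in>{0..T}. ereal (f n t)) \<longlonglongrightarrow> 0"
proof (rule tendsto_sandwich[OF _ _ tendsto_const])
  have T0: "0 \<in> {0..T}" using T by simp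
  have "0 \<le> (SUP t\<in>{0..T}. ereal (f n t))" for n
    by (rule order_trans[OF _ SUP_upper[OF T0]]) (use f(1)[OF T0] in simp)
  then show "\<forall>\<^sub>F n in sequentially. 0 \<le> (SUP t\<in>{0..T}. ereal (f n t))" by simp
  have "(SUP t\<in>{0..T}. ereal (f n t)) \<le> ereal (e n)" for n
    by (rule SUP_least) (use f(2) in simp)
  then show "\<forall>\<^sub>F n in sequentially. (SUP t\<in>{0..T}. ereal (f n t)) \<le> ereal (e n)" by simp
  show "(\<lambda>n. ereal (e n)) \<longlonglongrightarrow> 0" using tendsto_ereal[OF e] by (simp add: zero_ereal_def)
qed

theorem theorem2p4:
  fixes M :: "'a measure"
    and W :: "real \<Rightarrow> 'a \<Rightarrow> real"
    and X :: "nat \<Rightarrow> real \<Rightarrow> 'a \<Rightarrow> real"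
    and y0 b \<sigma> :: real
    and \<epsilon> :: "nat \<Rightarrow> real"
  assumes "prob_space M"
    and "brownian_motion M W"
    and "0 < y0" "0 < b" "0 < \<sigma>"
    and "\<And>n. 0 < \<epsilon> n" "decseq \<epsilon>" "\<epsilon> \<longlonglongrightarrow> 0"
    and "\<And>n. cir_process M W (y0\<^sup>2) (\<sigma>\<^sup>2 / 4 + \<epsilon> n) b \<sigma> (X n)"
  shows "\<exists>Y L.
     (AE \<omega> in M. \<forall>t\<ge>0. (\<lambda>n. sqrt (X n t \<omega>)) \<longlonglongrightarrow> Y t \<omega> \<and> 0 \<le> Y t \<omega>) \<and>
     reflected_OU_process M W y0 (b / 2) (\<sigma> / 2) Y L \<and>
     (AE \<omega> in M. \<forall>T>0.
        (\<lambda>n. SUP t\<in>{0..T}. ereal \<bar>Y t \<omega> - sqrt (X n t \<omega>)\<bar>) \<longlonglongrightarrow> 0 \<and>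
        (\<lambda>n. SUP t\<in>{0..T}.
           \<bar>ereal (L t \<omega>) - ereal (1 / 2) * recip_integral (\<epsilon> n) (\<lambda>s. sqrt (X n s \<omega>)) t\<bar>)
          \<longlonglongrightarrow> 0)"
proof -
  let ?y = "\<lambda>\<omega> n s. sqrt (X n s \<omega>)"
  define Y where "Y t \<omega> = lim (\<lambda>n. ?y \<omega> n t)" for t \<omega>
  \<comment> \<open>The time integral of \<open>Y\<close> is written as a limit of Riemann sums to make it measurable on the
    exceptional null set as well, where \<open>Y\<close> need not be integrable.\<close>
  define L where "L t \<omega> = lim (\<lambda>m. Y t \<omega> - y0 + b / 2 * (\<Sum>j<Suc m. Y (grid t m j) \<omega> * (t / real (Suc m))) - \<sigma> / 2 * W t \<omega>)" for t \<omega>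
  have Wc: "continuous_process M W" and W0: "AE \<omega> in M. W 0 \<omega> = 0"
    using assms(2) unfolding brownian_motion_def by blast+
  have Xm: "\<And>n t. 0 \<le> t \<Longrightarrow> X n t \<in> borel_measurable M"
    using assms(9) unfolding cir_process_def continuous_process_def stochastic_process_def by blast
  have Wm: "\<And>t. 0 \<le> t \<Longrightarrow> W t \<in> borel_measurable M"
    using Wc unfolding continuous_process_def stochastic_process_def by blast
  have Ym: "Y t \<in> borel_measurable M" if "0 \<le> t" for t
    unfolding Y_def using Xm[OF that] by measurable
  have Lm: "L t \<in> borel_measurable M" if t: "0 \<le> t" for t
  proof -
    note [measurable] = Ym[OF t] Wm[OF t] Ym[OF grid_nonneg[OF t]]
    show ?thesis unfolding L_def by measurable
  qed
  have all_n: "AE \<omega> in M. \<forall>n. singular_solution y0 (b / 2) (\<sigma> / 2) (\<lambda>t. W t \<omega>) (\<epsilon> n) (?y \<omega> n)"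
    unfolding AE_all_countable
    by (rule allI) (rule cir_sqrt_singular_solution[OF assms(1,2,3) assms(6) assms(9)])
  have Wcont: "AE \<omega> in M. continuous_on {0..} (\<lambda>t. W t \<omega>)" using Wc unfolding continuous_process_def by blast
  have path: "AE \<omega> in M. singular_limit y0 (b / 2) (\<sigma> / 2) (\<lambda>t. W t \<omega>) \<epsilon> (?y \<omega>)"
    using all_n Wcont W0
  proof eventually_elim
    case (elim \<omega>)
    show ?case
      by (rule singular_limit.intro) (use elim assms(4,6,7,8) in simp_all)
  qed
  have L_eq: "L t \<omega> = singular_limit.L y0 (b / 2) (\<sigma> / 2) (\<lambda>t. W t \<omega>) (?y \<omega>) t"
    if p: "singular_limit y0 (b / 2) (\<sigma> / 2) (\<lambda>t. W t \<omega>) \<epsilon> (?y \<omega>)" and t: "0 \<le> t" for \<omega> t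
  proof -
    interpret p: singular_limit y0 "b / 2" "\<sigma> / 2" "\<lambda>t. W t \<omega>" \<epsilon> "?y \<omega>" by (rule p)
    have Y: "p.Y = (\<lambda>s. Y s \<omega>)" by (simp add: fun_eq_iff p.Y_def Y_def)
    have "(\<lambda>m. \<Sum>j<Suc m. Y (grid t m j) \<omega> * (t / real (Suc m))) \<longlonglongrightarrow> integral {0..t} (\<lambda>s. Y s \<omega>)"
      by (rule grid_riemann_sum_tendsto[OF t p.Y_cont_Icc[unfolded Y]])
    then have "(\<lambda>m. Y t \<omega> - y0 + b / 2 * (\<Sum>j<Suc m. Y (grid t m j) \<omega> * (t / real (Suc m))) - \<sigma> / 2 * W t \<omega>)
      \<longlonglongrightarrow> Y t \<omega> - y0 + b / 2 * integral {0..t} (\<lambda>s. Y s \<omega>) - \<sigma> / 2 * W t \<omega>"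
      by (intro tendsto_diff tendsto_add tendsto_mult tendsto_const)
    then show ?thesis unfolding L_def p.L_def Y by (rule limI)
  qed
  have conv: "AE \<omega> in M. \<forall>t\<ge>0. (\<lambda>n. sqrt (X n t \<omega>)) \<longlonglongrightarrow> Y t \<omega> \<and> 0 \<le> Y t \<omega>"
    using path
  proof eventually_elim
    case (elim \<omega>)
    then interpret p: singular_limit y0 "b / 2" "\<sigma> / 2" "\<lambda>t. W t \<omega>" \<epsilon> "?y \<omega>" .
    show ?case using p.y_tendsto p.Y_nonneg unfolding p.Y_def Y_def by blast
  qed
  have reflection: "reflection_function M Y L"
    unfolding reflection_function_def continuous_process_def stochastic_process_def
  proof (intro conjI allI impI)
    show "L t \<in> borel_measurable M" if "0 \<le> t" for t by (rule Lm[OF that])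
    show "AE \<omega> in M. continuous_on {0..} (\<lambda>t. L t \<omega>)"
      using path
    proof eventually_elim
      case (elim \<omega>)
      then interpret p: singular_limit y0 "b / 2" "\<sigma> / 2" "\<lambda>t. W t \<omega>" \<epsilon> "?y \<omega>" .
      show ?case
        by (rule continuous_on_eq[OF p.L_cont]) (use L_eq[OF elim] in simp)
    qed
    show "AE \<omega> in M. mono_on {0..} (\<lambda>t. L t \<omega>) \<and> L 0 \<omega> = 0 \<and>
        (\<forall>t. growth_point (\<lambda>s. L s \<omega>) t \<longrightarrow> Y t \<omega> = 0)"
      using path
    proof eventually_elim
      case (elim \<omega>)
      then interpret p: singular_limit y0 "b / 2" "\<sigma> / 2" "\<lambda>t. W t \<omega>" \<epsilon> "?y \<omega>" .
      note L = L_eq[OF elim]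
      have "mono_on {0..} (\<lambda>t. L t \<omega>)"
        by (rule mono_onI) (use L p.L_mono in simp)
      moreover have "L 0 \<omega> = 0" using L[of 0] p.L_0 by simp
      moreover have "Y t \<omega> = 0" if g: "growth_point (\<lambda>s. L s \<omega>) t" for t
      proof -
        have "growth_point p.L t"
          unfolding growth_point_def
        proof (intro conjI allI impI)
          show t: "0 \<le> t" using g by (simp add: growth_point_def)
          fix \<delta> :: real assume "0 < \<delta>"
          then have "L (max 0 (t - \<delta>)) \<omega> < L (t + \<delta>) \<omega>" using g by (simp add: growth_point_def)
          then show "p.L (max 0 (t - \<delta>)) < p.L (t + \<delta>)" using L t \<open>0 < \<delta>\<close> by simp
        qed
        then have "p.Y t = 0" by (rule p.growth_point_zero)
        then show ?thesis by (simp add: p.Y_def Y_def)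
      qed
      ultimately show ?case by blast
    qed
  qed
  have eq: "AE \<omega> in M. \<forall>t\<ge>0. set_integrable lborel {0..t} (\<lambda>s. Y s \<omega>) \<and>
        Y t \<omega> = y0 - b / 2 * (LBINT s:{0..t}. Y s \<omega>) + \<sigma> / 2 * W t \<omega> + L t \<omega>"
    using path
  proof eventually_elim
    case (elim \<omega>)
    then interpret p: singular_limit y0 "b / 2" "\<sigma> / 2" "\<lambda>t. W t \<omega>" \<epsilon> "?y \<omega>" .
    have Y: "p.Y = (\<lambda>s. Y s \<omega>)" by (simp add: fun_eq_iff p.Y_def Y_def)
    show ?case
    proof (intro allI impI)
      fix t :: real assume t: "0 \<le> t"
      have si: "set_integrable lborel {0..t} (\<lambda>s. Y s \<omega>)"
        by (rule borel_integrable_atLeastAtMost'[OF p.Y_cont_Icc[unfolded Y]])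
      have "L t \<omega> = Y t \<omega> - y0 + b / 2 * (LBINT s:{0..t}. Y s \<omega>) - \<sigma> / 2 * W t \<omega>"
        unfolding L_eq[OF elim t] p.L_def Y set_borel_integral_eq_integral(2)[OF si] ..
      with si show "set_integrable lborel {0..t} (\<lambda>s. Y s \<omega>) \<and>
        Y t \<omega> = y0 - b / 2 * (LBINT s:{0..t}. Y s \<omega>) + \<sigma> / 2 * W t \<omega> + L t \<omega>" by simp
    qed
  qed
  have rou: "reflected_OU_process M W y0 (b / 2) (\<sigma> / 2) Y L"
    unfolding reflected_OU_process_def stochastic_process_def
  proof (intro conjI allI impI)
    show "AE \<omega> in M. \<forall>t\<ge>0. 0 \<le> Y t \<omega>" using conv by eventually_elim blast
  qed (use assms(3,4,5) Ym reflection eq in simp_all)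
  have unif: "AE \<omega> in M. \<forall>T>0.
        (\<lambda>n. SUP t\<in>{0..T}. ereal \<bar>Y t \<omega> - sqrt (X n t \<omega>)\<bar>) \<longlonglongrightarrow> 0 \<and>
        (\<lambda>n. SUP t\<in>{0..T}.
           \<bar>ereal (L t \<omega>) - ereal (1 / 2) * recip_integral (\<epsilon> n) (\<lambda>s. sqrt (X n s \<omega>)) t\<bar>)
          \<longlonglongrightarrow> 0"
    using path
  proof eventually_elim
    case (elim \<omega>)
    then interpret p: singular_limit y0 "b / 2" "\<sigma> / 2" "\<lambda>t. W t \<omega>" \<epsilon> "?y \<omega>" .
    have Y: "p.Y = (\<lambda>s. Y s \<omega>)" by (simp add: fun_eq_iff p.Y_def Y_def)
    have recip: "\<bar>ereal (L t \<omega>) - ereal (1 / 2) * recip_integral (\<epsilon> n) (\<lambda>s. sqrt (X n s \<omega>)) t\<bar>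
        = ereal \<bar>p.L t - p.K n t / 2\<bar>" if t: "0 \<le> t" for n t
    proof -
      have fin: "singular_integral (\<epsilon> n) (?y \<omega> n) t < \<infinity>" by (rule p.K_finite[OF t])
      have "recip_integral (\<epsilon> n) (\<lambda>s. sqrt (X n s \<omega>)) t = enn2ereal (singular_integral (\<epsilon> n) (?y \<omega> n) t)"
        by (simp add: recip_integral_def singular_integral_def)
      also have "\<dots> = ereal (p.K n t)"
        using fin by (cases "singular_integral (\<epsilon> n) (?y \<omega> n) t") (auto simp: enn2ereal_ennreal)
      finally show ?thesis by (simp add: L_eq[OF elim t])
    qed
    show ?case
    proof (intro allI impI conjI)
      fix T :: real assume T: "0 < T"
      show "(\<lambda>n. SUP t\<in>{0..T}. ereal \<bar>Y t \<omega> - sqrt (X n t \<omega>)\<bar>) \<longlonglongrightarrow> 0"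
      proof (rule SUP_ereal_tendsto_0[OF T _ _ p.rate_tendsto])
        fix n t assume "t \<in> {0..T}"
        then have "0 \<le> t" "t \<le> T" by auto
        from order_trans[OF p.Y_rate[OF this(1)] p.rate_mono[OF this(2)]]
        show "\<bar>Y t \<omega> - sqrt (X n t \<omega>)\<bar> \<le> sqrt (2 * \<epsilon> n * T)" unfolding Y .
      qed simp
      have "(\<lambda>n. SUP t\<in>{0..T}. ereal \<bar>p.L t - p.K n t / 2\<bar>) \<longlonglongrightarrow> 0"
      proof (rule SUP_ereal_tendsto_0[OF T])
        show "(\<lambda>n. (1 + b / 2 * T) * sqrt (2 * \<epsilon> n * T)) \<longlonglongrightarrow> 0"
          using tendsto_mult[OF tendsto_const p.rate_tendsto] by simp
        show "\<bar>p.L t - p.K n t / 2\<bar> \<le> (1 + b / 2 * T) * sqrt (2 * \<epsilon> n * T)" if "t \<in> {0..T}" for n t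
          using that by (intro p.L_rate) auto
      qed simp
      moreover have "(SUP t\<in>{0..T}. \<bar>ereal (L t \<omega>) - ereal (1 / 2) * recip_integral (\<epsilon> n) (\<lambda>s. sqrt (X n s \<omega>)) t\<bar>)
          = (SUP t\<in>{0..T}. ereal \<bar>p.L t - p.K n t / 2\<bar>)" for n
        by (rule SUP_cong[OF refl]) (use recip in auto)
      ultimately show "(\<lambda>n. SUP t\<in>{0..T}. \<bar>ereal (L t \<omega>) - ereal (1 / 2) * recip_integral (\<epsilon> n) (\<lambda>s. sqrt (X n s \<omega>)) t\<bar>) \<longlonglongrightarrow> 0"
        by simp
    qed
  qed
  show ?thesis by (rule exI[where x = Y], rule exI[where x = L]) (intro conjI conv rou unif)
qed

end
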